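(* For $i=1,\dots,K$ let $\theta^{(i)}>0$ and $\tau^{(i)}\neq0$ denote constants, and let $X^{(i)}$ be a $(\theta^{(i)},\tau^{(i)})$ GMSI process on $[0,\Delta)$, where $0<\Delta\le\min\{\theta^{(i)}/\tau^{(i)}:1\le i\le K,\ \tau^{(i)}>0\}$ if $\tau^{(i)}>0$ for some $i$, and $0<\Delta\le\infty$ otherwise. Assume that the $X^{(i)}$ are independent of one another. Let $k_1,\dots,k_K$ and $\rho$ be constants, let $Z(t)=\rho t+\sum_{i=1}^Kk_iX^{(i)}(t)$ for $0\le t<\Delta$, and let $Q(t)=Q(0)+Z(t)+L(t)$ be the queue-length process with net input $Z$ and initial value $Q(0)\ge0$. For $0\le u<\Delta$ and $0<h<\Delta-u$, let $Q_{u;\vec x,v}(h)$ denote $Q(u+h)$ conditional on $Q(u)=v$ and on $X^{(i)}(u)=x_i$ for $i=1,\dots,K$. Then $$P(Q_{u;\vec x,v}(h)\le q)=\frac12\left(1-e^{\frac{-2q(\tau_uq-\theta\rho_{u;\vec x})}{\theta^2}}-\mathrm{erf}\!\left(\frac{-q+v+\rho_{u;\vec x}h}{\sqrt{2h(\theta-\tau_uh)}}\right)+e^{\frac{-2q(\tau_uq-\theta\rho_{u;\vec x})}{\theta^2}}\,\mathrm{erf}\!\left(\frac{\theta(q+v)-(2\tau_uq-\theta\rho_{u;\vec x})h}{\theta\sqrt{2h(\theta-\tau_uh)}}\right)\right),$$ where $$\theta=\sum_{i=1}^Kk_i^2\theta^{(i)},\qquad\tau_u=\sum_{i=1}^Kk_i^2\frac{\theta^{(i)}}{\theta^{(i)}/\tau^{(i)}-u},\qquad\rho_{u;\vec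 x}=\rho-\sum_{i=1}^K\frac{k_ix_i}{\theta^{(i)}/\tau^{(i)}-u}.$$
   Context: A $(\theta,\tau)$ GMSI process on $[0,\Delta)$ (where $0<\Delta\le\infty$, $\theta>0$, $\tau\le\theta/\Delta$, with $\theta/\infty=0$) is a real, continuous, zero-mean Gaussian Markov process $X$ with $X(0)=0$, stationary increments, and covariance $E[X(s)X(t)]=s(\theta-\tau t)$ for $0\le s\le t<\Delta$. Queue-length process: $Q(t)=Q(0)+Z(t)+L(t)$, where $Q(0)\ge0$ and $L$ is a non-decreasing continuous function with $L(0)=0$ that increases only when $Q=0$, such that $Q(t)\ge0$ for all $0\le t<\Delta$. $\vec x=(x_1,\dots,x_K)$ and $\mathrm{erf}(z)=2\pi^{-1/2}\int_0^z e^{-t^2}\,dt$.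
   Formalization: The formula is proved for q ≥ 0 (it fails for q < 0, where the probability is 0), with at least one k_i nonzero (otherwise θ = 0), and with Q(0) constant or, if random, independent of the processes X^{(i)} (it fails for arbitrarily dependent Q(0)). *)

theory Defs
  imports "HOL-Probability.Probability"
begin

definition time_set :: "ereal \<Rightarrow> real set" where
  "time_set \<Delta> = {t. 0 \<le> t \<and> ereal t < \<Delta>}"

text \<open>Constants are normal random variables of variance zero, so that
  \<open>X 0 = 0\<close> does not prevent a process \<open>X\<close> from being Gaussian.\<close>

definition gaussian_rv :: "'a measure \<Rightarrow> ('a \<Rightarrow> real) \<Rightarrow> bool" where
  "gaussian_rv M Y \<longleftrightarrow> Y \<in> borel_measurable M \<and>
     ((\<exists>\<mu>. AE \<omega> in M. Y \<omega> = \<mu>) \<or>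
      (\<exists>\<mu> \<sigma>. \<sigma> > 0 \<and> distributed M lborel Y (normal_density \<mu> \<sigma>)))"

definition gaussian_process :: "'a measure \<Rightarrow> real set \<Rightarrow> (real \<Rightarrow> 'a \<Rightarrow> real) \<Rightarrow> bool" where
  "gaussian_process M T X \<longleftrightarrow>
     (\<forall>J c. finite J \<and> J \<subseteq> T \<longrightarrow> gaussian_rv M (\<lambda>\<omega>. \<Sum>t\<in>J. c t * X t \<omega>))"

definition past :: "'a measure \<Rightarrow> real set \<Rightarrow> (real \<Rightarrow> 'a \<Rightarrow> real) \<Rightarrow> real \<Rightarrow> 'a measure" where
  "past M T X s =
     vimage_algebra (space M) (\<lambda>\<omega>. \<lambda>r\<in>T \<inter> {..s}. X r \<omega>) (\<Pi>\<^sub>M r\<in>T \<inter> {..s}. borel)"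

definition markov_process :: "'a measure \<Rightarrow> real set \<Rightarrow> (real \<Rightarrow> 'a \<Rightarrow> real) \<Rightarrow> bool" where
  "markov_process M T X \<longleftrightarrow>
     (\<forall>t\<in>T. X t \<in> borel_measurable M) \<and>
     (\<forall>s\<in>T. \<forall>t\<in>T. s \<le> t \<longrightarrow> (\<forall>B\<in>sets borel. AE \<omega> in M.
        real_cond_exp M (past M T X s) (indicator (X t -` B \<inter> space M)) \<omega> =
        real_cond_exp M (vimage_algebra (space M) (X s) borel) (indicator (X t -` B \<inter> space M)) \<omega>))"

definition stationary_increments :: "'a measure \<Rightarrow> real set \<Rightarrow> (real \<Rightarrow> 'a \<Rightarrow> real) \<Rightarrow> bool" where
  "stationary_increments M T X \<longleftrightarrow>
     (\<forall>s t d. s \<in> T \<and> t \<in> T \<and> s + d \<in> T \<and> t + d \<in> T \<longrightarrow>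
        distr M borel (\<lambda>\<omega>. X (t + d) \<omega> - X (s + d) \<omega>) = distr M borel (\<lambda>\<omega>. X t \<omega> - X s \<omega>))"

text \<open>Note that \<open>ereal \<theta> / \<infinity> = 0\<close>.\<close>

definition gmsi_process ::
  "'a measure \<Rightarrow> ereal \<Rightarrow> real \<Rightarrow> real \<Rightarrow> (real \<Rightarrow> 'a \<Rightarrow> real) \<Rightarrow> bool" where
  "gmsi_process M \<Delta> \<theta> \<tau> X \<longleftrightarrow>
     0 < \<Delta> \<and> 0 < \<theta> \<and> ereal \<tau> \<le> ereal \<theta> / \<Delta> \<and>
     gaussian_process M (time_set \<Delta>) X \<and>
     markov_process M (time_set \<Delta>) X \<and>
     stationary_increments M (time_set \<Delta>) X \<and>
     (AE \<omega> in M. X 0 \<omega> = 0 \<and> continuous_on (time_set \<Delta>) (\<lambda>t. X t \<omega>)) \<and>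
     (\<forall>t\<in>time_set \<Delta>. prob_space.expectation M (X t) = 0) \<and>
     (\<forall>s\<in>time_set \<Delta>. \<forall>t\<in>time_set \<Delta>. s \<le> t \<longrightarrow>
        prob_space.expectation M (\<lambda>\<omega>. X s \<omega> * X t \<omega>) = s * (\<theta> - \<tau> * t))"

text \<open>The last clause says that \<open>l\<close> increases only when \<open>q = 0\<close>: it is constant on
  every time interval on which \<open>q\<close> is positive.\<close>

definition queue_length_path ::
  "ereal \<Rightarrow> (real \<Rightarrow> real) \<Rightarrow> (real \<Rightarrow> real) \<Rightarrow> (real \<Rightarrow> real) \<Rightarrow> bool" where
  "queue_length_path \<Delta> z l q \<longleftrightarrow>
     (\<forall>t\<in>time_set \<Delta>. q t = q 0 + z t + l t) \<and>
     (\<forall>t\<in>time_set \<Delta>. 0 \<le> q t) \<and>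
     l 0 = 0 \<and>
     continuous_on (time_set \<Delta>) l \<and>
     mono_on (time_set \<Delta>) l \<and>
     (\<forall>s\<in>time_set \<Delta>. \<forall>t\<in>time_set \<Delta>. s \<le> t \<and> (\<forall>r\<in>{s..t}. 0 < q r) \<longrightarrow> l s = l t)"

text \<open>\<open>\<kappa> t\<close> is the distribution of \<open>Y\<close> conditional on \<open>T = t\<close>. The events \<open>T = t\<close> may be
  null, so this is a regular conditional distribution; \<open>\<kappa>\<close> is determined up to null sets
  of the law of \<open>T\<close>.\<close>

definition regular_conditional_distribution ::
  "'a measure \<Rightarrow> 'b measure \<Rightarrow> ('a \<Rightarrow> 'b) \<Rightarrow> 'c measure \<Rightarrow> ('a \<Rightarrow> 'c) \<Rightarrow> ('b \<Rightarrow> 'c measure) \<Rightarrow> bool"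
  where
  "regular_conditional_distribution M N T R Y \<kappa> \<longleftrightarrow>
     T \<in> measurable M N \<and> Y \<in> measurable M R \<and> \<kappa> \<in> measurable N (prob_algebra R) \<and>
     (\<forall>B\<in>sets R. AE \<omega> in M.
        real_cond_exp M (vimage_algebra (space M) T N) (indicator (Y -` B \<inter> space M)) \<omega> =
        measure (\<kappa> (T \<omega>)) B)"

text \<open>The interval integral is oriented, so this is the usual odd function for \<open>z < 0\<close>.\<close>

definition erf :: "real \<Rightarrow> real" where
  "erf z = 2 / sqrt pi * (LBINT t=ereal 0..ereal z. exp (- (t\<^sup>2)))"

end

theory Submission
  imports Defs "HOL-Real_Asymp.Real_Asymp"
begin

text \<open>Let \<open>Y(s)\<close> be the increment over \<open>[u, u + s]\<close> of \<open>\<Sum> k\<^sub>i X\<^sub>i\<close>, minus its linear prediction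
  from the \<open>X\<^sub>i(u)\<close>. It is a centered Gaussian process with covariance \<open>s (\<theta> - \<tau>\<^sub>u t)\<close>, uncorrelated
  with, hence independent of, the \<open>X\<^sub>i\<close> up to time \<open>u\<close>, and \<open>Z(u + s) - Z(u) = \<rho>\<^sub>u s + Y(s)\<close>.
  Pathwise, \<open>Q(u + h) = max (Q(u) + Z(u + h) - Z(u)) (sup\<^sub>s (Z(u + h) - Z(u + s)))\<close>. After time
  reversal this asks for the joint law of the endpoint and the maximum of a process that, given its
  endpoint, is a Brownian bridge. The crossing probability \<open>exp (-2 q (q - y) / (\<theta> h))\<close> of a bridge
  ending in \<open>y\<close> follows from the reflection principle, and integrating it against the normal law of
  the endpoint gives the formula.\<close>

section \<open>Uniqueness of laws\<close>

text \<open>\<open>Q u\<close> is not Gaussian, so vanishing covariances alone cannot separate it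
  from the residual \<open>Y\<close>. It is written as a measurable function of \<open>Q 0\<close>
  and of the \<open>X i\<close> on \<open>[0, u]\<close>; the assumed independence of
  \<open>Q 0\<close> from the whole family then makes \<open>Y\<close> independent of
  \<open>Q u\<close> and the \<open>X i u\<close> jointly, and the conditional law arises by
  freezing these values.

  The bridge does not see \<open>\<tau>u\<close>: removing the interpolated endpoint leaves
  covariance \<open>\<theta> * s * (1 - t / h)\<close>, and a drift only moves the endpoint. It can
  therefore be completed to a Brownian motion with an artificial endpoint of variance
  \<open>\<theta> * h\<close>, while the true variance \<open>h * (\<theta> - \<tau>u * h)\<close>
  enters in the last integral. Comparing densities in the reflection identity yields the crossing
  probability for almost every endpoint, which is enough because the endpoint has a density.

  Paths are continuous only almost surely, so all suprema run over dyadic times, where measurability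
  is automatic. Joint Gaussian laws are identified through integrals of \<open>cos (s + Y)\<close>,
  whose free phase \<open>s\<close> encodes the complex characteristic function in real
  terms.\<close>

lemma weighted_law_char:
  fixes W k :: "'c \<Rightarrow> real"
  assumes P: "prob_space P" and [measurable]: "W \<in> borel_measurable P" "k \<in> borel_measurable P"
    and k: "\<And>x. 0 \<le> k x" "\<And>x. k x \<le> C" and mk: "(\<integral>\<omega>. k \<omega> \<partial>P) = m" and m: "0 < m"
    and B[measurable]: "B \<in> sets borel"
  defines "D \<equiv> distr (density P (\<lambda>x. ennreal (k x / m))) borel W"
  shows "real_distribution D"
    and "char D t = complex_of_real ((\<integral>\<omega>. k \<omega> * cos (0 + t * W \<omega>) \<partial>P) / m)
          + \<i> * complex_of_real ((\<integral>\<omega>. k \<omega> * cos (-(pi/2) + t * W \<omega>) \<partial>P) / m)"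
    and "measure D B = (\<integral>\<omega>. k \<omega> * indicator B (W \<omega>) \<partial>P) / m"
proof -
  interpret P: prob_space P by fact
  have intk: "integrable P k"
    by (rule P.integrable_const_bound[where B=C]) (use k in auto)
  have "emeasure (density P (\<lambda>x. ennreal (k x / m))) (space P) = (\<integral>\<^sup>+x. ennreal (k x / m) \<partial>P)"
    by (subst emeasure_density) (auto intro!: nn_integral_cong)
  also have "\<dots> = ennreal (\<integral>x. k x / m \<partial>P)"
    using k m intk by (intro nn_integral_eq_integral) auto
  also have "\<dots> = 1" using mk m by simp
  finally have "prob_space (density P (\<lambda>x. ennreal (k x / m)))"
    by (intro prob_spaceI) simp
  then interpret D: prob_space "density P (\<lambda>x. ennreal (k x / m))" .
  show "real_distribution D" unfolding D_def
    by (rule D.real_distribution_distr) simp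
  have ibd: "integrable P (\<lambda>x. k x * cos (a + t * W x))" for a t
    by (rule Bochner_Integration.integrable_bound[OF intk])
       (use k in \<open>auto simp: abs_mult intro!: AE_I2 mult_left_le\<close>)
  have "char D t = (CLINT x|P. (k x / m) *\<^sub>R iexp (t * W x))"
    unfolding char_def D_def using k m by (subst integral_distr) (auto simp: integral_density)
  \<comment> \<open>The shift by \<open>-(pi/2)\<close> turns the cosine into a sine, so
    phase-shifted cosines also supply the imaginary part of the characteristic function.\<close>
  also have "\<dots> = (CLINT x|P. complex_of_real (k x * cos (0 + t * W x) / m) + \<i> * complex_of_real (k x * cos (-(pi/2) + t * W x) / m))"
    by (intro Bochner_Integration.integral_cong refl)
       (simp add: complex_eq_iff Re_exp Im_exp cos_diff cos_add)
  also have "\<dots> = (CLINT x|P. complex_of_real (k x * cos (0 + t * W x) / m)) + (CLINT x|P. \<i> * complex_of_real (k x * cos (-(pi/2) + t * W x) / m))"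
    by (intro Bochner_Integration.integral_add Bochner_Integration.integrable_mult_right integrable_of_real Bochner_Integration.integrable_divide ibd)
  finally show "char D t = complex_of_real ((\<integral>\<omega>. k \<omega> * cos (0 + t * W \<omega>) \<partial>P) / m)
      + \<i> * complex_of_real ((\<integral>\<omega>. k \<omega> * cos (-(pi/2) + t * W \<omega>) \<partial>P) / m)"
    by (simp del: of_real_mult add: of_real_mult[symmetric])
  have "measure D B = (\<integral>x. indicator B x \<partial>D)"
    by (simp add: D_def)
  also have "\<dots> = (\<integral>x. (k x / m) *\<^sub>R indicator B (W x) \<partial>P)"
    unfolding D_def using k m by (subst integral_distr) (auto simp: integral_density)
  finally show "measure D B = (\<integral>\<omega>. k \<omega> * indicator B (W \<omega>) \<partial>P) / m"
    by simp
qed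

text \<open>Divided by their common mass, \<open>f\<close> and \<open>g\<close> become probability
  densities under which \<open>X\<close> and \<open>Y\<close> have the same characteristic function,
  and Levy's uniqueness theorem applies. The instance \<open>s = t = 0\<close> shows that the masses
  agree; if they vanish, both weights are zero almost everywhere.\<close>

lemma weighted_cos_uniqueness:
  fixes X :: "'a \<Rightarrow> real" and Y :: "'b \<Rightarrow> real" and f :: "'a \<Rightarrow> real" and g :: "'b \<Rightarrow> real"
  assumes M: "prob_space M" and N: "prob_space N"
    and X[measurable]: "X \<in> borel_measurable M" and Y[measurable]: "Y \<in> borel_measurable N"
    and f0[measurable]: "f \<in> borel_measurable M" and g0[measurable]: "g \<in> borel_measurable N"
    and f: "\<And>x. 0 \<le> f x" "\<And>x. f x \<le> C" and g: "\<And>x. 0 \<le> g x" "\<And>x. g x \<le> C"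
    and eq: "\<And>s t. (\<integral>\<omega>. f \<omega> * cos (s + t * X \<omega>) \<partial>M) = (\<integral>\<omega>. g \<omega> * cos (s + t * Y \<omega>) \<partial>N)"
    and B[measurable]: "B \<in> sets borel"
  shows "(\<integral>\<omega>. f \<omega> * indicator B (X \<omega>) \<partial>M) = (\<integral>\<omega>. g \<omega> * indicator B (Y \<omega>) \<partial>N)"
proof -
  interpret M: prob_space M by fact
  interpret N: prob_space N by fact
  have intf: "integrable M f"
    by (rule M.integrable_const_bound[where B=C]) (use f in auto)
  have intg: "integrable N g"
    by (rule N.integrable_const_bound[where B=C]) (use g in auto)
  define m where "m = (\<integral>\<omega>. f \<omega> \<partial>M)"
  have mg: "m = (\<integral>\<omega>. g \<omega> \<partial>N)"
    using eq[of 0 0] by (simp add: m_def)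
  have m0: "0 \<le> m" unfolding m_def using f by simp
  show ?thesis
  proof (cases "m = 0")
    case True
    have "AE x in M. f x = 0" using integral_nonneg_eq_0_iff_AE[OF intf] f True by (simp add: m_def)
    then have "(\<integral>\<omega>. f \<omega> * indicator B (X \<omega>) \<partial>M) = 0"
      by (intro integral_eq_zero_AE) auto
    moreover have "AE x in N. g x = 0" using integral_nonneg_eq_0_iff_AE[OF intg] g True mg by simp
    then have "(\<integral>\<omega>. g \<omega> * indicator B (Y \<omega>) \<partial>N) = 0"
      by (intro integral_eq_zero_AE) auto
    ultimately show ?thesis by simp
  next
    case False
    then have m: "0 < m" using m0 by simp
    note L = weighted_law_char[OF M X f0 f m_def[symmetric] m B]
    note R = weighted_law_char[OF N Y g0 g mg[symmetric] m B]
    have "distr (density M (\<lambda>x. ennreal (f x / m))) borel X = distr (density N (\<lambda>x. ennreal (g x / m))) borel Y"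
      by (rule Levy_uniqueness[OF L(1) R(1)]) (simp only: fun_eq_iff L(2) R(2) eq, simp)
    then show ?thesis using L(3) R(3) m by simp
  qed
qed

text \<open>The indicator factors are introduced one coordinate at a time. Multiplying by the nonnegative
  weight \<open>1 + cos (s + \<dots>)\<close> of the remaining coordinates keeps the one-dimensional uniqueness
  theorem applicable at each step.\<close>

lemma cos_integrals_determine_boxes:
  fixes X :: "'i \<Rightarrow> 'a \<Rightarrow> real" and Y :: "'i \<Rightarrow> 'b \<Rightarrow> real"
  assumes M: "prob_space M" and N: "prob_space N" and I: "finite I"
    and X[measurable]: "\<And>i. i \<in> I \<Longrightarrow> X i \<in> borel_measurable M"
    and Y[measurable]: "\<And>i. i \<in> I \<Longrightarrow> Y i \<in> borel_measurable N"
    and eq: "\<And>s c. (\<integral>\<omega>. cos (s + (\<Sum>i\<in>I. c i * X i \<omega>)) \<partial>M) = (\<integral>\<omega>. cos (s + (\<Sum>i\<in>I. c i * Y i \<omega>)) \<partial>N)"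
    and B[measurable]: "\<And>i. i \<in> I \<Longrightarrow> B i \<in> sets borel"
  shows "(\<integral>\<omega>. (\<Prod>i\<in>I. indicator (B i) (X i \<omega>) :: real) \<partial>M) = (\<integral>\<omega>. (\<Prod>i\<in>I. indicator (B i) (Y i \<omega>)) \<partial>N)"
proof -
  interpret M: prob_space M by fact
  interpret N: prob_space N by fact
  have "(\<integral>\<omega>. (\<Prod>i\<in>J. indicator (B i) (X i \<omega>)) * cos (s + (\<Sum>i\<in>I-J. c i * X i \<omega>)) \<partial>M)
      = (\<integral>\<omega>. (\<Prod>i\<in>J. indicator (B i) (Y i \<omega>)) * cos (s + (\<Sum>i\<in>I-J. c i * Y i \<omega>)) \<partial>N)"
    if "finite J" "J \<subseteq> I" for J s c
    using that
  proof (induction J arbitrary: s c)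
    case empty
    then show ?case using eq by simp
  next
    case (insert j J)
    define K where "K = I - insert j J"
    have K: "finite K" "j \<notin> K" "I - J = insert j K" "K \<subseteq> I" using insert I by (auto simp: K_def)
    have jI: "j \<in> I" and JI: "J \<subseteq> I" using insert by auto
    note [measurable] = X[OF jI] Y[OF jI] B[OF jI]
    have [measurable]: "i \<in> J \<Longrightarrow> X i \<in> borel_measurable M" "i \<in> J \<Longrightarrow> Y i \<in> borel_measurable N"
      "i \<in> J \<Longrightarrow> B i \<in> sets borel"
      "i \<in> K \<Longrightarrow> X i \<in> borel_measurable M" "i \<in> K \<Longrightarrow> Y i \<in> borel_measurable N" for i
      using X Y B JI K by auto
    define p q a b where "p = (\<lambda>\<omega>. (\<Prod>i\<in>J. indicator (B i) (X i \<omega>)) :: real)"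
      and "q = (\<lambda>\<omega>. (\<Prod>i\<in>J. indicator (B i) (Y i \<omega>)) :: real)"
      and "a = (\<lambda>\<omega>. \<Sum>i\<in>K. c i * X i \<omega>)" and "b = (\<lambda>\<omega>. \<Sum>i\<in>K. c i * Y i \<omega>)"
    have [measurable]: "p \<in> borel_measurable M" "q \<in> borel_measurable N" "a \<in> borel_measurable M" "b \<in> borel_measurable N"
      unfolding p_def q_def a_def b_def by measurable
    have p: "0 \<le> p x" "p x \<le> 1" for x unfolding p_def by (auto intro!: prod_nonneg prod_le_1)
    have q: "0 \<le> q x" "q x \<le> 1" for x unfolding q_def by (auto intro!: prod_nonneg prod_le_1)
    \<comment> \<open>Choosing the coefficient \<open>t\<close> at \<open>j\<close> and
      \<open>d * c i\<close> elsewhere frees the frequency of coordinate \<open>j\<close>. The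
      values 0, 1 and -1 of \<open>d\<close> are those that the product-to-sum formula
      produces.\<close>
    have IH: "(\<integral>\<omega>. p \<omega> * cos (s + d * a \<omega> + t * X j \<omega>) \<partial>M) = (\<integral>\<omega>. q \<omega> * cos (s + d * b \<omega> + t * Y j \<omega>) \<partial>N)" for s d t
    proof -
      have 1: "(\<Sum>i\<in>I-J. (if i = j then t else d * c i) * Z i) = d * (\<Sum>i\<in>K. c i * Z i) + t * Z j" for Z :: "'i \<Rightarrow> real"
      proof -
        have "(\<Sum>i\<in>K. (if i = j then t else d * c i) * Z i) = (\<Sum>i\<in>K. d * (c i * Z i))"
          using K by (intro sum.cong) auto
        then show ?thesis using K by (simp add: sum_distrib_left)
      qed
      show ?thesis
        using insert.IH[OF JI, of s "\<lambda>i. if i = j then t else d * c i"]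
        unfolding 1 p_def q_def a_def b_def by (simp add: add.assoc)
    qed
    have iM: "integrable M (\<lambda>\<omega>. p \<omega> * cos (s + d * a \<omega> + t * X j \<omega>))" for s d t
      by (rule M.integrable_const_bound[where B=1]) (use p in \<open>auto simp: abs_mult intro!: AE_I2 mult_le_one\<close>)
    have iN: "integrable N (\<lambda>\<omega>. q \<omega> * cos (s + d * b \<omega> + t * Y j \<omega>))" for s d t
      by (rule N.integrable_const_bound[where B=1]) (use q in \<open>auto simp: abs_mult intro!: AE_I2 mult_le_one\<close>)
    \<comment> \<open>The product-to-sum formula for cosines splits the weighted cosine into three
      terms, each of the shape covered by \<open>IH\<close>.\<close>
    have ex: "w * (1 + cos (s + z)) * cos (s' + t * x) = w * cos (s' + 0 * z + t * x)
        + (1/2) * (w * cos (s + s' + 1 * z + t * x)) + (1/2) * (w * cos (s' - s + (-1) * z + t * x))" for w z x s' t :: real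
    proof -
      have 1: "cos (s + s' + 1 * z + t * x) = cos ((s' + t * x) + (s + z))"
        "cos (s' - s + (-1) * z + t * x) = cos ((s' + t * x) - (s + z))" by (simp_all add: algebra_simps)
      show ?thesis unfolding 1 cos_add[of "s' + t * x"] cos_diff[of "s' + t * x"] by (simp add: algebra_simps)
    qed
    have E1: "(\<integral>\<omega>. p \<omega> * (1 + cos (s + a \<omega>)) * indicator (B j) (X j \<omega>) \<partial>M) = (\<integral>\<omega>. q \<omega> * (1 + cos (s + b \<omega>)) * indicator (B j) (Y j \<omega>) \<partial>N)"
    proof (rule weighted_cos_uniqueness[OF M N, where C=2])
      show "0 \<le> p x * (1 + cos (s + a x))" for x using p[of x] cos_ge_minus_one[of "s + a x"] by (intro mult_nonneg_nonneg) (auto simp del: cos_ge_minus_one)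
      show "p x * (1 + cos (s + a x)) \<le> 2" for x using p[of x] cos_le_one[of "s + a x"] cos_ge_minus_one[of "s + a x"]
          mult_mono[of "p x" 1 "1 + cos (s + a x)" 2] by (simp del: cos_ge_minus_one cos_le_one)
      show "0 \<le> q x * (1 + cos (s + b x))" for x using q[of x] cos_ge_minus_one[of "s + b x"] by (intro mult_nonneg_nonneg) (auto simp del: cos_ge_minus_one)
      show "q x * (1 + cos (s + b x)) \<le> 2" for x using q[of x] cos_le_one[of "s + b x"] cos_ge_minus_one[of "s + b x"]
          mult_mono[of "q x" 1 "1 + cos (s + b x)" 2] by (simp del: cos_ge_minus_one cos_le_one)
      fix s' t
      show "(\<integral>\<omega>. p \<omega> * (1 + cos (s + a \<omega>)) * cos (s' + t * X j \<omega>) \<partial>M) = (\<integral>\<omega>. q \<omega> * (1 + cos (s + b \<omega>)) * cos (s' + t * Y j \<omega>) \<partial>N)"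
        unfolding ex using iM iN IH
        by (subst (1 2) Bochner_Integration.integral_add; (intro Bochner_Integration.integrable_add Bochner_Integration.integrable_mult_right iM iN)?)+
           (simp only: Bochner_Integration.integral_mult_right_zero IH)
    qed measurable
    have E0: "(\<integral>\<omega>. p \<omega> * indicator (B j) (X j \<omega>) \<partial>M) = (\<integral>\<omega>. q \<omega> * indicator (B j) (Y j \<omega>) \<partial>N)"
      by (rule weighted_cos_uniqueness[OF M N, where C=1]) (use p q IH[of _ 0] in auto)
    \<comment> \<open>The cosine changes sign and cannot itself be a weight, so it is written as the
      difference of the nonnegative weights \<open>1 + cos\<close> and \<open>1\<close>, which
      \<open>E1\<close> and \<open>E0\<close> treat.\<close>
    have sp: "(\<integral>\<omega>. w \<omega> * indicator (B j) (Z \<omega>) * cos (s + z \<omega>) \<partial>P) =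
        (\<integral>\<omega>. w \<omega> * (1 + cos (s + z \<omega>)) * indicator (B j) (Z \<omega>) \<partial>P) - (\<integral>\<omega>. w \<omega> * indicator (B j) (Z \<omega>) \<partial>P)"
      if P: "prob_space P" and [measurable]: "w \<in> borel_measurable P" "z \<in> borel_measurable P" "Z \<in> borel_measurable P"
        and w: "\<And>x. 0 \<le> w x" "\<And>x. w x \<le> 1" for P :: "'p measure" and w z Z
    proof -
      interpret P: prob_space P by fact
      have 1: "integrable P (\<lambda>\<omega>. w \<omega> * indicator (B j) (Z \<omega>))"
        by (rule P.integrable_const_bound[where B=1]) (use w in \<open>auto simp: abs_mult intro!: AE_I2 mult_le_one\<close>)
      have 2: "integrable P (\<lambda>\<omega>. w \<omega> * indicator (B j) (Z \<omega>) * cos (s + z \<omega>))"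
        by (rule P.integrable_const_bound[where B=1]) (use w in \<open>auto simp: abs_mult intro!: AE_I2 mult_le_one mult_nonneg_nonneg\<close>)
      have "(\<integral>\<omega>. w \<omega> * (1 + cos (s + z \<omega>)) * indicator (B j) (Z \<omega>) \<partial>P)
          = (\<integral>\<omega>. w \<omega> * indicator (B j) (Z \<omega>) + w \<omega> * indicator (B j) (Z \<omega>) * cos (s + z \<omega>) \<partial>P)"
        by (simp add: algebra_simps)
      also have "\<dots> = (\<integral>\<omega>. w \<omega> * indicator (B j) (Z \<omega>) \<partial>P) + (\<integral>\<omega>. w \<omega> * indicator (B j) (Z \<omega>) * cos (s + z \<omega>) \<partial>P)"
        by (rule Bochner_Integration.integral_add[OF 1 2])
      finally show ?thesis by simp
    qed
    have "(\<integral>\<omega>. p \<omega> * indicator (B j) (X j \<omega>) * cos (s + a \<omega>) \<partial>M) = (\<integral>\<omega>. q \<omega> * indicator (B j) (Y j \<omega>) * cos (s + b \<omega>) \<partial>N)"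
      using E0 E1 sp[OF M, of p a "X j"] sp[OF N, of q b "Y j"] p q by simp
    then show ?case
      using insert.hyps by (simp add: p_def q_def a_def b_def K_def mult.commute)
  qed
  from this[OF I subset_refl, of 0 "\<lambda>_. 0"] show ?thesis by simp
qed

text \<open>A Cramer-Wold device for whole processes: finite cylinders with box bases determine a
  law on the product sigma-algebra, so \<open>I\<close> may be infinite although each test involves
  only finitely many coordinates.\<close>

theorem cos_integrals_determine_law:
  fixes X :: "'i \<Rightarrow> 'a \<Rightarrow> real" and Y :: "'i \<Rightarrow> 'b \<Rightarrow> real"
  assumes M: "prob_space M" and N: "prob_space N"
    and X[measurable]: "\<And>i. i \<in> I \<Longrightarrow> X i \<in> borel_measurable M"
    and Y[measurable]: "\<And>i. i \<in> I \<Longrightarrow> Y i \<in> borel_measurable N"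
    and eq: "\<And>J s c. finite J \<Longrightarrow> J \<subseteq> I \<Longrightarrow>
      (\<integral>\<omega>. cos (s + (\<Sum>i\<in>J. c i * X i \<omega>)) \<partial>M) = (\<integral>\<omega>. cos (s + (\<Sum>i\<in>J. c i * Y i \<omega>)) \<partial>N)"
  shows "distr M (\<Pi>\<^sub>M i\<in>I. borel) (\<lambda>\<omega>. \<lambda>i\<in>I. X i \<omega>) = distr N (\<Pi>\<^sub>M i\<in>I. borel) (\<lambda>\<omega>. \<lambda>i\<in>I. Y i \<omega>)"
proof (rule measure_eqI_PiM_infinite)
  interpret M: prob_space M by fact
  interpret N: prob_space N by fact
  show "finite_measure (distr M (\<Pi>\<^sub>M i\<in>I. borel) (\<lambda>\<omega>. \<lambda>i\<in>I. X i \<omega>))"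
    by (intro prob_space.finite_measure M.prob_space_distr) measurable
  fix A :: "'i \<Rightarrow> real set" and J assume J: "finite J" "J \<subseteq> I" and A: "\<And>i. i \<in> J \<Longrightarrow> A i \<in> sets borel"
  have *: "emeasure (distr P (\<Pi>\<^sub>M i\<in>I. borel) (\<lambda>\<omega>. \<lambda>i\<in>I. Z i \<omega>)) (prod_emb I (\<lambda>_. borel) J (Pi\<^sub>E J A))
     = ennreal (\<integral>\<omega>. (\<Prod>i\<in>J. indicator (A i) (Z i \<omega>)) \<partial>P)"
    if P: "prob_space P" and Z[measurable]: "\<And>i. i \<in> I \<Longrightarrow> Z i \<in> borel_measurable P" for P :: "'p measure" and Z
  proof -
    interpret P: prob_space P by fact
    note [measurable] = A
    have [measurable]: "i \<in> J \<Longrightarrow> Z i \<in> borel_measurable P" for i using J Z by auto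
    have "emeasure (distr P (\<Pi>\<^sub>M i\<in>I. borel) (\<lambda>\<omega>. \<lambda>i\<in>I. Z i \<omega>)) (prod_emb I (\<lambda>_. borel) J (Pi\<^sub>E J A))
      = emeasure P ((\<lambda>\<omega>. \<lambda>i\<in>I. Z i \<omega>) -` prod_emb I (\<lambda>_. borel) J (Pi\<^sub>E J A) \<inter> space P)"
      using J A by (intro emeasure_distr sets_PiM_I) auto
    also have "(\<lambda>\<omega>. \<lambda>i\<in>I. Z i \<omega>) -` prod_emb I (\<lambda>_. borel) J (Pi\<^sub>E J A) \<inter> space P = {\<omega>\<in>space P. \<forall>i\<in>J. Z i \<omega> \<in> A i}"
      using J by (auto simp: prod_emb_def restrict_PiE_iff Int_absorb1 space_PiM)
    also have "emeasure P \<dots> = ennreal (\<integral>\<omega>. indicator {\<omega>\<in>space P. \<forall>i\<in>J. Z i \<omega> \<in> A i} \<omega> \<partial>P)"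
      using J by (subst Bochner_Integration.integral_indicator) (auto simp: P.emeasure_eq_measure Int_absorb2)
    also have "(\<integral>\<omega>. indicator {\<omega>\<in>space P. \<forall>i\<in>J. Z i \<omega> \<in> A i} \<omega> \<partial>P) = (\<integral>\<omega>. (\<Prod>i\<in>J. indicator (A i) (Z i \<omega>) :: real) \<partial>P)"
    proof (rule Bochner_Integration.integral_cong[OF refl])
      fix \<omega> assume "\<omega> \<in> space P"
      then show "indicator {\<omega>\<in>space P. \<forall>i\<in>J. Z i \<omega> \<in> A i} \<omega> = (\<Prod>i\<in>J. indicator (A i) (Z i \<omega>) :: real)"
        using J by (cases "\<forall>i\<in>J. Z i \<omega> \<in> A i") (auto simp: indicator_def)
    qed
    finally show ?thesis .
  qed
  have "(\<integral>\<omega>. (\<Prod>i\<in>J. indicator (A i) (X i \<omega>) :: real) \<partial>M) = (\<integral>\<omega>. (\<Prod>i\<in>J. indicator (A i) (Y i \<omega>)) \<partial>N)"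
    by (rule cos_integrals_determine_boxes[OF M N J(1)]) (use J X Y A eq in auto)
  then show "emeasure (distr M (\<Pi>\<^sub>M i\<in>I. borel) (\<lambda>\<omega>. \<lambda>i\<in>I. X i \<omega>)) (prod_emb I (\<lambda>_. borel) J (Pi\<^sub>E J A))
     = emeasure (distr N (\<Pi>\<^sub>M i\<in>I. borel) (\<lambda>\<omega>. \<lambda>i\<in>I. Y i \<omega>)) (prod_emb I (\<lambda>_. borel) J (Pi\<^sub>E J A))"
    using *[OF M X] *[OF N Y] by simp
qed simp_all

section \<open>Spaces of centered Gaussian variables\<close>

lemma abs_mult_le_sum_squares: "\<bar>a * b\<bar> \<le> a\<^sup>2 + b\<^sup>2" for a b :: real
proof -
  have "2 * (\<bar>a\<bar> * \<bar>b\<bar>) \<le> a\<^sup>2 + b\<^sup>2"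
    using sum_squares_bound[of "\<bar>a\<bar>" "\<bar>b\<bar>"] by simp
  moreover have "0 \<le> \<bar>a\<bar> * \<bar>b\<bar>" by simp
  ultimately show ?thesis unfolding abs_mult by linarith
qed

text \<open>Closure under linear combinations makes every finite family in \<open>H\<close> jointly
  Gaussian. \<open>expectation_cos\<close> is the characteristic function of a centered normal law
  in real form; it includes variance zero, so degenerate variables such as the process at time 0
  belong to \<open>H\<close>.\<close>

locale gaussian_space = prob_space M for M :: "'a measure" +
  fixes H :: "('a \<Rightarrow> real) set"
  assumes measurable_H: "Y \<in> H \<Longrightarrow> Y \<in> borel_measurable M"
    and square_integrable: "Y \<in> H \<Longrightarrow> integrable M (\<lambda>\<omega>. (Y \<omega>)\<^sup>2)"
    and centered: "Y \<in> H \<Longrightarrow> expectation Y = 0"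
    and expectation_cos:
      "Y \<in> H \<Longrightarrow> expectation (\<lambda>\<omega>. cos (s + Y \<omega>)) = cos s * exp (- expectation (\<lambda>\<omega>. (Y \<omega>)\<^sup>2) / 2)"
    and zero_closed: "(\<lambda>_. 0) \<in> H"
    and add_closed: "Y \<in> H \<Longrightarrow> Z \<in> H \<Longrightarrow> (\<lambda>\<omega>. Y \<omega> + Z \<omega>) \<in> H"
    and scale_closed: "Y \<in> H \<Longrightarrow> (\<lambda>\<omega>. c * Y \<omega>) \<in> H"
begin

lemma integrable_product:
  assumes "Y \<in> H" "Z \<in> H"
  shows "integrable M (\<lambda>\<omega>. Y \<omega> * Z \<omega>)"
proof (rule Bochner_Integration.integrable_bound)
  show "integrable M (\<lambda>\<omega>. (Y \<omega>)\<^sup>2 + (Z \<omega>)\<^sup>2)"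
    using assms square_integrable by auto
  show "(\<lambda>\<omega>. Y \<omega> * Z \<omega>) \<in> borel_measurable M" using assms measurable_H by simp
  show "AE x in M. norm (Y x * Z x) \<le> norm ((Y x)\<^sup>2 + (Z x)\<^sup>2)"
    by (simp add: abs_mult_le_sum_squares)
qed

lemma diff_closed: "Y \<in> H \<Longrightarrow> Z \<in> H \<Longrightarrow> (\<lambda>\<omega>. Y \<omega> - Z \<omega>) \<in> H"
  using add_closed[of Y "\<lambda>\<omega>. (-1) * Z \<omega>"] scale_closed[of Z "-1"] by simp

lemma sum_closed: "finite J \<Longrightarrow> (\<And>j. j \<in> J \<Longrightarrow> X j \<in> H) \<Longrightarrow> (\<lambda>\<omega>. \<Sum>j\<in>J. X j \<omega>) \<in> H"
  by (induction J rule: finite_induct) (auto intro: zero_closed add_closed)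

lemma lincomb_closed: "finite J \<Longrightarrow> (\<And>j. j \<in> J \<Longrightarrow> X j \<in> H) \<Longrightarrow> (\<lambda>\<omega>. \<Sum>j\<in>J. c j * X j \<omega>) \<in> H"
  by (intro sum_closed scale_closed)

lemma covariance_sum_left:
  assumes "finite J" "\<And>j. j \<in> J \<Longrightarrow> X j \<in> H" "Z \<in> H"
  shows "expectation (\<lambda>\<omega>. (\<Sum>j\<in>J. c j * X j \<omega>) * Z \<omega>) = (\<Sum>j\<in>J. c j * expectation (\<lambda>\<omega>. X j \<omega> * Z \<omega>))"
proof -
  have "expectation (\<lambda>\<omega>. (\<Sum>j\<in>J. c j * X j \<omega>) * Z \<omega>) = expectation (\<lambda>\<omega>. \<Sum>j\<in>J. c j * (X j \<omega> * Z \<omega>))"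
    by (simp add: sum_distrib_right mult.assoc)
  also have "\<dots> = (\<Sum>j\<in>J. expectation (\<lambda>\<omega>. c j * (X j \<omega> * Z \<omega>)))"
    using assms by (intro Bochner_Integration.integral_sum Bochner_Integration.integrable_mult_right integrable_product) auto
  finally show ?thesis by simp
qed

lemma covariance_diff_left:
  assumes "Y \<in> H" "Z \<in> H" "W \<in> H"
  shows "expectation (\<lambda>\<omega>. (Y \<omega> - Z \<omega>) * W \<omega>) = expectation (\<lambda>\<omega>. Y \<omega> * W \<omega>) - expectation (\<lambda>\<omega>. Z \<omega> * W \<omega>)"
  using assms by (simp add: left_diff_distrib integrable_product)

lemma covariance_diff_right:
  assumes "Y \<in> H" "Z \<in> H" "W \<in> H"
  shows "expectation (\<lambda>\<omega>. W \<omega> * (Y \<omega> - Z \<omega>)) = expectation (\<lambda>\<omega>. W \<omega> * Y \<omega>) - expectation (\<lambda>\<omega>. W \<omega> * Z \<omega>)"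
  using assms by (simp add: right_diff_distrib integrable_product)

lemma covariance_scale_left:
  fixes c :: real and Y W :: "'a \<Rightarrow> real"
  shows "expectation (\<lambda>\<omega>. (c * Y \<omega>) * W \<omega>) = c * expectation (\<lambda>\<omega>. Y \<omega> * W \<omega>)"
  by (simp add: mult.assoc)

lemma covariance_scale_right:
  fixes c :: real and Y W :: "'a \<Rightarrow> real"
  shows "expectation (\<lambda>\<omega>. W \<omega> * (c * Y \<omega>)) = c * expectation (\<lambda>\<omega>. W \<omega> * Y \<omega>)"
  by (simp add: mult.left_commute)

lemma variance_sum:
  assumes "finite J" "\<And>j. j \<in> J \<Longrightarrow> X j \<in> H"
  shows "expectation (\<lambda>\<omega>. (\<Sum>j\<in>J. c j * X j \<omega>)\<^sup>2)
    = (\<Sum>i\<in>J. \<Sum>j\<in>J. c i * c j * expectation (\<lambda>\<omega>. X i \<omega> * X j \<omega>))"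
proof -
  have S: "(\<lambda>\<omega>. \<Sum>j\<in>J. c j * X j \<omega>) \<in> H" using assms by (rule lincomb_closed)
  have "expectation (\<lambda>\<omega>. (\<Sum>j\<in>J. c j * X j \<omega>) * (\<Sum>j\<in>J. c j * X j \<omega>))
      = (\<Sum>i\<in>J. c i * expectation (\<lambda>\<omega>. (\<Sum>j\<in>J. c j * X j \<omega>) * X i \<omega>))"
    using assms S by (subst covariance_sum_left) (simp_all add: mult.commute)
  also have "\<dots> = (\<Sum>i\<in>J. c i * (\<Sum>j\<in>J. c j * expectation (\<lambda>\<omega>. X j \<omega> * X i \<omega>)))"
    using assms by (intro sum.cong refl) (simp add: covariance_sum_left)
  also have "\<dots> = (\<Sum>i\<in>J. \<Sum>j\<in>J. c i * c j * expectation (\<lambda>\<omega>. X i \<omega> * X j \<omega>))"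
  proof (intro sum.cong refl)
    fix i
    show "c i * (\<Sum>j\<in>J. c j * expectation (\<lambda>\<omega>. X j \<omega> * X i \<omega>)) = (\<Sum>j\<in>J. c i * c j * expectation (\<lambda>\<omega>. X i \<omega> * X j \<omega>))"
      unfolding sum_distrib_left mult.assoc
      by (intro sum.cong refl arg_cong2[where f="(*)"] Bochner_Integration.integral_cong mult.commute)
  qed
  finally show ?thesis by (simp add: power2_eq_square)
qed

lemma AE_zero:
  assumes "Y \<in> H" "expectation (\<lambda>\<omega>. Y \<omega> * Y \<omega>) = 0"
  shows "AE \<omega> in M. Y \<omega> = 0"
proof -
  have "AE \<omega> in M. Y \<omega> * Y \<omega> = 0"
    using integral_nonneg_eq_0_iff_AE[OF integrable_product[OF assms(1) assms(1)]] assms(2) by simp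
  then show ?thesis by simp
qed

end

text \<open>The cosine integral of a linear combination depends only on its variance, hence only on
  the covariances. The two families may live on different probability spaces, which allows
  comparison with a product space as well as with a reflected walk.\<close>

lemma gaussian_same_law:
  fixes X :: "'i \<Rightarrow> 'a \<Rightarrow> real" and Y :: "'i \<Rightarrow> 'b \<Rightarrow> real"
  assumes "gaussian_space M H" "gaussian_space N G"
    and X: "\<And>i. i \<in> I \<Longrightarrow> X i \<in> H" and Y: "\<And>i. i \<in> I \<Longrightarrow> Y i \<in> G"
    and cov: "\<And>i j. i \<in> I \<Longrightarrow> j \<in> I \<Longrightarrow> (\<integral>\<omega>. X i \<omega> * X j \<omega> \<partial>M) = (\<integral>\<omega>. Y i \<omega> * Y j \<omega> \<partial>N)"
  shows "distr M (\<Pi>\<^sub>M i\<in>I. borel) (\<lambda>\<omega>. \<lambda>i\<in>I. X i \<omega>) = distr N (\<Pi>\<^sub>M i\<in>I. borel) (\<lambda>\<omega>. \<lambda>i\<in>I. Y i \<omega>)"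
proof -
  interpret M: gaussian_space M H by fact
  interpret N: gaussian_space N G by fact
  show ?thesis
  proof (rule cos_integrals_determine_law)
    fix J s c assume J: "finite J" "J \<subseteq> I"
    have XJ: "\<And>j. j \<in> J \<Longrightarrow> X j \<in> H" and YJ: "\<And>j. j \<in> J \<Longrightarrow> Y j \<in> G" using J X Y by auto
    have "(\<integral>\<omega>. (\<Sum>i\<in>J. c i * X i \<omega>)\<^sup>2 \<partial>M) = (\<integral>\<omega>. (\<Sum>i\<in>J. c i * Y i \<omega>)\<^sup>2 \<partial>N)"
    proof -
      have "(\<integral>\<omega>. (\<Sum>i\<in>J. c i * X i \<omega>)\<^sup>2 \<partial>M) = (\<Sum>i\<in>J. \<Sum>j\<in>J. c i * c j * (\<integral>\<omega>. X i \<omega> * X j \<omega> \<partial>M))"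
        by (rule M.variance_sum[OF J(1) XJ])
      also have "\<dots> = (\<Sum>i\<in>J. \<Sum>j\<in>J. c i * c j * (\<integral>\<omega>. Y i \<omega> * Y j \<omega> \<partial>N))"
        using J cov by (intro sum.cong refl) (auto simp: subset_iff)
      also have "\<dots> = (\<integral>\<omega>. (\<Sum>i\<in>J. c i * Y i \<omega>)\<^sup>2 \<partial>N)"
        by (rule N.variance_sum[OF J(1) YJ, symmetric])
      finally show ?thesis .
    qed
    then show "(\<integral>\<omega>. cos (s + (\<Sum>i\<in>J. c i * X i \<omega>)) \<partial>M) = (\<integral>\<omega>. cos (s + (\<Sum>i\<in>J. c i * Y i \<omega>)) \<partial>N)"
      using M.expectation_cos[OF M.lincomb_closed[OF J(1) XJ, where c=c]]
        N.expectation_cos[OF N.lincomb_closed[OF J(1) YJ, where c=c]] by simp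
  qed (use X Y M.measurable_H N.measurable_H M.prob_space_axioms N.prob_space_axioms in auto)
qed

section \<open>Products of Gaussian spaces and independence\<close>

lemma distr_pair_snd:
  assumes "prob_space M" "prob_space N"
  shows "distr (M \<Otimes>\<^sub>M N) N snd = N"
proof (rule measure_eqI)
  interpret M: prob_space M by fact
  interpret N: prob_space N by fact
  fix A assume "A \<in> sets (distr (M \<Otimes>\<^sub>M N) N snd)"
  then have A: "A \<in> sets N" by simp
  have "snd -` A \<inter> space (M \<Otimes>\<^sub>M N) = space M \<times> A"
    using sets.sets_into_space[OF A] by (auto simp: space_pair_measure)
  then show "emeasure (distr (M \<Otimes>\<^sub>M N) N snd) A = emeasure N A"
    using A by (simp add: emeasure_distr N.emeasure_pair_measure_Times M.emeasure_space_1)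
qed simp

text \<open>Cosine integrals factor by integrating out one coordinate at a time, and the mixed
  covariances vanish because both factors are centered. This places independent Gaussian families in
  a single Gaussian space; it provides the independent copy used next and, later, the artificial
  endpoint of a bridge.\<close>

lemma gaussian_space_pair:
  assumes "gaussian_space M H" "gaussian_space N G"
  shows "gaussian_space (M \<Otimes>\<^sub>M N) {\<lambda>p. Y (fst p) + Z (snd p) | Y Z. Y \<in> H \<and> Z \<in> G}" (is "gaussian_space _ ?H")
    and "Y \<in> H \<Longrightarrow> Y' \<in> H \<Longrightarrow> Z \<in> G \<Longrightarrow> Z' \<in> G \<Longrightarrow>
      (\<integral>p. (Y (fst p) + Z (snd p)) * (Y' (fst p) + Z' (snd p)) \<partial>(M \<Otimes>\<^sub>M N)) =
      (\<integral>\<omega>. Y \<omega> * Y' \<omega> \<partial>M) + (\<integral>\<omega>. Z \<omega> * Z' \<omega> \<partial>N)"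
proof -
  interpret M: gaussian_space M H by fact
  interpret N: gaussian_space N G by fact
  interpret P: pair_prob_space M N ..
  have int1: "integrable (M \<Otimes>\<^sub>M N) (\<lambda>p. f (fst p))" "(\<integral>p. f (fst p) \<partial>(M \<Otimes>\<^sub>M N)) = (\<integral>x. f x \<partial>M)"
    if "integrable M f" for f :: "'a \<Rightarrow> real"
  proof -
    have d: "distr (M \<Otimes>\<^sub>M N) M fst = M" by (rule N.distr_pair_fst)
    have m: "f \<in> borel_measurable M" using that by simp
    show "integrable (M \<Otimes>\<^sub>M N) (\<lambda>p. f (fst p))"
      using that by (intro integrable_distr[of fst _ M]) (simp_all add: d)
    show "(\<integral>p. f (fst p) \<partial>(M \<Otimes>\<^sub>M N)) = (\<integral>x. f x \<partial>M)"
      using m by (subst (2) d[symmetric]) (simp add: integral_distr)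
  qed
  have int2: "integrable (M \<Otimes>\<^sub>M N) (\<lambda>p. f (snd p))" "(\<integral>p. f (snd p) \<partial>(M \<Otimes>\<^sub>M N)) = (\<integral>x. f x \<partial>N)"
    if "integrable N f" for f :: "'b \<Rightarrow> real"
  proof -
    have d: "distr (M \<Otimes>\<^sub>M N) N snd = N"
      by (intro distr_pair_snd M.prob_space_axioms N.prob_space_axioms)
    have m: "f \<in> borel_measurable N" using that by simp
    show "integrable (M \<Otimes>\<^sub>M N) (\<lambda>p. f (snd p))"
      using that by (intro integrable_distr[of snd _ N]) (simp_all add: d)
    show "(\<integral>p. f (snd p) \<partial>(M \<Otimes>\<^sub>M N)) = (\<integral>x. f x \<partial>N)"
      using m by (subst (2) d[symmetric]) (simp add: integral_distr)
  qed
  note [measurable] = M.measurable_H N.measurable_H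
  have int12: "integrable (M \<Otimes>\<^sub>M N) (\<lambda>p. Y (fst p) * Z (snd p))" "(\<integral>p. Y (fst p) * Z (snd p) \<partial>(M \<Otimes>\<^sub>M N)) = 0"
    if Y: "Y \<in> H" and Z: "Z \<in> G" for Y Z
  proof -
    show i: "integrable (M \<Otimes>\<^sub>M N) (\<lambda>p. Y (fst p) * Z (snd p))"
    proof (rule Bochner_Integration.integrable_bound)
      show "integrable (M \<Otimes>\<^sub>M N) (\<lambda>p. (Y (fst p))\<^sup>2 + (Z (snd p))\<^sup>2)"
        using Y Z M.square_integrable N.square_integrable
        by (intro Bochner_Integration.integrable_add int1(1)[of "\<lambda>x. (Y x)\<^sup>2"] int2(1)[of "\<lambda>x. (Z x)\<^sup>2"]) auto
      show "(\<lambda>p. Y (fst p) * Z (snd p)) \<in> borel_measurable (M \<Otimes>\<^sub>M N)" using Y Z by measurable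
      show "AE p in M \<Otimes>\<^sub>M N. norm (Y (fst p) * Z (snd p)) \<le> norm ((Y (fst p))\<^sup>2 + (Z (snd p))\<^sup>2)"
        by (simp add: abs_mult_le_sum_squares)
    qed
    have "(\<integral>p. Y (fst p) * Z (snd p) \<partial>(M \<Otimes>\<^sub>M N)) = (\<integral>x. (\<integral>y. Y x * Z y \<partial>N) \<partial>M)"
      by (subst P.integral_fst'[symmetric, OF i]) simp
    also have "\<dots> = 0" using N.centered[OF Z] by simp
    finally show "(\<integral>p. Y (fst p) * Z (snd p) \<partial>(M \<Otimes>\<^sub>M N)) = 0" .
  qed
  have cov: "integrable (M \<Otimes>\<^sub>M N) (\<lambda>p. (Y (fst p) + Z (snd p)) * (Y' (fst p) + Z' (snd p)))"
    "(\<integral>p. (Y (fst p) + Z (snd p)) * (Y' (fst p) + Z' (snd p)) \<partial>(M \<Otimes>\<^sub>M N)) =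
      (\<integral>\<omega>. Y \<omega> * Y' \<omega> \<partial>M) + (\<integral>\<omega>. Z \<omega> * Z' \<omega> \<partial>N)"
    if Y: "Y \<in> H" "Y' \<in> H" and Z: "Z \<in> G" "Z' \<in> G" for Y Y' Z Z'
  proof -
    have e: "(Y (fst p) + Z (snd p)) * (Y' (fst p) + Z' (snd p)) = Y (fst p) * Y' (fst p) + Z (snd p) * Z' (snd p)
      + Y (fst p) * Z' (snd p) + Y' (fst p) * Z (snd p)" for p by (simp add: algebra_simps)
    note i = int1[OF M.integrable_product[OF Y]] int2[OF N.integrable_product[OF Z]] int12[OF Y(1) Z(2)] int12[OF Y(2) Z(1)]
    show "integrable (M \<Otimes>\<^sub>M N) (\<lambda>p. (Y (fst p) + Z (snd p)) * (Y' (fst p) + Z' (snd p)))"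
      unfolding e using i by auto
    show "(\<integral>p. (Y (fst p) + Z (snd p)) * (Y' (fst p) + Z' (snd p)) \<partial>(M \<Otimes>\<^sub>M N)) =
      (\<integral>\<omega>. Y \<omega> * Y' \<omega> \<partial>M) + (\<integral>\<omega>. Z \<omega> * Z' \<omega> \<partial>N)"
      unfolding e using i by simp
  qed
  show "Y \<in> H \<Longrightarrow> Y' \<in> H \<Longrightarrow> Z \<in> G \<Longrightarrow> Z' \<in> G \<Longrightarrow>
      (\<integral>p. (Y (fst p) + Z (snd p)) * (Y' (fst p) + Z' (snd p)) \<partial>(M \<Otimes>\<^sub>M N)) =
      (\<integral>\<omega>. Y \<omega> * Y' \<omega> \<partial>M) + (\<integral>\<omega>. Z \<omega> * Z' \<omega> \<partial>N)"
    by (rule cov(2))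
  show "gaussian_space (M \<Otimes>\<^sub>M N) ?H"
  proof
    fix W assume "W \<in> ?H"
    then obtain Y Z where W: "W = (\<lambda>p. Y (fst p) + Z (snd p))" and Y: "Y \<in> H" and Z: "Z \<in> G" by auto
    show "W \<in> borel_measurable (M \<Otimes>\<^sub>M N)" unfolding W using Y Z by measurable
    show "integrable (M \<Otimes>\<^sub>M N) (\<lambda>\<omega>. (W \<omega>)\<^sup>2)"
      using cov(1)[OF Y Y Z Z] by (simp add: W power2_eq_square)
    have iY: "integrable M Y" and iZ: "integrable N Z"
      using Y Z M.square_integrable_imp_integrable[OF M.measurable_H M.square_integrable]
        N.square_integrable_imp_integrable[OF N.measurable_H N.square_integrable] by auto
    show "integral\<^sup>L (M \<Otimes>\<^sub>M N) W = 0"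
      unfolding W using int1[OF iY] int2[OF iZ] M.centered[OF Y] N.centered[OF Z] by simp
    fix s
    have "(\<integral>p. cos (s + W p) \<partial>(M \<Otimes>\<^sub>M N)) = (\<integral>x. (\<integral>y. cos (s + W (x, y)) \<partial>N) \<partial>M)"
    proof (rule P.integral_fst'[symmetric])
      show "integrable (M \<Otimes>\<^sub>M N) (\<lambda>p. cos (s + W p))"
        by (rule P.integrable_const_bound[where B=1]) (use Y Z W in auto)
    qed
    also have "\<dots> = (\<integral>x. cos (s + Y x) * exp (- (\<integral>y. (Z y)\<^sup>2 \<partial>N) / 2) \<partial>M)"
      using N.expectation_cos[OF Z] by (simp add: W add.assoc[symmetric])
    also have "\<dots> = cos s * exp (- ((\<integral>x. (Y x)\<^sup>2 \<partial>M) + (\<integral>y. (Z y)\<^sup>2 \<partial>N)) / 2)"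
      using M.expectation_cos[OF Y] by (simp add: exp_add[symmetric] add_divide_distrib)
    also have "(\<integral>x. (Y x)\<^sup>2 \<partial>M) + (\<integral>y. (Z y)\<^sup>2 \<partial>N) = (\<integral>p. (W p)\<^sup>2 \<partial>(M \<Otimes>\<^sub>M N))"
      using cov(2)[OF Y Y Z Z] by (simp add: W power2_eq_square)
    finally show "(\<integral>p. cos (s + W p) \<partial>(M \<Otimes>\<^sub>M N)) = cos s * exp (- (\<integral>p. (W p)\<^sup>2 \<partial>(M \<Otimes>\<^sub>M N)) / 2)" .
  next
    show "(\<lambda>_. 0) \<in> ?H"
      using M.zero_closed N.zero_closed by (intro CollectI exI[of _ "\<lambda>_. 0"]) auto
  next
    fix U V assume "U \<in> ?H" "V \<in> ?H"
    then obtain Y Z Y' Z' where "U = (\<lambda>p. Y (fst p) + Z (snd p))" "Y \<in> H" "Z \<in> G"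
      "V = (\<lambda>p. Y' (fst p) + Z' (snd p))" "Y' \<in> H" "Z' \<in> G" by auto
    then show "(\<lambda>p. U p + V p) \<in> ?H" using M.add_closed[of Y Y'] N.add_closed[of Z Z']
      by (intro CollectI exI[of _ "\<lambda>x. Y x + Y' x"] exI[of _ "\<lambda>x. Z x + Z' x"]) auto
  next
    fix U c assume "U \<in> ?H"
    then obtain Y Z where "U = (\<lambda>p. Y (fst p) + Z (snd p))" "Y \<in> H" "Z \<in> G" by auto
    then show "(\<lambda>p. c * U p) \<in> ?H" using M.scale_closed[of Y] N.scale_closed[of Z]
      by (intro CollectI exI[of _ "\<lambda>x. c * Y x"] exI[of _ "\<lambda>x. c * Z x"]) (auto simp: algebra_simps)
  qed
qed

text \<open>The family on \<open>M\<close> is compared with a copy on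
  \<open>M \<Otimes>\<^sub>M M\<close> in which \<open>X\<close> reads the first coordinate and
  \<open>Y\<close> the second. All covariances agree, the mixed ones being zero on both sides, so
  the laws agree, and the law of the copy is a product by construction.\<close>

lemma (in gaussian_space) uncorrelated_imp_indep:
  fixes X :: "'i \<Rightarrow> 'a \<Rightarrow> real" and Y :: "'j \<Rightarrow> 'a \<Rightarrow> real"
  assumes X: "\<And>i. i \<in> I \<Longrightarrow> X i \<in> H" and Y: "\<And>j. j \<in> J \<Longrightarrow> Y j \<in> H"
    and cov: "\<And>i j. i \<in> I \<Longrightarrow> j \<in> J \<Longrightarrow> expectation (\<lambda>\<omega>. X i \<omega> * Y j \<omega>) = 0"
  shows "distr M ((\<Pi>\<^sub>M i\<in>I. borel) \<Otimes>\<^sub>M (\<Pi>\<^sub>M j\<in>J. borel)) (\<lambda>\<omega>. (\<lambda>i\<in>I. X i \<omega>, \<lambda>j\<in>J. Y j \<omega>))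
    = distr M (\<Pi>\<^sub>M i\<in>I. borel) (\<lambda>\<omega>. \<lambda>i\<in>I. X i \<omega>) \<Otimes>\<^sub>M distr M (\<Pi>\<^sub>M j\<in>J. borel) (\<lambda>\<omega>. \<lambda>j\<in>J. Y j \<omega>)"
proof -
  \<comment> \<open>Both families are merged over the sum type so that one comparison of covariances
    covers them; \<open>S\<close> splits the merged family again.\<close>
  let ?K = "I <+> J"
  define Z1 where "Z1 = case_sum X Y"
  define Z2 where "Z2 = case_sum (\<lambda>i (p::'a\<times>'a). X i (fst p)) (\<lambda>j p. Y j (snd p))"
  let ?H2 = "{\<lambda>p. Y (fst p) + Z (snd p) | Y Z. Y \<in> H \<and> Z \<in> H}"
  have ax: "gaussian_space M H" ..
  interpret P: gaussian_space "M \<Otimes>\<^sub>M M" ?H2 by (rule gaussian_space_pair[OF ax ax])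
  note pc = gaussian_space_pair(2)[OF ax ax]
  have mX[measurable]: "\<And>i. i \<in> I \<Longrightarrow> X i \<in> borel_measurable M" and mY[measurable]: "\<And>j. j \<in> J \<Longrightarrow> Y j \<in> borel_measurable M"
    using X Y measurable_H by auto
  have Z1: "k \<in> ?K \<Longrightarrow> Z1 k \<in> H" for k unfolding Z1_def using X Y by auto
  have Z2: "Z2 k \<in> ?H2" if "k \<in> ?K" for k
    using that
  proof (elim PlusE; hypsubst)
    fix i assume "i \<in> I"
    then show "Z2 (Inl i) \<in> ?H2"
      using X zero_closed by (intro CollectI exI[of _ "X i"] exI[of _ "\<lambda>_. 0"]) (simp add: Z2_def)
  next
    fix j assume "j \<in> J"
    then show "Z2 (Inr j) \<in> ?H2"
      using Y zero_closed by (intro CollectI exI[of _ "Y j"] exI[of _ "\<lambda>_. 0"]) (simp add: Z2_def)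
  qed
  have "distr M (\<Pi>\<^sub>M i\<in>?K. borel) (\<lambda>\<omega>. \<lambda>i\<in>?K. Z1 i \<omega>) = distr (M \<Otimes>\<^sub>M M) (\<Pi>\<^sub>M i\<in>?K. borel) (\<lambda>\<omega>. \<lambda>i\<in>?K. Z2 i \<omega>)"
  proof (rule gaussian_same_law[OF ax P.gaussian_space_axioms Z1 Z2])
    fix i j assume i: "i \<in> ?K" and j: "j \<in> ?K"
    show "expectation (\<lambda>\<omega>. Z1 i \<omega> * Z1 j \<omega>) = (\<integral>p. Z2 i p * Z2 j p \<partial>(M \<Otimes>\<^sub>M M))"
      using i j
    proof (elim PlusE; hypsubst)
      fix a b assume "a \<in> I" "b \<in> I"
      then show "expectation (\<lambda>\<omega>. Z1 (Inl a) \<omega> * Z1 (Inl b) \<omega>) = (\<integral>p. Z2 (Inl a) p * Z2 (Inl b) p \<partial>(M \<Otimes>\<^sub>M M))"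
        using pc[of "X a" "X b" "\<lambda>_. 0" "\<lambda>_. 0"] X zero_closed by (simp add: Z1_def Z2_def)
    next
      fix a b assume "a \<in> I" "b \<in> J"
      then show "expectation (\<lambda>\<omega>. Z1 (Inl a) \<omega> * Z1 (Inr b) \<omega>) = (\<integral>p. Z2 (Inl a) p * Z2 (Inr b) p \<partial>(M \<Otimes>\<^sub>M M))"
        using pc[of "X a" "\<lambda>_. 0" "\<lambda>_. 0" "Y b"] X Y zero_closed cov by (simp add: Z1_def Z2_def)
    next
      fix a b assume "a \<in> J" "b \<in> I"
      then show "expectation (\<lambda>\<omega>. Z1 (Inr a) \<omega> * Z1 (Inl b) \<omega>) = (\<integral>p. Z2 (Inr a) p * Z2 (Inl b) p \<partial>(M \<Otimes>\<^sub>M M))"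
        using pc[of "\<lambda>_. 0" "X b" "Y a" "\<lambda>_. 0"] X Y zero_closed cov[of b a] by (simp add: Z1_def Z2_def mult.commute)
    next
      fix a b assume "a \<in> J" "b \<in> J"
      then show "expectation (\<lambda>\<omega>. Z1 (Inr a) \<omega> * Z1 (Inr b) \<omega>) = (\<integral>p. Z2 (Inr a) p * Z2 (Inr b) p \<partial>(M \<Otimes>\<^sub>M M))"
        using pc[of "\<lambda>_. 0" "\<lambda>_. 0" "Y a" "Y b"] Y zero_closed by (simp add: Z1_def Z2_def)
    qed
  qed
  moreover define S where "S = (\<lambda>f :: 'i + 'j \<Rightarrow> real. (\<lambda>i\<in>I. f (Inl i), \<lambda>j\<in>J. f (Inr j)))"
  have S[measurable]: "S \<in> measurable (\<Pi>\<^sub>M i\<in>?K. borel) ((\<Pi>\<^sub>M i\<in>I. borel) \<Otimes>\<^sub>M (\<Pi>\<^sub>M j\<in>J. borel))"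
    unfolding S_def by (intro measurable_Pair measurable_restrict measurable_component_singleton) auto
  ultimately have eq: "distr (distr M (\<Pi>\<^sub>M i\<in>?K. borel) (\<lambda>\<omega>. \<lambda>i\<in>?K. Z1 i \<omega>)) ((\<Pi>\<^sub>M i\<in>I. borel) \<Otimes>\<^sub>M (\<Pi>\<^sub>M j\<in>J. borel)) S
    = distr (distr (M \<Otimes>\<^sub>M M) (\<Pi>\<^sub>M i\<in>?K. borel) (\<lambda>\<omega>. \<lambda>i\<in>?K. Z2 i \<omega>)) ((\<Pi>\<^sub>M i\<in>I. borel) \<Otimes>\<^sub>M (\<Pi>\<^sub>M j\<in>J. borel)) S"
    by simp
  have [measurable]: "k \<in> ?K \<Longrightarrow> Z1 k \<in> borel_measurable M" "k \<in> ?K \<Longrightarrow> Z2 k \<in> borel_measurable (M \<Otimes>\<^sub>M M)" for k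
    using Z1 Z2 measurable_H P.measurable_H by auto
  have "distr M ((\<Pi>\<^sub>M i\<in>I. borel) \<Otimes>\<^sub>M (\<Pi>\<^sub>M j\<in>J. borel)) (\<lambda>\<omega>. (\<lambda>i\<in>I. X i \<omega>, \<lambda>j\<in>J. Y j \<omega>))
     = distr (M \<Otimes>\<^sub>M M) ((\<Pi>\<^sub>M i\<in>I. borel) \<Otimes>\<^sub>M (\<Pi>\<^sub>M j\<in>J. borel)) (\<lambda>p. (\<lambda>i\<in>I. X i (fst p), \<lambda>j\<in>J. Y j (snd p)))"
  proof -
    have "S (\<lambda>k\<in>?K. Z1 k \<omega>) = (\<lambda>i\<in>I. X i \<omega>, \<lambda>j\<in>J. Y j \<omega>)" for \<omega>
      by (auto simp: S_def Z1_def restrict_def fun_eq_iff)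
    moreover have "S (\<lambda>k\<in>?K. Z2 k p) = (\<lambda>i\<in>I. X i (fst p), \<lambda>j\<in>J. Y j (snd p))" for p
      by (auto simp: S_def Z2_def restrict_def fun_eq_iff)
    ultimately show ?thesis
      using eq by (subst (asm) (1 2) distr_distr) (auto simp: comp_def intro!: measurable_restrict S)
  qed
  also have "\<dots> = distr M (\<Pi>\<^sub>M i\<in>I. borel) (\<lambda>\<omega>. \<lambda>i\<in>I. X i \<omega>) \<Otimes>\<^sub>M distr M (\<Pi>\<^sub>M j\<in>J. borel) (\<lambda>\<omega>. \<lambda>j\<in>J. Y j \<omega>)"
  proof -
    interpret D: prob_space "distr M (\<Pi>\<^sub>M j\<in>J. borel) (\<lambda>\<omega>. \<lambda>j\<in>J. Y j \<omega>)"
      by (rule prob_space_distr) measurable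
    show ?thesis
      by (subst pair_measure_distr) (auto intro!: measurable_restrict D.sigma_finite_measure_axioms simp: case_prod_beta')
  qed
  finally show ?thesis .
qed

text \<open>The one-dimensional model space: it identifies the law of a single Gaussian variable and
  serves as the second factor when an endpoint is adjoined to a bridge. The cosine integral comes
  from the standard normal characteristic function by scaling.\<close>

lemma gaussian_space_normal_line:
  assumes \<sigma>: "0 < \<sigma>"
  shows "gaussian_space (density lborel (normal_density 0 \<sigma>)) (range (\<lambda>c x. c * x))"
    and "(\<integral>x. x\<^sup>2 \<partial>density lborel (normal_density 0 \<sigma>)) = \<sigma>\<^sup>2"
proof -
  let ?N = "density lborel (normal_density 0 \<sigma>)"
  let ?S = "std_normal_distribution"
  interpret S: real_distribution ?S by (rule real_dist_normal_dist)
  interpret N: prob_space ?N by (rule prob_space_normal_density[OF \<sigma>])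
  have "distributed ?S lborel (\<lambda>x. x) (normal_density 0 1)"
    unfolding distributed_def by (auto simp: distr_id2)
  from S.normal_density_affine[OF this, of \<sigma> 0] \<sigma>
  have "distr ?S lborel (\<lambda>x. \<sigma> * x) = ?N"
    by (simp add: distributed_def)
  moreover have "distr ?S lborel (\<lambda>x. \<sigma> * x) = distr ?S borel (\<lambda>x. \<sigma> * x)"
    by (intro distr_cong) auto
  ultimately have N: "?N = distr ?S borel (\<lambda>x. \<sigma> * x)" by simp
  have sq: "integrable ?N (\<lambda>x. x\<^sup>2)" "(\<integral>x. x\<^sup>2 \<partial>?N) = \<sigma>\<^sup>2"
    using integrable_normal_moment[OF \<sigma>, of 0 2] integral_normal_moment_even[OF \<sigma>, of 0 1] \<sigma>
    by (auto simp: integrable_density integral_density power2_eq_square field_simps fact_numeral)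
  show "(\<integral>x. x\<^sup>2 \<partial>?N) = \<sigma>\<^sup>2" by (rule sq(2))
  have mean: "(\<integral>x. x \<partial>?N) = 0"
    using integral_normal_moment_nz_1[OF \<sigma>, of 0] by (simp add: integral_density)
  have ccos: "(\<integral>x. cos (s + c * x) \<partial>?N) = cos s * exp (- (c\<^sup>2 * \<sigma>\<^sup>2) / 2)" for s c
  proof -
    have "(\<integral>x. cos (s + c * x) \<partial>?N) = (\<integral>x. Re (iexp s * iexp (c * \<sigma> * x)) \<partial>?S)"
      unfolding N by (subst integral_distr) (auto simp: Re_exp Im_exp cos_add algebra_simps intro!: Bochner_Integration.integral_cong)
    also have "\<dots> = Re (iexp s * char ?S (c * \<sigma>))"
    proof -
      have "integrable ?S (\<lambda>x. iexp s * iexp (c * \<sigma> * x))"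
        by (intro Bochner_Integration.integrable_mult_right S.integrable_iexp) auto
      then have "(\<integral>x. Re (iexp s * iexp (c * \<sigma> * x)) \<partial>?S) = Re (CLINT x|?S. iexp s * iexp (c * \<sigma> * x))"
        by (rule integral_Re)
      then show ?thesis unfolding char_def by simp
    qed
    also have "\<dots> = cos s * exp (- (c\<^sup>2 * \<sigma>\<^sup>2) / 2)"
      by (simp add: char_std_normal_distribution Re_exp power_mult_distrib del: of_real_exp)
    finally show ?thesis .
  qed
  show "gaussian_space ?N (range (\<lambda>c x. c * x))"
  proof
    fix Y assume "Y \<in> range (\<lambda>c x. c * x :: real)"
    then obtain c where Y: "Y = (\<lambda>x. c * x)" by auto
    show "Y \<in> borel_measurable ?N" by (simp add: Y)
    show "integrable ?N (\<lambda>x. (Y x)\<^sup>2)" using sq(1) by (simp add: Y power_mult_distrib)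
    show "N.expectation Y = 0" using mean by (simp add: Y)
    show "N.expectation (\<lambda>x. cos (s + Y x)) = cos s * exp (- N.expectation (\<lambda>x. (Y x)\<^sup>2) / 2)" for s
      using ccos[of s c] sq(2) by (simp add: Y power_mult_distrib)
  next
    show "(\<lambda>_. 0) \<in> range (\<lambda>c x. c * x :: real)" by (auto intro!: range_eqI[of _ _ 0])
  next
    fix Y Z :: "real \<Rightarrow> real" assume "Y \<in> range (\<lambda>c x. c * x)" "Z \<in> range (\<lambda>c x. c * x)"
    then obtain a b where "Y = (\<lambda>x. a * x)" "Z = (\<lambda>x. b * x)" by auto
    then show "(\<lambda>x. Y x + Z x) \<in> range (\<lambda>c x. c * x)" by (auto simp: algebra_simps intro!: range_eqI[of _ _ "a + b"])
  next
    fix Y :: "real \<Rightarrow> real" and c assume "Y \<in> range (\<lambda>c x. c * x)"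
    then obtain a where "Y = (\<lambda>x. a * x)" by auto
    then show "(\<lambda>x. c * Y x) \<in> range (\<lambda>c x. c * x)" by (auto intro!: range_eqI[of _ _ "c * a"])
  qed
qed

lemma (in gaussian_space) distr_normal:
  assumes Y: "Y \<in> H" and v: "expectation (\<lambda>\<omega>. Y \<omega> * Y \<omega>) = v" "0 < v"
  shows "distr M borel Y = density lborel (normal_density 0 (sqrt v))"
proof (rule measure_eqI)
  let ?N = "density lborel (normal_density 0 (sqrt v))"
  interpret N: gaussian_space ?N "range (\<lambda>c x. c * x)"
    using gaussian_space_normal_line(1)[of "sqrt v"] v by simp
  have v2: "(\<integral>x. x\<^sup>2 \<partial>?N) = v" using gaussian_space_normal_line(2)[of "sqrt v"] v by simp
  have m[measurable]: "Y \<in> borel_measurable M" using Y by (rule measurable_H)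
  fix B assume "B \<in> sets (distr M borel Y)"
  then have B[measurable]: "B \<in> sets borel" by simp
  have "(\<integral>\<omega>. 1 * indicator B (Y \<omega>) \<partial>M) = (\<integral>x. (1 * indicator B x :: real) \<partial>?N)"
  proof (rule weighted_cos_uniqueness[where C=1 and f="\<lambda>_. 1" and g="\<lambda>_. 1" and X=Y and Y="\<lambda>x. x"])
    fix s t
    show "(\<integral>\<omega>. 1 * cos (s + t * Y \<omega>) \<partial>M) = (\<integral>x. 1 * cos (s + t * x) \<partial>?N)"
      using expectation_cos[OF scale_closed[OF Y, of t], of s] N.expectation_cos[of "\<lambda>x. t * x" s] v(1) v2
      by (simp add: power_mult_distrib power2_eq_square[of "Y _"])
  qed (auto intro: prob_space_axioms N.prob_space_axioms)
  moreover have "measure (distr M borel Y) B = (\<integral>x. indicator B x \<partial>distr M borel Y)" by simp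
  moreover have "(\<integral>x. indicator B x \<partial>distr M borel Y) = (\<integral>\<omega>. (indicator B (Y \<omega>) :: real) \<partial>M)"
    by (subst integral_distr) auto
  ultimately have "measure (distr M borel Y) B = measure ?N B" by simp
  then show "emeasure (distr M borel Y) B = emeasure ?N B"
    using N.emeasure_eq_measure finite_measure.emeasure_eq_measure[OF prob_space.finite_measure[OF prob_space_distr[OF m]]]
    by simp
qed simp

text \<open>Both alternatives of \<open>gaussian_rv\<close> lead to the one formula required by
  \<open>gaussian_space\<close>: a constant with mean zero is almost surely 0, which is the case of
  variance zero.\<close>

lemma gaussian_rv_centered:
  assumes M: "prob_space M" and Y: "gaussian_rv M Y" and mean: "(\<integral>\<omega>. Y \<omega> \<partial>M) = 0"
  shows "integrable M (\<lambda>\<omega>. (Y \<omega>)\<^sup>2)"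
    and "(\<integral>\<omega>. cos (s + Y \<omega>) \<partial>M) = cos s * exp (- (\<integral>\<omega>. (Y \<omega>)\<^sup>2 \<partial>M) / 2)"
proof -
  interpret prob_space M by fact
  have m[measurable]: "Y \<in> borel_measurable M" using Y by (simp add: gaussian_rv_def)
  have "integrable M (\<lambda>\<omega>. (Y \<omega>)\<^sup>2) \<and> (\<integral>\<omega>. cos (s + Y \<omega>) \<partial>M) = cos s * exp (- (\<integral>\<omega>. (Y \<omega>)\<^sup>2 \<partial>M) / 2)" for s
  proof (cases "\<exists>\<mu>. AE \<omega> in M. Y \<omega> = \<mu>")
    case True
    then obtain \<mu> where \<mu>: "AE \<omega> in M. Y \<omega> = \<mu>" by auto
    have "(\<integral>\<omega>. Y \<omega> \<partial>M) = (\<integral>\<omega>. \<mu> \<partial>M)" using \<mu> by (intro integral_cong_AE) auto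
    then have "\<mu> = 0" using mean by (simp add: prob_space)
    then have Y0: "AE \<omega> in M. Y \<omega> = 0" using \<mu> by simp
    have "integrable M (\<lambda>\<omega>. (Y \<omega>)\<^sup>2) \<longleftrightarrow> integrable M (\<lambda>\<omega>. 0 :: real)"
      using Y0 by (intro integrable_cong_AE) auto
    moreover have "(\<integral>\<omega>. (Y \<omega>)\<^sup>2 \<partial>M) = (\<integral>\<omega>. 0 \<partial>M)"
      using Y0 by (intro integral_cong_AE) auto
    moreover have "(\<integral>\<omega>. cos (s + Y \<omega>) \<partial>M) = (\<integral>\<omega>. cos s \<partial>M)"
      using Y0 by (intro integral_cong_AE) auto
    ultimately show ?thesis by (simp add: prob_space)
  next
    case False
    then obtain \<mu> \<sigma> where \<sigma>: "0 < \<sigma>" and d: "distributed M lborel Y (normal_density \<mu> \<sigma>)"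
      using Y by (auto simp: gaussian_rv_def)
    have "\<mu> = 0" using normal_distributed_expectation[OF \<sigma> d] mean by simp
    let ?N = "density lborel (normal_density 0 \<sigma>)"
    have D: "distr M borel Y = ?N"
    proof -
      have "distr M borel Y = distr M lborel Y" by (intro distr_cong) auto
      then show ?thesis using d \<open>\<mu> = 0\<close> by (simp add: distributed_def)
    qed
    interpret N: gaussian_space ?N "range (\<lambda>c x. c * x)"
      by (rule gaussian_space_normal_line(1)[OF \<sigma>])
    have x: "(\<lambda>x. x) \<in> range (\<lambda>c x. c * x :: real)" by (auto intro!: range_eqI[of _ _ 1])
    have "integrable M (\<lambda>\<omega>. (Y \<omega>)\<^sup>2)"
      by (rule integrable_distr[of Y M borel "\<lambda>x. x\<^sup>2"]) (use N.square_integrable[OF x] D in auto)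
    moreover have "(\<integral>\<omega>. (Y \<omega>)\<^sup>2 \<partial>M) = (\<integral>x. x\<^sup>2 \<partial>?N)"
      unfolding D[symmetric] by (subst integral_distr) auto
    moreover have "(\<integral>\<omega>. cos (s + Y \<omega>) \<partial>M) = (\<integral>x. cos (s + x) \<partial>?N)"
      unfolding D[symmetric] by (subst integral_distr) auto
    ultimately show ?thesis using N.expectation_cos[OF x] by simp
  qed
  then show "integrable M (\<lambda>\<omega>. (Y \<omega>)\<^sup>2)"
    and "(\<integral>\<omega>. cos (s + Y \<omega>) \<partial>M) = cos s * exp (- (\<integral>\<omega>. (Y \<omega>)\<^sup>2 \<partial>M) / 2)" by auto
qed

text \<open>A single finite time set \<open>J\<close> serves all indices, with coefficients
  depending on \<open>i\<close> and \<open>t\<close>. Two combinations can then be merged over the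
  union of their time sets, padding with zeros, and each combination splits into one summand per
  index.\<close>

definition process_span :: "'i set \<Rightarrow> real set \<Rightarrow> ('i \<Rightarrow> real \<Rightarrow> 'a \<Rightarrow> real) \<Rightarrow> ('a \<Rightarrow> real) set" where
  "process_span I T X = {\<lambda>\<omega>. \<Sum>i\<in>I. \<Sum>t\<in>J. c i t * X i t \<omega> | J c. finite J \<and> J \<subseteq> T}"

lemma process_span_add:
  assumes "Y \<in> process_span I T X" "Z \<in> process_span I T X"
  shows "(\<lambda>\<omega>. Y \<omega> + Z \<omega>) \<in> process_span I T X"
proof -
  obtain J c where Y: "Y = (\<lambda>\<omega>. \<Sum>i\<in>I. \<Sum>t\<in>J. c i t * X i t \<omega>)" "finite J" "J \<subseteq> T"
    using assms(1) by (auto simp: process_span_def)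
  obtain L d where Z: "Z = (\<lambda>\<omega>. \<Sum>i\<in>I. \<Sum>t\<in>L. d i t * X i t \<omega>)" "finite L" "L \<subseteq> T"
    using assms(2) by (auto simp: process_span_def)
  have "(\<Sum>t\<in>J \<union> L. ((if t \<in> J then c i t else 0) + (if t \<in> L then d i t else 0)) * X i t \<omega>)
      = (\<Sum>t\<in>J. c i t * X i t \<omega>) + (\<Sum>t\<in>L. d i t * X i t \<omega>)" for i \<omega>
  proof -
    have "(\<Sum>t\<in>J \<union> L. (if t \<in> J then c i t else 0) * X i t \<omega>) = (\<Sum>t\<in>J. c i t * X i t \<omega>)"
      using Y Z by (intro sum.mono_neutral_cong_right) auto
    moreover have "(\<Sum>t\<in>J \<union> L. (if t \<in> L then d i t else 0) * X i t \<omega>) = (\<Sum>t\<in>L. d i t * X i t \<omega>)"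
      using Y Z by (intro sum.mono_neutral_cong_right) auto
    ultimately show ?thesis by (simp only: distrib_right sum.distrib)
  qed
  then have "(\<lambda>\<omega>. Y \<omega> + Z \<omega>) = (\<lambda>\<omega>. \<Sum>i\<in>I. \<Sum>t\<in>J \<union> L. ((if t \<in> J then c i t else 0) + (if t \<in> L then d i t else 0)) * X i t \<omega>)"
    using Y Z by (simp add: sum.distrib)
  then show ?thesis unfolding process_span_def using Y Z
    by (intro CollectI exI[of _ "J \<union> L"] exI[of _ "\<lambda>i t. (if t \<in> J then c i t else 0) + (if t \<in> L then d i t else 0)"]) auto
qed

lemma process_span_scale:
  assumes "Y \<in> process_span I T X"
  shows "(\<lambda>\<omega>. a * Y \<omega>) \<in> process_span I T X"
proof -
  obtain J c where Y: "Y = (\<lambda>\<omega>. \<Sum>i\<in>I. \<Sum>t\<in>J. c i t * X i t \<omega>)" "finite J" "J \<subseteq> T"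
    using assms(1) by (auto simp: process_span_def)
  then have "(\<lambda>\<omega>. a * Y \<omega>) = (\<lambda>\<omega>. \<Sum>i\<in>I. \<Sum>t\<in>J. (a * c i t) * X i t \<omega>)"
    by (simp add: sum_distrib_left mult.assoc)
  then show ?thesis unfolding process_span_def using Y
    by (intro CollectI exI[of _ J] exI[of _ "\<lambda>i t. a * c i t"]) auto
qed

lemma process_in_span:
  assumes "finite I" "i \<in> I" "t \<in> T"
  shows "X i t \<in> process_span I T X"
proof -
  have "(\<Sum>j\<in>I. \<Sum>r\<in>{t}. (if j = i then 1 else 0) * X j r \<omega>) = X i t \<omega>" for \<omega>
    using assms by (simp add: if_distrib[of "\<lambda>x. x * _"] cong: if_cong)
  then show ?thesis unfolding process_span_def using assms
    by (intro CollectI exI[of _ "{t}"] exI[of _ "\<lambda>j r. if j = i then 1 else 0"]) auto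
qed

lemma (in prob_space) indep_vars_imp_indep_var:
  fixes Y :: "'i \<Rightarrow> 'a \<Rightarrow> real"
  assumes "indep_vars (\<lambda>_. borel) Y I" "i \<in> I" "j \<in> I" "i \<noteq> j"
  shows "indep_var borel (Y i) borel (Y j)"
  using indep_vars_sum[of "{j}" i Y] indep_vars_subset[OF assms(1), of "{i, j}"] assms by simp

text \<open>Each process is Gaussian only on its own; joint Gaussianity comes from independence. A
  combination is a sum of independent Gaussian variables \<open>Z i\<close>, so characteristic
  functions multiply while variances add.\<close>

lemma (in prob_space) gaussian_space_process_span:
  fixes X :: "'i \<Rightarrow> real \<Rightarrow> 'a \<Rightarrow> real"
  assumes I: "finite I" and G: "\<And>i. i \<in> I \<Longrightarrow> gaussian_process M T (X i)"
    and mean: "\<And>i t. i \<in> I \<Longrightarrow> t \<in> T \<Longrightarrow> expectation (X i t) = 0"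
    and indep: "indep_vars (\<lambda>_. \<Pi>\<^sub>M t\<in>T. borel) (\<lambda>i \<omega>. \<lambda>t\<in>T. X i t \<omega>) I"
  shows "gaussian_space M (process_span I T X)"
    and "i \<in> I \<Longrightarrow> j \<in> I \<Longrightarrow> i \<noteq> j \<Longrightarrow> s \<in> T \<Longrightarrow> t \<in> T \<Longrightarrow> expectation (\<lambda>\<omega>. X i s \<omega> * X j t \<omega>) = 0"
proof -
  have rv: "gaussian_rv M (\<lambda>\<omega>. \<Sum>t\<in>J. c t * X i t \<omega>)" if "i \<in> I" "finite J" "J \<subseteq> T" for i J c
    using G that by (auto simp: gaussian_process_def)
  have rv1: "gaussian_rv M (X i t)" if "i \<in> I" "t \<in> T" for i t
    using rv[OF that(1), of "{t}" "\<lambda>_. 1"] that by simp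
  have mX[measurable]: "X i t \<in> borel_measurable M" if "i \<in> I" "t \<in> T" for i t
    using rv1[OF that] by (simp add: gaussian_rv_def)
  have iX: "integrable M (X i t)" if "i \<in> I" "t \<in> T" for i t
    using gaussian_rv_centered(1)[OF prob_space_axioms rv1[OF that] mean[OF that]] mX[OF that]
    by (rule square_integrable_imp_integrable[rotated])
  have lin: "indep_vars (\<lambda>_. borel) (\<lambda>i \<omega>. \<Sum>t\<in>J. c i t * X i t \<omega>) I" if J: "finite J" "J \<subseteq> T" for J c
  proof -
    have "indep_vars (\<lambda>_. borel) (\<lambda>i \<omega>. (\<lambda>f. \<Sum>t\<in>J. c i t * f t) (\<lambda>t\<in>T. X i t \<omega>)) I"
    proof (rule indep_vars_compose2[OF indep])
      fix i
      have "t \<in> J \<Longrightarrow> (\<lambda>f. f t) \<in> borel_measurable (\<Pi>\<^sub>M t\<in>T. borel :: real measure)" for t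
        using J by (intro measurable_component_singleton) auto
      then show "(\<lambda>f. \<Sum>t\<in>J. c i t * f t) \<in> borel_measurable (\<Pi>\<^sub>M t\<in>T. borel :: real measure)"
        by (intro borel_measurable_sum borel_measurable_times) auto
    qed
    moreover have "(\<Sum>t\<in>J. c i t * (\<lambda>t\<in>T. X i t \<omega>) t) = (\<Sum>t\<in>J. c i t * X i t \<omega>)" for i \<omega>
      using J by (intro sum.cong) auto
    ultimately show ?thesis by simp
  qed
  show "expectation (\<lambda>\<omega>. X i s \<omega> * X j t \<omega>) = 0" if "i \<in> I" "j \<in> I" "i \<noteq> j" "s \<in> T" "t \<in> T" for i j s t
  proof -
    \<comment> \<open>\<open>lin\<close> works with one time set for all indices, here
      \<open>{s, t}\<close>; these coefficients pick time \<open>s\<close> for index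
      \<open>i\<close> and time \<open>t\<close> for the others.\<close>
    let ?c = "\<lambda>k r. if r = (if k = i then s else t) then 1 else 0 :: real"
    have "indep_var borel (\<lambda>\<omega>. \<Sum>r\<in>{s, t}. ?c i r * X i r \<omega>) borel (\<lambda>\<omega>. \<Sum>r\<in>{s, t}. ?c j r * X j r \<omega>)"
      using that by (intro indep_vars_imp_indep_var[OF lin]) auto
    moreover have "(\<lambda>\<omega>. \<Sum>r\<in>{s, t}. ?c i r * X i r \<omega>) = X i s" "(\<lambda>\<omega>. \<Sum>r\<in>{s, t}. ?c j r * X j r \<omega>) = X j t"
      using that by (cases "s = t"; auto simp: fun_eq_iff)+
    ultimately have "indep_var borel (X i s) borel (X j t)" by simp
    then show ?thesis using indep_var_lebesgue_integral[OF _ iX[OF that(1,4)] iX[OF that(2,5)]] that mean by simp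
  qed
  show "gaussian_space M (process_span I T X)"
  proof
    fix Y assume "Y \<in> process_span I T X"
    then obtain J c where Y: "Y = (\<lambda>\<omega>. \<Sum>i\<in>I. \<Sum>t\<in>J. c i t * X i t \<omega>)" and J: "finite J" "J \<subseteq> T"
      by (auto simp: process_span_def)
    define Z where "Z i = (\<lambda>\<omega>. \<Sum>t\<in>J. c i t * X i t \<omega>)" for i
    have Y: "Y = (\<lambda>\<omega>. \<Sum>i\<in>I. Z i \<omega>)" using Y by (simp add: Z_def)
    have ind: "indep_vars (\<lambda>_. borel) Z I" using lin[OF J, of c] by (simp add: Z_def[abs_def])
    have rvZ: "gaussian_rv M (Z i)" if "i \<in> I" for i using rv[OF that J] by (simp add: Z_def[abs_def])
    have mZ[measurable]: "Z i \<in> borel_measurable M" if "i \<in> I" for i using rvZ[OF that] by (simp add: gaussian_rv_def)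
    have iZ: "integrable M (Z i)" "expectation (Z i) = 0" if "i \<in> I" for i
    proof -
      have "integrable M (\<lambda>\<omega>. c i t * X i t \<omega>)" if "t \<in> J" for t
        using iX[OF \<open>i \<in> I\<close>, of t] that J by auto
      then show "integrable M (Z i)" "expectation (Z i) = 0"
        unfolding Z_def using mean[OF that] J by (auto intro!: sum.neutral)
    qed
    note gc = gaussian_rv_centered[OF prob_space_axioms rvZ iZ(2)]
    have "integrable M (\<lambda>\<omega>. Z i \<omega> * Z j \<omega>) \<and>
        expectation (\<lambda>\<omega>. Z i \<omega> * Z j \<omega>) = (if i = j then expectation (\<lambda>\<omega>. (Z i \<omega>)\<^sup>2) else 0)"
      if "i \<in> I" "j \<in> I" for i j
    proof (cases "i = j")
      case True
      then show ?thesis using gc(1)[OF that(1) that(1)] by (simp add: power2_eq_square)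
    next
      case False
      have "indep_var borel (Z i) borel (Z j)" using indep_vars_imp_indep_var[OF ind that False] .
      then show ?thesis
        using indep_var_lebesgue_integral[OF _ iZ(1)[OF that(1)] iZ(1)[OF that(2)]]
          indep_var_integrable[OF _ iZ(1)[OF that(1)] iZ(1)[OF that(2)]] that False iZ(2)
        by simp
    qed
    note cross = this[THEN conjunct1] this[THEN conjunct2]
    have sq: "(Y \<omega>)\<^sup>2 = (\<Sum>i\<in>I. \<Sum>j\<in>I. Z i \<omega> * Z j \<omega>)" for \<omega>
      by (simp add: Y power2_eq_square sum_product)
    show "Y \<in> borel_measurable M" unfolding Y by measurable
    show "integrable M (\<lambda>\<omega>. (Y \<omega>)\<^sup>2)" unfolding sq using cross by (intro Bochner_Integration.integrable_sum) auto
    show "expectation Y = 0" unfolding Y using iZ by (simp add: Bochner_Integration.integral_sum)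
    have var: "expectation (\<lambda>\<omega>. (Y \<omega>)\<^sup>2) = (\<Sum>i\<in>I. expectation (\<lambda>\<omega>. (Z i \<omega>)\<^sup>2))"
    proof -
      have "expectation (\<lambda>\<omega>. (Y \<omega>)\<^sup>2) = (\<Sum>i\<in>I. \<Sum>j\<in>I. expectation (\<lambda>\<omega>. Z i \<omega> * Z j \<omega>))"
        unfolding sq using cross by (subst Bochner_Integration.integral_sum; intro sum.cong Bochner_Integration.integrable_sum Bochner_Integration.integral_sum) auto
      also have "\<dots> = (\<Sum>i\<in>I. \<Sum>j\<in>I. if i = j then expectation (\<lambda>\<omega>. (Z i \<omega>)\<^sup>2) else 0)"
        using cross(2) by (intro sum.cong) auto
      also have "\<dots> = (\<Sum>i\<in>I. expectation (\<lambda>\<omega>. (Z i \<omega>)\<^sup>2))" using I by simp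
      finally show ?thesis .
    qed
    \<comment> \<open>These two identities translate between phase-shifted cosines, in which
      Gaussianity is stated, and complex exponentials, for which the product formula of independent
      sums holds.\<close>
    have re_im: "(CLINT \<omega>|M. iexp (W \<omega>)) = Complex (expectation (\<lambda>\<omega>. cos (0 + W \<omega>))) (expectation (\<lambda>\<omega>. cos (-(pi/2) + W \<omega>)))"
      and re: "expectation (\<lambda>\<omega>. cos (s + W \<omega>)) = Re (iexp s * (CLINT \<omega>|M. iexp (W \<omega>)))"
      if [measurable]: "W \<in> borel_measurable M" for W s
    proof -
      have i: "integrable M (\<lambda>\<omega>. iexp (W \<omega>))" by (rule integrable_iexp) auto
      show "(CLINT \<omega>|M. iexp (W \<omega>)) = Complex (expectation (\<lambda>\<omega>. cos (0 + W \<omega>))) (expectation (\<lambda>\<omega>. cos (-(pi/2) + W \<omega>)))"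
        using integral_Re[OF i] integral_Im[OF i] by (simp add: complex_eq_iff Re_exp Im_exp cos_diff cos_add)
      have "Re (iexp s * (CLINT \<omega>|M. iexp (W \<omega>))) = Re (CLINT \<omega>|M. iexp s * iexp (W \<omega>))" by simp
      also have "\<dots> = expectation (\<lambda>\<omega>. Re (iexp s * iexp (W \<omega>)))"
        using i by (intro integral_Re[symmetric]) auto
      also have "\<dots> = expectation (\<lambda>\<omega>. cos (s + W \<omega>))" by (simp add: Re_exp Im_exp cos_add)
      finally show "expectation (\<lambda>\<omega>. cos (s + W \<omega>)) = Re (iexp s * (CLINT \<omega>|M. iexp (W \<omega>)))" ..
    qed
    have chi: "(CLINT \<omega>|M. iexp (Z i \<omega>)) = of_real (exp (- expectation (\<lambda>\<omega>. (Z i \<omega>)\<^sup>2) / 2))" if "i \<in> I" for i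
      using gc(2)[OF that that] by (simp only: re_im[OF mZ[OF that]]) (simp add: complex_eq_iff)
    have "(CLINT \<omega>|M. iexp (Y \<omega>)) = (\<Prod>i\<in>I. CLINT \<omega>|M. iexp (Z i \<omega>))"
      using char_distr_sum[OF ind, of 1] unfolding Y char_def by (simp add: integral_distr cong: prod.cong)
    also have "\<dots> = of_real (\<Prod>i\<in>I. exp (- expectation (\<lambda>\<omega>. (Z i \<omega>)\<^sup>2) / 2))"
      using chi by (simp del: of_real_exp)
    also have "(\<Prod>i\<in>I. exp (- expectation (\<lambda>\<omega>. (Z i \<omega>)\<^sup>2) / 2)) = exp (- expectation (\<lambda>\<omega>. (Y \<omega>)\<^sup>2) / 2)"
      using I by (simp add: var exp_sum[symmetric] sum_negf sum_divide_distrib)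
    finally show "expectation (\<lambda>\<omega>. cos (s + Y \<omega>)) = cos s * exp (- expectation (\<lambda>\<omega>. (Y \<omega>)\<^sup>2) / 2)" for s
      using re[OF \<open>Y \<in> borel_measurable M\<close>, of s] by (simp add: Re_exp del: of_real_exp)
  next
    show "(\<lambda>_. 0) \<in> process_span I T X"
      unfolding process_span_def by (intro CollectI exI[of _ "{}"]) simp
  qed (auto intro: process_span_add process_span_scale)
qed

section \<open>Reflection principle\<close>

text \<open>Reflecting the walk after step \<open>k\<close> replaces \<open>S m\<close> by \<open>2 * S k - S m\<close>.\<close>

lemma (in gaussian_space) walk_reflection:
  assumes S: "\<And>k. S k \<in> H"
    and cov: "\<And>i j. i \<le> j \<Longrightarrow> j \<le> m \<Longrightarrow> expectation (\<lambda>\<omega>. S i \<omega> * S j \<omega>) = v * real i"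
    and k: "k \<le> m"
    and P: "{f \<in> space (\<Pi>\<^sub>M i\<in>{..Suc k}. borel). P f} \<in> sets (\<Pi>\<^sub>M i\<in>{..Suc k}. borel)"
  shows "prob {\<omega>\<in>space M. P (\<lambda>i\<in>{..Suc k}. if i \<le> k then S i \<omega> else S m \<omega>)}
    = prob {\<omega>\<in>space M. P (\<lambda>i\<in>{..Suc k}. if i \<le> k then S i \<omega> else 2 * S k \<omega> - S m \<omega>)}"
proof -
  let ?I = "{..Suc k}" and ?L = "\<Pi>\<^sub>M i\<in>{..Suc k}. borel :: real measure"
  \<comment> \<open>Position \<open>Suc k\<close> of the family stores the endpoint
    \<open>S m\<close>: an event of first passage at \<open>k\<close> involves only the walk up to
    \<open>k\<close> and its final value.\<close>
  define X where "X = (\<lambda>i. if i \<le> k then S i else S m)"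
  define Y where "Y = (\<lambda>i. if i \<le> k then S i else (\<lambda>\<omega>. 2 * S k \<omega> - S m \<omega>))"
  have ax: "gaussian_space M H" ..
  have X: "X i \<in> H" and Y: "Y i \<in> H" for i
    using S k by (auto simp: X_def Y_def intro!: diff_closed scale_closed)
  have [measurable]: "X i \<in> borel_measurable M" "Y i \<in> borel_measurable M" for i
    using X Y measurable_H by auto
  have "distr M ?L (\<lambda>\<omega>. \<lambda>i\<in>?I. X i \<omega>) = distr M ?L (\<lambda>\<omega>. \<lambda>i\<in>?I. Y i \<omega>)"
  proof (rule gaussian_same_law[OF ax ax X Y])
    note SS = S[of k] S[of m] scale_closed[OF S[of k], of 2] diff_closed
    \<comment> \<open>The increment \<open>S m - S k\<close> is uncorrelated with \<open>S i\<close>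
      for \<open>i \<le> k\<close>, so reversing its sign alters no covariance.\<close>
    have 1: "expectation (\<lambda>\<omega>. S i \<omega> * (2 * S k \<omega> - S m \<omega>)) = v * real i" if "i \<le> k" for i
    proof -
      have i: "S i \<in> H" by (rule S)
      show ?thesis using that k cov[of i k] cov[of i m]
        by (simp add: covariance_diff_right[OF SS(3) SS(2) i] covariance_scale_right)
    qed
    have 2: "expectation (\<lambda>\<omega>. (2 * S k \<omega> - S m \<omega>) * (2 * S k \<omega> - S m \<omega>)) = v * real m"
      using 1[OF order_refl] k cov[of k m] cov[of m m]
      by (simp add: covariance_diff_left[OF SS(3) SS(2) SS(4)[OF SS(3) SS(2)]] covariance_scale_left
          covariance_diff_right[OF SS(3) SS(2) SS(2)] covariance_scale_right mult.commute[of "S m _" "S k _"])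
    fix i j
    show "expectation (\<lambda>\<omega>. X i \<omega> * X j \<omega>) = expectation (\<lambda>\<omega>. Y i \<omega> * Y j \<omega>)"
      using 1[of i] 1[of j] 2 cov[of i m] cov[of j m] cov[of m m] k
      by (auto simp: X_def Y_def mult.commute[of "S m _" "S j _"] mult.commute[of "2 * S k _ - S m _" "S j _"])
  qed
  then have "measure (distr M ?L (\<lambda>\<omega>. \<lambda>i\<in>?I. X i \<omega>)) {f\<in>space ?L. P f} = measure (distr M ?L (\<lambda>\<omega>. \<lambda>i\<in>?I. Y i \<omega>)) {f\<in>space ?L. P f}"
    by simp
  moreover have "(\<lambda>\<omega>. \<lambda>i\<in>?I. Z i \<omega>) -` {f\<in>space ?L. P f} \<inter> space M = {\<omega>\<in>space M. P (\<lambda>i\<in>?I. Z i \<omega>)}" for Z :: "nat \<Rightarrow> 'a \<Rightarrow> real"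
    by (auto simp: space_PiM)
  ultimately have "prob {\<omega>\<in>space M. P (\<lambda>i\<in>?I. X i \<omega>)} = prob {\<omega>\<in>space M. P (\<lambda>i\<in>?I. Y i \<omega>)}"
    using P by (simp add: measure_distr measurable_restrict)
  moreover have "(\<lambda>i\<in>?I. X i \<omega>) = (\<lambda>i\<in>?I. if i \<le> k then S i \<omega> else S m \<omega>)"
    "(\<lambda>i\<in>?I. Y i \<omega>) = (\<lambda>i\<in>?I. if i \<le> k then S i \<omega> else 2 * S k \<omega> - S m \<omega>)" for \<omega>
    by (auto simp: X_def Y_def restrict_def fun_eq_iff)
  ultimately show ?thesis by simp
qed

text \<open>The crossing event is split by the first index at which the walk exceeds
  \<open>q\<close>, and the walk is reflected after it. A discrete walk overshoots \<open>q\<close>,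
  so reflection gives inequalities only. Overshooting favours the upper bound; for the lower bound
  the increments are kept at most \<open>\<delta>\<close>, and the reflected endpoint then misses
  its target by at most \<open>2 * \<delta>\<close>.\<close>

lemma (in gaussian_space) walk_crossing_bounds:
  assumes S: "\<And>k. S k \<in> H"
    and cov: "\<And>i j. i \<le> j \<Longrightarrow> j \<le> m \<Longrightarrow> expectation (\<lambda>\<omega>. S i \<omega> * S j \<omega>) = v * real i"
    and q: "0 \<le> q" and c: "c \<le> q" and \<delta>: "0 \<le> \<delta>"
  shows "prob {\<omega>\<in>space M. S m \<omega> \<le> c \<and> (\<exists>k\<le>m. q < S k \<omega>)} \<le> prob {\<omega>\<in>space M. 2 * q - c < S m \<omega>}"
    and "prob {\<omega>\<in>space M. 2 * q - c + 2 * \<delta> < S m \<omega> \<and> S 0 \<omega> = 0 \<and> (\<forall>k<m. S (Suc k) \<omega> - S k \<omega> \<le> \<delta>)}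
      \<le> prob {\<omega>\<in>space M. S m \<omega> \<le> c \<and> (\<exists>k\<le>m. q < S k \<omega>)}"
proof -
  have mS[measurable]: "S k \<in> borel_measurable M" for k using S measurable_H by auto
  define A where "A k \<omega> \<longleftrightarrow> q < S k \<omega> \<and> (\<forall>j<k. S j \<omega> \<le> q)" for k \<omega>
  have mA[measurable]: "Measurable.pred M (A k)" for k
    unfolding A_def by measurable
  have uniq: "A i \<omega> \<Longrightarrow> A j \<omega> \<Longrightarrow> i = j" for i j \<omega>
    unfolding A_def by (metis linorder_cases not_le)
  have first: "\<exists>k\<le>i. A k \<omega>" if "q < S i \<omega>" for i \<omega>
  proof -
    define k where "k = (LEAST k. q < S k \<omega>)"
    have "q < S k \<omega>" "k \<le> i" unfolding k_def using that by (auto intro: LeastI Least_le)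
    moreover have "S j \<omega> \<le> q" if "j < k" for j using not_less_Least[of j "\<lambda>k. q < S k \<omega>"] that by (auto simp: k_def not_less)
    ultimately show ?thesis by (auto simp: A_def)
  qed
  have sumA: "prob {\<omega>\<in>space M. R \<omega> \<and> (\<exists>k\<le>m. A k \<omega>)} = (\<Sum>k\<le>m. prob {\<omega>\<in>space M. A k \<omega> \<and> R \<omega>})"
    if [measurable]: "Measurable.pred M R" for R
  proof -
    have "{\<omega>\<in>space M. R \<omega> \<and> (\<exists>k\<le>m. A k \<omega>)} = (\<Union>k\<in>{..m}. {\<omega>\<in>space M. A k \<omega> \<and> R \<omega>})" by auto
    moreover have "prob (\<Union>k\<in>{..m}. {\<omega>\<in>space M. A k \<omega> \<and> R \<omega>}) = (\<Sum>k\<le>m. prob {\<omega>\<in>space M. A k \<omega> \<and> R \<omega>})"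
    proof (rule finite_measure_finite_Union)
      show "(\<lambda>k. {\<omega>\<in>space M. A k \<omega> \<and> R \<omega>}) ` {..m} \<subseteq> events"
        by auto
    qed (auto simp: disjoint_family_on_def dest: uniq)
    ultimately show ?thesis by simp
  qed
  \<comment> \<open>The set \<open>R\<close> restricts the passage value \<open>S k\<close>, which
    reflection leaves unchanged; the lower bound uses it to record the overshoot.\<close>
  have refl: "prob {\<omega>\<in>space M. A k \<omega> \<and> S k \<omega> \<in> R \<and> S m \<omega> \<in> W}
      = prob {\<omega>\<in>space M. A k \<omega> \<and> S k \<omega> \<in> R \<and> 2 * S k \<omega> - S m \<omega> \<in> W}"
    if k: "k \<le> m" and [measurable]: "W \<in> sets borel" "R \<in> sets borel" for k R W
  proof -
    define P where "P f \<longleftrightarrow> (q < f k \<and> (\<forall>j\<in>{..<k}. f j \<le> q)) \<and> f k \<in> R \<and> f (Suc k) \<in> W" for f :: "nat \<Rightarrow> real"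
    have P: "{f \<in> space (\<Pi>\<^sub>M i\<in>{..Suc k}. borel). P f} \<in> sets (\<Pi>\<^sub>M i\<in>{..Suc k}. borel)"
    proof -
      have [measurable]: "(\<lambda>f. f i) \<in> borel_measurable (\<Pi>\<^sub>M i\<in>{..Suc k}. borel :: real measure)" if "i \<in> {..Suc k}" for i
        using that by (rule measurable_component_singleton)
      have [measurable]: "(\<lambda>f. f k) \<in> borel_measurable (\<Pi>\<^sub>M i\<in>{..Suc k}. borel :: real measure)"
        "(\<lambda>f. f (Suc k)) \<in> borel_measurable (\<Pi>\<^sub>M i\<in>{..Suc k}. borel :: real measure)" by auto
      have [measurable]: "j \<in> {..<k} \<Longrightarrow> (\<lambda>f. f j) \<in> borel_measurable (\<Pi>\<^sub>M i\<in>{..Suc k}. borel :: real measure)" for j by auto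
      show ?thesis unfolding P_def by measurable
    qed
    have *: "P (\<lambda>i\<in>{..Suc k}. if i \<le> k then S i \<omega> else x) \<longleftrightarrow> A k \<omega> \<and> S k \<omega> \<in> R \<and> x \<in> W" for \<omega> x
      by (auto simp: P_def A_def)
    show ?thesis using walk_reflection[OF S cov k P] unfolding * .
  qed
  have up: "prob {\<omega>\<in>space M. A k \<omega> \<and> S m \<omega> \<le> c} \<le> prob {\<omega>\<in>space M. A k \<omega> \<and> 2 * q - c < S m \<omega>}" if k: "k \<le> m" for k
  proof -
    have "prob {\<omega>\<in>space M. A k \<omega> \<and> S m \<omega> \<le> c} = prob {\<omega>\<in>space M. A k \<omega> \<and> 2 * S k \<omega> - S m \<omega> \<le> c}"
      using refl[OF k, of "{..c}" UNIV] by simp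
    also have "\<dots> \<le> prob {\<omega>\<in>space M. A k \<omega> \<and> 2 * q - c < S m \<omega>}"
      by (intro finite_measure_mono) (auto simp: A_def)
    finally show ?thesis .
  qed
  have lo: "prob {\<omega>\<in>space M. A k \<omega> \<and> S k \<omega> \<le> q + \<delta> \<and> 2 * q - c + 2 * \<delta> < S m \<omega>} \<le> prob {\<omega>\<in>space M. A k \<omega> \<and> S m \<omega> \<le> c}"
    if k: "k \<le> m" for k
  proof -
    have "prob {\<omega>\<in>space M. A k \<omega> \<and> S k \<omega> \<le> q + \<delta> \<and> 2 * q - c + 2 * \<delta> < S m \<omega>}
        = prob {\<omega>\<in>space M. A k \<omega> \<and> S k \<omega> \<le> q + \<delta> \<and> 2 * q - c + 2 * \<delta> < 2 * S k \<omega> - S m \<omega>}"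
      using refl[OF k, of "{2 * q - c + 2 * \<delta><..}" "{..q + \<delta>}"] by simp
    also have "\<dots> \<le> prob {\<omega>\<in>space M. A k \<omega> \<and> S m \<omega> \<le> c}"
      by (intro finite_measure_mono) auto
    finally show ?thesis .
  qed
  have U: "{\<omega>\<in>space M. S m \<omega> \<le> c \<and> (\<exists>k\<le>m. q < S k \<omega>)} = {\<omega>\<in>space M. S m \<omega> \<le> c \<and> (\<exists>k\<le>m. A k \<omega>)}"
    using first by (auto simp: A_def) (meson le_trans)
  have "prob {\<omega>\<in>space M. S m \<omega> \<le> c \<and> (\<exists>k\<le>m. q < S k \<omega>)} = (\<Sum>k\<le>m. prob {\<omega>\<in>space M. A k \<omega> \<and> S m \<omega> \<le> c})"
    unfolding U by (rule sumA) measurable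
  also have "\<dots> \<le> (\<Sum>k\<le>m. prob {\<omega>\<in>space M. A k \<omega> \<and> 2 * q - c < S m \<omega>})"
    by (intro sum_mono up) auto
  also have "\<dots> = prob {\<omega>\<in>space M. 2 * q - c < S m \<omega> \<and> (\<exists>k\<le>m. A k \<omega>)}"
    by (rule sumA[symmetric]) measurable
  also have "\<dots> \<le> prob {\<omega>\<in>space M. 2 * q - c < S m \<omega>}"
    by (intro finite_measure_mono) auto
  finally show "prob {\<omega>\<in>space M. S m \<omega> \<le> c \<and> (\<exists>k\<le>m. q < S k \<omega>)} \<le> prob {\<omega>\<in>space M. 2 * q - c < S m \<omega>}" .
  define G where "G \<omega> \<longleftrightarrow> 2 * q - c + 2 * \<delta> < S m \<omega> \<and> S 0 \<omega> = 0 \<and> (\<forall>k\<in>{..<m}. S (Suc k) \<omega> - S k \<omega> \<le> \<delta>)" for \<omega>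
  have [measurable]: "Measurable.pred M G" unfolding G_def by measurable
  \<comment> \<open>On \<open>G\<close> the endpoint exceeds \<open>2 * q - c\<close>, hence
    \<open>q\<close>, so a first passage exists. It is not at index 0, because
    \<open>S 0 = 0\<close> does not exceed \<open>q\<close>; its predecessor is at most
    \<open>q\<close>, which bounds the overshoot by \<open>\<delta>\<close>.\<close>
  have G: "\<exists>k\<le>m. A k \<omega>" "A k \<omega> \<Longrightarrow> k \<le> m \<Longrightarrow> S k \<omega> \<le> q + \<delta> \<and> 2 * q - c + 2 * \<delta> < S m \<omega>" if "G \<omega>" for \<omega> k
  proof -
    have "q < S m \<omega>" using that q c \<delta> by (auto simp: G_def)
    then show "\<exists>k\<le>m. A k \<omega>" by (rule first)
    assume A: "A k \<omega>" "k \<le> m"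
    have "k \<noteq> 0"
    proof
      assume "k = 0"
      then show False using A that q by (simp add: A_def G_def)
    qed
    then obtain j where j: "k = Suc j" by (cases k) auto
    then have "S j \<omega> \<le> q" "S k \<omega> - S j \<omega> \<le> \<delta>" using A that by (auto simp: A_def G_def)
    then show "S k \<omega> \<le> q + \<delta> \<and> 2 * q - c + 2 * \<delta> < S m \<omega>" using that by (auto simp: G_def)
  qed
  have "prob {\<omega>\<in>space M. G \<omega>} \<le> prob {\<omega>\<in>space M. G \<omega> \<and> (\<exists>k\<le>m. A k \<omega>)}"
    using G(1) by (intro finite_measure_mono) auto
  also have "\<dots> = (\<Sum>k\<le>m. prob {\<omega>\<in>space M. A k \<omega> \<and> G \<omega>})"
    by (rule sumA) measurable
  also have "\<dots> \<le> (\<Sum>k\<le>m. prob {\<omega>\<in>space M. A k \<omega> \<and> S m \<omega> \<le> c})"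
  proof (rule sum_mono)
    fix k assume "k \<in> {..m}"
    then have k: "k \<le> m" by simp
    have "prob {\<omega>\<in>space M. A k \<omega> \<and> G \<omega>} \<le> prob {\<omega>\<in>space M. A k \<omega> \<and> S k \<omega> \<le> q + \<delta> \<and> 2 * q - c + 2 * \<delta> < S m \<omega>}"
      using G(2) k by (intro finite_measure_mono) auto
    also note lo[OF k]
    finally show "prob {\<omega>\<in>space M. A k \<omega> \<and> G \<omega>} \<le> prob {\<omega>\<in>space M. A k \<omega> \<and> S m \<omega> \<le> c}" .
  qed
  also have "\<dots> = prob {\<omega>\<in>space M. S m \<omega> \<le> c \<and> (\<exists>k\<le>m. q < S k \<omega>)}"
    unfolding U by (rule sumA[symmetric]) measurable
  finally show "prob {\<omega>\<in>space M. 2 * q - c + 2 * \<delta> < S m \<omega> \<and> S 0 \<omega> = 0 \<and> (\<forall>k<m. S (Suc k) \<omega> - S k \<omega> \<le> \<delta>)}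
      \<le> prob {\<omega>\<in>space M. S m \<omega> \<le> c \<and> (\<exists>k\<le>m. q < S k \<omega>)}"
    by (simp add: G_def lessThan_def Ball_def)
qed

text \<open>A countable dense set of times in \<open>{0..h}\<close> that contains both ends, is the
  increasing union of uniform grids, as the walk approximation requires, and is invariant under the
  time reversal sending \<open>s\<close> to \<open>h - s\<close>.\<close>

definition dyadics :: "real \<Rightarrow> real set" where
  "dyadics h = {h * real k / 2 ^ n | k n. k \<le> 2 ^ n}"

lemma countable_dyadics: "countable (dyadics h)"
proof -
  have "dyadics h \<subseteq> (\<lambda>(k, n). h * real k / 2 ^ n) ` UNIV" by (auto simp: dyadics_def)
  then show ?thesis by (rule countable_subset) auto
qed

lemma dyadics_subset: "0 \<le> h \<Longrightarrow> dyadics h \<subseteq> {0..h}"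
proof
  fix s assume h: "0 \<le> h" and "s \<in> dyadics h"
  then obtain k n where s: "s = h * real k / 2 ^ n" and "k \<le> 2 ^ n" by (auto simp: dyadics_def)
  then have "real k \<le> 2 ^ n" by (simp add: of_nat_le_numeral_power_cancel_iff)
  then have "h * real k \<le> h * 2 ^ n" using h by (rule mult_left_mono)
  then show "s \<in> {0..h}" using h by (simp add: s divide_le_eq)
qed

lemma dyadics_ends: "0 \<in> dyadics h" "h \<in> dyadics h"
proof -
  show "0 \<in> dyadics h" unfolding dyadics_def by (intro CollectI exI[of _ 0]) simp
  show "h \<in> dyadics h" unfolding dyadics_def by (intro CollectI exI[of _ "1::nat"] exI[of _ "0::nat"]) simp
qed

lemma dyadics_reflect: "s \<in> dyadics h \<Longrightarrow> h - s \<in> dyadics h"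
proof -
  assume "s \<in> dyadics h"
  then obtain k n where "s = h * real k / 2 ^ n" "k \<le> 2 ^ n" by (auto simp: dyadics_def)
  then have "h - s = h * real (2 ^ n - k) / 2 ^ n" "2 ^ n - k \<le> 2 ^ n"
    by (auto simp: of_nat_diff field_simps)
  then show "h - s \<in> dyadics h" unfolding dyadics_def by blast
qed

text \<open>Rounding \<open>s\<close> down to the grid of mesh \<open>h / 2 ^ n\<close> gives dyadic
  times converging to \<open>s\<close>. The case \<open>h = 0\<close> is apart because the rounding
  divides by \<open>h\<close>.\<close>

lemma dyadics_dense:
  assumes h: "0 \<le> h" and f: "continuous_on {0..h} f" and le: "\<And>s. s \<in> dyadics h \<Longrightarrow> f s \<le> (c :: real)" and s: "s \<in> {0..h}"
  shows "f s \<le> c"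
proof (cases "h = 0")
  case True
  then show ?thesis using le dyadics_ends(1) s by auto
next
  case False
  define x where "x n = h * real (nat \<lfloor>s / h * 2 ^ n\<rfloor>) / 2 ^ n" for n
  have fl: "real (nat \<lfloor>s / h * 2 ^ n\<rfloor>) = of_int \<lfloor>s / h * 2 ^ n\<rfloor>" for n
    using s h by (simp add: of_nat_nat)
  have k: "nat \<lfloor>s / h * 2 ^ n\<rfloor> \<le> 2 ^ n" for n
  proof -
    have "s / h * 2 ^ n \<le> 1 * 2 ^ n" using s h False by (intro mult_right_mono) auto
    then have "\<lfloor>s / h * 2 ^ n\<rfloor> \<le> 2 ^ n" by (simp add: floor_le_iff)
    then show ?thesis by (simp add: nat_le_iff)
  qed
  then have x: "x n \<in> dyadics h" for n unfolding x_def dyadics_def by blast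
  have b: "s - h / 2 ^ n \<le> x n" "x n \<le> s" for n
  proof -
    have f: "s / h * 2 ^ n - 1 \<le> of_int \<lfloor>s / h * 2 ^ n\<rfloor>" "of_int \<lfloor>s / h * 2 ^ n\<rfloor> \<le> s / h * 2 ^ n" by linarith+
    have e: "h * (s / h * 2 ^ n) = s * 2 ^ n" using False by simp
    have "s * 2 ^ n - h \<le> h * of_int \<lfloor>s / h * 2 ^ n\<rfloor>"
      using mult_left_mono[OF f(1) h] unfolding right_diff_distrib e by simp
    moreover have "h * of_int \<lfloor>s / h * 2 ^ n\<rfloor> \<le> s * 2 ^ n"
      using mult_left_mono[OF f(2) h] unfolding e .
    ultimately
    show "s - h / 2 ^ n \<le> x n" "x n \<le> s"
      unfolding x_def fl by (simp_all add: divide_le_eq le_divide_eq left_diff_distrib)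
  qed
  have "x \<longlonglongrightarrow> s"
  proof (rule tendsto_sandwich)
    show "(\<lambda>n. s - h / 2 ^ n) \<longlonglongrightarrow> s" by real_asymp
  qed (use b in auto)
  moreover have "eventually (\<lambda>n. x n \<in> {0..h}) sequentially"
    by (intro always_eventually allI subsetD[OF dyadics_subset[OF h] x])
  ultimately have "(\<lambda>n. f (x n)) \<longlonglongrightarrow> f s" using continuous_on_tendsto_compose[OF f] s by blast
  then show ?thesis by (rule LIMSEQ_le_const2) (use le x in auto)
qed

text \<open>Covariance \<open>\<theta> * s\<close> turns every dyadic grid into a walk with
  uncorrelated increments. The upper bound holds on each grid and passes to the limit of the
  increasing crossing events. The lower bound is exact only after two limits, the mesh tending to 0
  for fixed \<open>\<delta>\<close> and then \<open>\<delta>\<close> tending to 0.\<close>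

theorem (in gaussian_space) brownian_reflection:
  fixes B :: "real \<Rightarrow> 'a \<Rightarrow> real"
  assumes h: "0 < h"
    and B: "\<And>s. s \<in> {0..h} \<Longrightarrow> B s \<in> H"
    and cov: "\<And>s t. 0 \<le> s \<Longrightarrow> s \<le> t \<Longrightarrow> t \<le> h \<Longrightarrow> expectation (\<lambda>\<omega>. B s \<omega> * B t \<omega>) = \<theta> * s"
    and cont: "AE \<omega> in M. continuous_on {0..h} (\<lambda>s. B s \<omega>)"
    and q: "0 \<le> q" and c: "c \<le> q"
  shows "prob {\<omega>\<in>space M. B h \<omega> \<le> c \<and> (\<exists>s\<in>dyadics h. q < B s \<omega>)} = prob {\<omega>\<in>space M. 2 * q - c < B h \<omega>}"
proof -
  define m :: "nat \<Rightarrow> nat" where "m n = 2 ^ n" for n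
  \<comment> \<open>The minimum freezes the walk after its last grid point, so that
    \<open>S n k\<close> is defined and lies in \<open>H\<close> for every \<open>k\<close>.\<close>
  define S where "S n k = B (h * real (min k (m n)) / 2 ^ n)" for n k
  have grid: "h * real (min k (m n)) / 2 ^ n \<in> dyadics h" for n k
    unfolding dyadics_def m_def by (intro CollectI exI[of _ "min k (2 ^ n)"] exI[of _ n]) auto
  then have grid': "h * real (min k (m n)) / 2 ^ n \<in> {0..h}" for n k by (meson dyadics_subset h less_imp_le subsetD)
  have S: "S n k \<in> H" for n k unfolding S_def by (intro B grid')
  have Sm: "S n (m n) = B h" for n by (simp add: S_def m_def)
  have covS: "expectation (\<lambda>\<omega>. S n i \<omega> * S n j \<omega>) = (\<theta> * h / 2 ^ n) * real i" if "i \<le> j" "j \<le> m n" for n i j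
  proof -
    have "h * real (min i (m n)) / 2 ^ n \<le> h * real (min j (m n)) / 2 ^ n"
      using that h by (intro divide_right_mono mult_left_mono) auto
    then show ?thesis unfolding S_def using cov grid'[of i n] grid'[of j n] that by (simp add: min_def)
  qed
  have [measurable]: "S n k \<in> borel_measurable M" for n k using S measurable_H by auto
  have mBh[measurable]: "B h \<in> borel_measurable M" using B h measurable_H by auto
  define U where "U n = {\<omega>\<in>space M. B h \<omega> \<le> c \<and> (\<exists>k\<in>{..m n}. q < S n k \<omega>)}" for n
  have mU[measurable]: "U n \<in> events" for n unfolding U_def by measurable
  have "incseq U"
  proof (rule incseq_SucI)
    fix n
    have "S (Suc n) (2 * k) = S n k" if "k \<le> m n" for k
      using that by (simp add: S_def m_def min_def)
    moreover have "2 * k \<le> m (Suc n)" if "k \<le> m n" for k using that by (simp add: m_def)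
    ultimately show "U n \<subseteq> U (Suc n)" unfolding U_def by (auto intro!: bexI[of _ "2 * _"])
  qed
  moreover have "(\<Union>n. U n) = {\<omega>\<in>space M. B h \<omega> \<le> c \<and> (\<exists>s\<in>dyadics h. q < B s \<omega>)}" (is "_ = ?T")
  proof
    show "(\<Union>n. U n) \<subseteq> ?T" unfolding U_def S_def using grid by blast
    show "?T \<subseteq> (\<Union>n. U n)"
    proof safe
      fix \<omega> s assume *: "\<omega> \<in> space M" "B h \<omega> \<le> c" "s \<in> dyadics h" "q < B s \<omega>"
      then obtain k n where "s = h * real k / 2 ^ n" "k \<le> 2 ^ n" by (auto simp: dyadics_def)
      then have "\<omega> \<in> U n" using * by (auto simp: U_def S_def m_def intro!: bexI[of _ k])
      then show "\<omega> \<in> (\<Union>n. U n)" by auto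
    qed
  qed
  ultimately have lim: "(\<lambda>n. prob (U n)) \<longlonglongrightarrow> prob ?T"
    using finite_Lim_measure_incseq[of U] mU by (auto simp: image_subset_iff)
  have U': "U n = {\<omega>\<in>space M. S n (m n) \<omega> \<le> c \<and> (\<exists>k\<le>m n. q < S n k \<omega>)}" for n
    by (auto simp: U_def Sm)
  have "prob (U n) \<le> prob {\<omega>\<in>space M. 2 * q - c < B h \<omega>}" for n
    using walk_crossing_bounds(1)[where S="S n" and m="m n", OF S covS q c order_refl] by (simp add: U' Sm)
  then have upper: "prob ?T \<le> prob {\<omega>\<in>space M. 2 * q - c < B h \<omega>}"
    by (intro LIMSEQ_le_const2[OF lim]) auto
  have B0: "AE \<omega> in M. B 0 \<omega> = 0"
    using AE_zero[OF B[of 0]] cov[of 0 0] h by simp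
  have lower: "prob {\<omega>\<in>space M. 2 * q - c + 2 * \<delta> < B h \<omega>} \<le> prob ?T" if \<delta>: "0 < \<delta>" for \<delta>
  proof -
    define G where "G n = {\<omega>\<in>space M. S n 0 \<omega> = 0 \<and> (\<forall>k\<in>{..<m n}. S n (Suc k) \<omega> - S n k \<omega> \<le> \<delta>)}" for n
    have [measurable]: "G n \<in> events" for n unfolding G_def by measurable
    \<comment> \<open>A continuous path is uniformly continuous on \<open>{0..h}\<close>, so from
      some grid on its increments stay below \<open>\<delta>\<close>. That grid depends on
      \<open>\<omega>\<close>; dominated convergence turns this into convergence of
      \<open>prob (G n)\<close> to 1.\<close>
    have "AE \<omega> in M. eventually (\<lambda>n. \<omega> \<in> G n) sequentially"
      using B0 cont AE_space
    proof eventually_elim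
      case (elim \<omega>)
      have "uniformly_continuous_on {0..h} (\<lambda>s. B s \<omega>)"
        using elim by (intro compact_uniformly_continuous) auto
      then obtain d where d: "0 < d" "\<And>x y. x \<in> {0..h} \<Longrightarrow> y \<in> {0..h} \<Longrightarrow> dist y x < d \<Longrightarrow> dist (B y \<omega>) (B x \<omega>) < \<delta>"
        unfolding uniformly_continuous_on_def using \<delta> by meson
      have "(\<lambda>n. h / 2 ^ n) \<longlonglongrightarrow> 0" by real_asymp
      then have "eventually (\<lambda>n. h / 2 ^ n < d) sequentially" using d(1) by (rule order_tendstoD)
      then show ?case
      proof eventually_elim
        case (elim n)
        have "S n (Suc k) \<omega> - S n k \<omega> \<le> \<delta>" if "k < m n" for k
        proof -
          have "h * real (min (Suc k) (m n)) / 2 ^ n - h * real (min k (m n)) / 2 ^ n = h / 2 ^ n"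
            using that by (simp add: min_def field_simps)
          then have "dist (h * real (min (Suc k) (m n)) / 2 ^ n) (h * real (min k (m n)) / 2 ^ n) < d"
            using elim h by (simp add: dist_real_def)
          then have "dist (S n (Suc k) \<omega>) (S n k \<omega>) < \<delta>" unfolding S_def by (intro d(2) grid')
          then show ?thesis by (simp add: dist_real_def)
        qed
        then show ?case using \<open>B 0 \<omega> = 0\<close> \<open>\<omega> \<in> space M\<close> by (simp add: G_def S_def)
      qed
    qed
    then have "AE \<omega> in M. (\<lambda>n. indicator (G n) \<omega> :: real) \<longlonglongrightarrow> 1"
      by eventually_elim (auto intro!: tendsto_eventually elim!: eventually_mono)
    then have "(\<lambda>n. expectation (indicat_real (G n))) \<longlonglongrightarrow> expectation (\<lambda>_. 1)"
      by (intro integral_dominated_convergence[where w="\<lambda>_. 1"]) (auto simp: indicator_def)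
    then have limG: "(\<lambda>n. prob (G n)) \<longlonglongrightarrow> 1" by (simp add: prob_space)
    have bnd: "prob {\<omega>\<in>space M. 2 * q - c + 2 * \<delta> < B h \<omega>} - (1 - prob (G n)) \<le> prob (U n)" for n
    proof -
      let ?E = "{\<omega>\<in>space M. 2 * q - c + 2 * \<delta> < B h \<omega>}"
      have "prob ?E \<le> prob ((?E \<inter> G n) \<union> (space M - G n))"
        by (intro finite_measure_mono) auto
      also have "\<dots> \<le> prob (?E \<inter> G n) + prob (space M - G n)"
        by (intro measure_Un_le) auto
      also have "prob (space M - G n) = 1 - prob (G n)" by (simp add: prob_compl)
      also have "prob (?E \<inter> G n) \<le> prob (U n)"
      proof -
        have "?E \<inter> G n = {\<omega>\<in>space M. 2 * q - c + 2 * \<delta> < S n (m n) \<omega> \<and> S n 0 \<omega> = 0 \<and> (\<forall>k<m n. S n (Suc k) \<omega> - S n k \<omega> \<le> \<delta>)}"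
          by (auto simp: G_def Sm)
        then show ?thesis
          using walk_crossing_bounds(2)[where S="S n" and m="m n", OF S covS q c, of \<delta>] \<delta> by (simp add: U')
      qed
      finally show ?thesis by simp
    qed
    have "(\<lambda>n. prob {\<omega>\<in>space M. 2 * q - c + 2 * \<delta> < B h \<omega>} - (1 - prob (G n))) \<longlonglongrightarrow>
        prob {\<omega>\<in>space M. 2 * q - c + 2 * \<delta> < B h \<omega>} - (1 - 1)"
      by (intro tendsto_intros limG)
    from LIMSEQ_le[OF this lim] bnd show ?thesis by auto
  qed
  have "prob {\<omega>\<in>space M. 2 * q - c < B h \<omega>} \<le> prob ?T"
  proof -
    \<comment> \<open>The inequality \<open>2 * q - c < B h\<close> is strict, so the events with
      slack \<open>2 / (j + 1)\<close> increase to it.\<close>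
    define V where "V j = {\<omega>\<in>space M. 2 * q - c + 2 * (1 / real (Suc j)) < B h \<omega>}" for j
    have "incseq V"
    proof (rule incseq_SucI)
      fix j
      have "1 / real (Suc (Suc j)) \<le> 1 / real (Suc j)" by (intro divide_left_mono) auto
      then show "V j \<subseteq> V (Suc j)" by (auto simp: V_def)
    qed
    moreover have "V j \<in> events" for j unfolding V_def by measurable
    moreover have "(\<Union>j. V j) = {\<omega>\<in>space M. 2 * q - c < B h \<omega>}"
    proof safe
      fix \<omega> j assume "\<omega> \<in> V j"
      moreover have "0 < 1 / real (Suc j)" by simp
      ultimately show "2 * q - c < B h \<omega>" unfolding V_def mem_Collect_eq by linarith
    next
      fix \<omega> assume \<omega>: "\<omega> \<in> space M" "2 * q - c < B h \<omega>"
      then obtain j where "1 / real (Suc j) < (B h \<omega> - (2 * q - c)) / 2"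
        using nat_approx_posE[of "(B h \<omega> - (2 * q - c)) / 2"] by auto
      then have "\<omega> \<in> V j" using \<omega> by (auto simp: V_def)
      then show "\<omega> \<in> (\<Union>j. V j)" by auto
    qed (auto simp: V_def)
    ultimately have "(\<lambda>j. prob (V j)) \<longlonglongrightarrow> prob {\<omega>\<in>space M. 2 * q - c < B h \<omega>}"
      using finite_Lim_measure_incseq[of V] by (auto simp: image_subset_iff)
    moreover have "prob (V j) \<le> prob ?T" for j unfolding V_def by (rule lower) simp
    ultimately show ?thesis by (intro LIMSEQ_le_const2) auto
  qed
  then show ?thesis using upper by simp
qed

section \<open>Crossing probabilities of bridges\<close>

lemma pred_Ball_countable:
  assumes D: "countable D" and P: "\<And>s. s \<in> D \<Longrightarrow> Measurable.pred M (\<lambda>x. P x s)"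
  shows "Measurable.pred M (\<lambda>x. \<forall>s\<in>D. P x s)"
proof (cases "D = {}")
  case False
  have "{x\<in>space M. \<forall>s\<in>D. P x s} = (\<Inter>s\<in>D. {x\<in>space M. P x s})"
    using False by auto
  also have "\<dots> \<in> sets M"
    using P D False by (intro sets.countable_INT') (auto simp: pred_def)
  finally show ?thesis by (simp add: pred_def)
qed simp

lemma measure_pair_section:
  assumes "prob_space M" "prob_space N" and E: "E \<in> sets (M \<Otimes>\<^sub>M N)"
  shows "measure (M \<Otimes>\<^sub>M N) E = (\<integral>y. measure M ((\<lambda>x. (x, y)) -` E) \<partial>N)"
    and "(\<lambda>y. measure M ((\<lambda>x. (x, y)) -` E)) \<in> borel_measurable N"
proof -
  interpret M: prob_space M by fact
  interpret N: prob_space N by fact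
  interpret P: pair_prob_space M N ..
  have "(\<lambda>y. emeasure M ((\<lambda>x. (x, y)) -` E)) \<in> borel_measurable N"
    by (rule P.measurable_emeasure_Pair2[OF E])
  then show m: "(\<lambda>y. measure M ((\<lambda>x. (x, y)) -` E)) \<in> borel_measurable N"
    unfolding measure_def by measurable
  have "measure (M \<Otimes>\<^sub>M N) E = enn2real (\<integral>\<^sup>+y. emeasure M ((\<lambda>x. (x, y)) -` E) \<partial>N)"
    by (simp add: measure_def P.emeasure_pair_measure_alt2[OF E])
  also have "\<dots> = (\<integral>y. measure M ((\<lambda>x. (x, y)) -` E) \<partial>N)"
    by (subst integral_eq_nn_integral[OF m]) (auto simp: M.emeasure_eq_measure)
  finally show "measure (M \<Otimes>\<^sub>M N) E = (\<integral>y. measure M ((\<lambda>x. (x, y)) -` E) \<partial>N)" .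
qed

text \<open>The reflection identity holds for every bound \<open>c\<close> on the endpoint; this
  lemma plays the part of differentiating it in \<open>c\<close>. Equal integrals mean equal
  distribution functions, hence equal measures, hence densities that agree almost
  everywhere.\<close>

lemma AE_eq_of_integrals_atMost:
  fixes f g :: "real \<Rightarrow> real"
  assumes f: "integrable lborel f" "\<And>x. 0 \<le> f x" and g: "integrable lborel g" "\<And>x. 0 \<le> g x"
    and eq: "\<And>c. (LINT x:{..c}|lborel. f x) = (LINT x:{..c}|lborel. g x)"
  shows "AE x in lborel. f x = g x"
proof -
  have [measurable]: "f \<in> borel_measurable borel" "g \<in> borel_measurable borel" using f g by auto
  have e: "emeasure (density lborel (\<lambda>x. ennreal (k x))) A = ennreal (LINT x:A|lborel. k x)"
    if k: "integrable lborel k" "\<And>x. 0 \<le> k x" and [measurable]: "A \<in> sets borel" for k :: "real \<Rightarrow> real" and A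
  proof -
    have [measurable]: "k \<in> borel_measurable borel" using k by auto
    have "emeasure (density lborel (\<lambda>x. ennreal (k x))) A = (\<integral>\<^sup>+x. ennreal (indicator A x * k x) \<partial>lborel)"
      by (subst emeasure_density) (auto intro!: nn_integral_cong simp: indicator_def)
    also have "\<dots> = ennreal (\<integral>x. indicator A x * k x \<partial>lborel)"
      using k by (intro nn_integral_eq_integral) (auto intro!: integrable_real_mult_indicator[of A lborel k, unfolded mult.commute[of _ "indicator A _"]])
    finally show ?thesis by (simp add: set_lebesgue_integral_def)
  qed
  have fin: "finite_borel_measure (density lborel (\<lambda>x. ennreal (k x)))" if "integrable lborel k" "\<And>x. 0 \<le> k x" for k :: "real \<Rightarrow> real"
    unfolding finite_borel_measure_def finite_borel_measure_axioms_def
    using e[OF that, of UNIV] by (auto intro!: finite_measureI)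
  have "density lborel (\<lambda>x. ennreal (f x)) = density lborel (\<lambda>x. ennreal (g x))"
  proof (rule cdf_unique'[OF fin fin])
    show "cdf (density lborel (\<lambda>x. ennreal (f x))) = cdf (density lborel (\<lambda>x. ennreal (g x)))"
      by (auto simp: fun_eq_iff cdf_def measure_def e[OF f] e[OF g] eq)
  qed (use f g in auto)
  then have "AE x in lborel. ennreal (f x) = ennreal (g x)"
    by (intro sigma_finite_measure.density_unique[OF lborel.sigma_finite_measure_axioms]) auto
  then show ?thesis using f g by (auto elim!: eventually_mono)
qed

text \<open>The likelihood ratio between the mirror image \<open>2 * q - y\<close> and
  \<open>y\<close> is the source of the exponential in the crossing probability: the squares differ
  by \<open>4 * q * (q - y)\<close>.\<close>

lemma normal_density_reflect_ratio:
  assumes "0 < v"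
  shows "normal_density 0 (sqrt v) (2 * q - y) = exp (- 2 * q * (q - y) / v) * normal_density 0 (sqrt v) y"
proof -
  have "- (2 * q - y)\<^sup>2 / (2 * v) = - 2 * q * (q - y) / v + - y\<^sup>2 / (2 * v)"
    using assms by (simp add: field_simps power2_eq_square)
  then show ?thesis using assms by (simp add: normal_density_def exp_add[symmetric])
qed

locale bridge_crossing = gaussian_space +
  fixes R :: "real \<Rightarrow> 'a \<Rightarrow> real" and h \<theta> \<tau> :: real
  assumes h: "0 < h" and \<theta>: "0 < \<theta>" and pos: "0 < \<theta> - \<tau> * h"
    and R: "\<And>s. s \<in> {0..h} \<Longrightarrow> R s \<in> H"
    and cov: "\<And>s t. 0 \<le> s \<Longrightarrow> s \<le> t \<Longrightarrow> t \<le> h \<Longrightarrow> expectation (\<lambda>\<omega>. R s \<omega> * R t \<omega>) = s * (\<theta> - \<tau> * t)"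
    and cont: "AE \<omega> in M. continuous_on {0..h} (\<lambda>s. R s \<omega>)"
begin

text \<open>The coefficient \<open>s / h\<close> is the regression of \<open>R s\<close> on
  \<open>R h\<close>: covariance and variance share the factor \<open>\<theta> - \<tau> * h\<close>,
  so their ratio is free of \<open>\<tau>\<close>.\<close>

definition bridge :: "real \<Rightarrow> 'a \<Rightarrow> real" where
  "bridge s \<omega> = R s \<omega> - (s / h) * R h \<omega>"

text \<open>The probability that the path pinned at 0 and at the endpoint \<open>y\<close> stays
  under \<open>q\<close>. As the bridge is independent of \<open>R h\<close>, this is the
  conditional probability given the endpoint, and a linear drift is absorbed into
  \<open>y\<close>.\<close>

definition below :: "real \<Rightarrow> real \<Rightarrow> real" where
  "below q y = prob {\<omega>\<in>space M. \<forall>s\<in>dyadics h. bridge s \<omega> + s / h * y \<le> q}"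

lemma Rh: "R h \<in> H" using R h by auto

lemma bridge_H: "s \<in> {0..h} \<Longrightarrow> bridge s \<in> H"
  unfolding bridge_def[abs_def] using R Rh by (intro diff_closed scale_closed) auto

lemma bridge_measurable[measurable]: "s \<in> dyadics h \<Longrightarrow> bridge s \<in> borel_measurable M"
  using bridge_H dyadics_subset[of h] h measurable_H by (meson less_imp_le subsetD)

lemma bridge_uncorrelated: "s \<in> {0..h} \<Longrightarrow> expectation (\<lambda>\<omega>. bridge s \<omega> * R h \<omega>) = 0"
  unfolding bridge_def using R[of s] Rh cov[of s h] cov[of h h] h scale_closed[OF Rh, of "s / h"]
  by (simp add: covariance_diff_left covariance_scale_left)

text \<open>The terms in \<open>\<tau>\<close> cancel, leaving the covariance of a Brownian bridge
  of rate \<open>\<theta>\<close>. Hence \<open>\<tau>\<close> affects \<open>R\<close> only through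
  the variance of its endpoint.\<close>

lemma bridge_cov:
  assumes "0 \<le> s" "s \<le> t" "t \<le> h"
  shows "expectation (\<lambda>\<omega>. bridge s \<omega> * bridge t \<omega>) = \<theta> * s - \<theta> * s * t / h"
proof -
  have H: "R s \<in> H" "R t \<in> H" "bridge s \<in> H" using assms R bridge_H by auto
  have "expectation (\<lambda>\<omega>. bridge s \<omega> * bridge t \<omega>)
      = expectation (\<lambda>\<omega>. bridge s \<omega> * R t \<omega>) - t / h * expectation (\<lambda>\<omega>. bridge s \<omega> * R h \<omega>)"
    unfolding bridge_def[of t] using H Rh scale_closed[OF Rh, of "t / h"]
    by (simp add: covariance_diff_right covariance_scale_right)
  also have "\<dots> = expectation (\<lambda>\<omega>. bridge s \<omega> * R t \<omega>)"
    using bridge_uncorrelated[of s] assms by simp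
  also have "\<dots> = expectation (\<lambda>\<omega>. R s \<omega> * R t \<omega>) - s / h * expectation (\<lambda>\<omega>. R t \<omega> * R h \<omega>)"
    unfolding bridge_def using H Rh scale_closed[OF Rh, of "s / h"]
    by (simp add: covariance_diff_left covariance_scale_left mult.commute[of "R h _" "R t _"])
  also have "\<dots> = s * (\<theta> - \<tau> * t) - s / h * (t * (\<theta> - \<tau> * h))"
    using cov[of s t] cov[of t h] assms by simp
  also have "\<dots> = \<theta> * s - \<theta> * s * t / h" using h by (simp add: field_simps)
  finally show ?thesis .
qed

text \<open>Integration over the endpoint \<open>y\<close> last: for fixed \<open>y\<close> the
  pinned path crosses \<open>q\<close> with probability \<open>1 - below q y\<close>. The standard
  deviation \<open>\<sigma>\<close> is left free because the endpoint adjoined for the reflection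
  argument has another variance than \<open>R h\<close>.\<close>

lemma pair_normal_section:
  assumes \<sigma>: "0 < \<sigma>"
  shows "measure (M \<Otimes>\<^sub>M density lborel (normal_density 0 \<sigma>))
      {p\<in>space (M \<Otimes>\<^sub>M density lborel (normal_density 0 \<sigma>)). snd p \<le> c \<and> (\<exists>s\<in>dyadics h. q < bridge s (fst p) + s / h * snd p)}
    = (LINT y:{..c}|lborel. normal_density 0 \<sigma> y * (1 - below q y))"
    and "below q \<in> borel_measurable borel"
proof -
  let ?N = "density lborel (normal_density 0 \<sigma>)"
  interpret N: prob_space ?N by (rule prob_space_normal_density[OF \<sigma>])
  interpret P: pair_prob_space M ?N ..
  have ax: "prob_space M" "prob_space ?N" by unfold_locales
  have D: "countable (dyadics h)" by (rule countable_dyadics)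
  have pB: "Measurable.pred (M \<Otimes>\<^sub>M ?N) (\<lambda>p. \<forall>s\<in>dyadics h. bridge s (fst p) + s / h * snd p \<le> q)"
  proof (rule pred_Ball_countable[OF D])
    fix s assume "s \<in> dyadics h"
    note [measurable] = bridge_measurable[OF this]
    have [measurable]: "snd \<in> borel_measurable (M \<Otimes>\<^sub>M ?N)" using measurable_snd[of M ?N] by simp
    show "Measurable.pred (M \<Otimes>\<^sub>M ?N) (\<lambda>p. bridge s (fst p) + s / h * snd p \<le> q)" by measurable
  qed
  have sect: "(\<lambda>x. (x, y)) -` {p\<in>space (M \<Otimes>\<^sub>M ?N). \<forall>s\<in>dyadics h. bridge s (fst p) + s / h * snd p \<le> q}
      = {\<omega>\<in>space M. \<forall>s\<in>dyadics h. bridge s \<omega> + s / h * y \<le> q}" for y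
    by (auto simp: space_pair_measure)
  show mb: "below q \<in> borel_measurable borel"
    using measure_pair_section(2)[OF ax pB[unfolded pred_def]] unfolding sect below_def[symmetric] by simp
  let ?E = "{p\<in>space (M \<Otimes>\<^sub>M ?N). snd p \<le> c \<and> (\<exists>s\<in>dyadics h. q < bridge s (fst p) + s / h * snd p)}"
  have E: "?E \<in> sets (M \<Otimes>\<^sub>M ?N)"
  proof -
    note [measurable] = pB
    have [measurable]: "snd \<in> borel_measurable (M \<Otimes>\<^sub>M ?N)" using measurable_snd[of M ?N] by simp
    have "?E = {p\<in>space (M \<Otimes>\<^sub>M ?N). snd p \<le> c \<and> \<not> (\<forall>s\<in>dyadics h. bridge s (fst p) + s / h * snd p \<le> q)}"
      by (auto simp: not_le)
    also have "\<dots> \<in> sets (M \<Otimes>\<^sub>M ?N)" by measurable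
    finally show ?thesis .
  qed
  have sE: "measure M ((\<lambda>x. (x, y)) -` ?E) = indicator {..c} y * (1 - below q y)" for y
  proof (cases "y \<le> c")
    case True
    then have "(\<lambda>x. (x, y)) -` ?E = space M - {\<omega>\<in>space M. \<forall>s\<in>dyadics h. bridge s \<omega> + s / h * y \<le> q}"
      by (auto simp: space_pair_measure not_le)
    moreover have "{\<omega>\<in>space M. \<forall>s\<in>dyadics h. bridge s \<omega> + s / h * y \<le> q} \<in> sets M"
      unfolding pred_def[symmetric] by (intro pred_Ball_countable[OF D]) measurable
    ultimately show ?thesis using True by (simp add: prob_compl below_def)
  qed (auto simp: vimage_def)
  have "measure (M \<Otimes>\<^sub>M ?N) ?E = (\<integral>y. indicator {..c} y * (1 - below q y) \<partial>?N)"
    unfolding measure_pair_section(1)[OF ax E] sE ..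
  also have "\<dots> = (LINT y:{..c}|lborel. normal_density 0 \<sigma> y * (1 - below q y))"
    using mb by (subst integral_density) (auto simp: set_lebesgue_integral_def mult_ac)
  finally show "measure (M \<Otimes>\<^sub>M ?N) ?E = (LINT y:{..c}|lborel. normal_density 0 \<sigma> y * (1 - below q y))" .
qed

text \<open>Adding an independent \<open>N(0, \<theta> h)\<close> endpoint turns the bridge into a Brownian motion, to which the
  reflection principle applies.\<close>

lemma below_eq:
  assumes q: "0 \<le> q"
  shows "AE y in lborel. y \<le> q \<longrightarrow> below q y = 1 - exp (- 2 * q * (q - y) / (\<theta> * h))"
proof -
  \<comment> \<open>With endpoint variance \<open>\<theta> * h\<close> the interpolated endpoint
    contributes \<open>\<theta> * s * t / h\<close> to the covariance, which cancels the correction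
    term of the bridge and leaves \<open>\<theta> * s\<close>.\<close>
  define \<sigma> where "\<sigma> = sqrt (\<theta> * h)"
  have \<sigma>: "0 < \<sigma>" "\<sigma>\<^sup>2 = \<theta> * h" using \<theta> h by (auto simp: \<sigma>_def)
  let ?N = "density lborel (normal_density 0 \<sigma>)" and ?n = "normal_density 0 \<sigma>"
  have axM: "gaussian_space M H" ..
  have axN: "gaussian_space ?N (range (\<lambda>c x. c * x))" by (rule gaussian_space_normal_line(1)[OF \<sigma>(1)])
  interpret N: gaussian_space ?N "range (\<lambda>c x. c * x)" by (rule axN)
  let ?H = "{\<lambda>p. Y (fst p) + Z (snd p) | Y Z. Y \<in> H \<and> Z \<in> range (\<lambda>c x. c * x)}"
  interpret P: gaussian_space "M \<Otimes>\<^sub>M ?N" ?H by (rule gaussian_space_pair(1)[OF axM axN])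
  define B where "B s p = bridge s (fst p) + s / h * snd p" for s p
  have line: "(\<lambda>x. a * x) \<in> range (\<lambda>c x. c * x :: real)" for a by auto
  have Bh: "B h p = snd p" for p using h by (simp add: B_def bridge_def)
  note mb[measurable] = pair_normal_section(2)[OF \<sigma>(1)]
  have below01: "0 \<le> below q y" "below q y \<le> 1" for y by (auto simp: below_def)
  have key: "(LINT y:{..c}|lborel. ?n y * (1 - below q y)) = (LINT y:{..c}|lborel. ?n (2 * q - y))" if c: "c \<le> q" for c
  proof -
    have "measure (M \<Otimes>\<^sub>M ?N) {p\<in>space (M \<Otimes>\<^sub>M ?N). B h p \<le> c \<and> (\<exists>s\<in>dyadics h. q < B s p)}
        = measure (M \<Otimes>\<^sub>M ?N) {p\<in>space (M \<Otimes>\<^sub>M ?N). 2 * q - c < B h p}"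
    proof (rule P.brownian_reflection[OF h _ _ _ q c, where \<theta>=\<theta>])
      show "B s \<in> ?H" if "s \<in> {0..h}" for s
        unfolding B_def[abs_def] using bridge_H[OF that] line[of "s / h"]
        by (intro CollectI exI[of _ "bridge s"] exI[of _ "\<lambda>x. s / h * x"]) auto
      show "(\<integral>p. B s p * B t p \<partial>(M \<Otimes>\<^sub>M ?N)) = \<theta> * s" if st: "0 \<le> s" "s \<le> t" "t \<le> h" for s t
      proof -
        have "(\<integral>p. B s p * B t p \<partial>(M \<Otimes>\<^sub>M ?N)) = expectation (\<lambda>\<omega>. bridge s \<omega> * bridge t \<omega>) + N.expectation (\<lambda>x. (s / h * x) * (t / h * x))"
          unfolding B_def using st by (intro gaussian_space_pair(2)[OF axM axN] bridge_H line) auto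
        also have "N.expectation (\<lambda>x. (s / h * x) * (t / h * x)) = (s / h * (t / h)) * N.expectation (\<lambda>x. x\<^sup>2)"
          by (subst Bochner_Integration.integral_mult_right_zero[symmetric]) (simp add: power2_eq_square mult_ac)
        also have "\<dots> = \<theta> * s * t / h"
          using gaussian_space_normal_line(2)[OF \<sigma>(1)] \<sigma>(2) h by (simp add: field_simps)
        finally show ?thesis using bridge_cov[OF st] by simp
      qed
      have "AE \<omega> in distr (M \<Otimes>\<^sub>M ?N) M fst. continuous_on {0..h} (\<lambda>s. R s \<omega>)"
        by (subst N.distr_pair_fst) (rule cont)
      then have "AE p in M \<Otimes>\<^sub>M ?N. continuous_on {0..h} (\<lambda>s. R s (fst p))"
        by (rule AE_distrD[rotated]) simp
      then show "AE p in M \<Otimes>\<^sub>M ?N. continuous_on {0..h} (\<lambda>s. B s p)"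
        by eventually_elim (use h in \<open>auto simp: B_def bridge_def intro!: continuous_intros\<close>)
    qed
    also have "\<dots> = measure (distr (M \<Otimes>\<^sub>M ?N) ?N snd) {2 * q - c<..}"
      by (subst measure_distr) (auto simp: Bh intro!: arg_cong[where f="measure _"])
    also have "distr (M \<Otimes>\<^sub>M ?N) ?N snd = ?N"
      by (intro distr_pair_snd prob_space_axioms N.prob_space_axioms)
    also have "measure ?N {2 * q - c<..} = (\<integral>x. indicator {2 * q - c<..} x \<partial>?N)" by simp
    also have "\<dots> = (\<integral>x. ?n x * indicator {2 * q - c<..} x \<partial>lborel)"
      by (subst integral_density) auto
    also have "\<dots> = (\<integral>x. ?n (2 * q + (-1) * x) * indicator {2 * q - c<..} (2 * q + (-1) * x) \<partial>lborel)"
      by (subst lborel_integral_real_affine[where c="-1" and t="2 * q"]) auto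
    \<comment> \<open>The mirror map sends the open half-line above \<open>2 * q - c\<close> to the
      one below \<open>c\<close>; the missing point \<open>c\<close> is null.\<close>
    also have "\<dots> = (LINT y:{..c}|lborel. ?n (2 * q - y))"
      unfolding set_lebesgue_integral_def using AE_lborel_singleton[of c]
      by (intro integral_cong_AE) (auto elim!: eventually_mono simp: indicator_def)
    finally have "measure (M \<Otimes>\<^sub>M ?N) {p\<in>space (M \<Otimes>\<^sub>M ?N). B h p \<le> c \<and> (\<exists>s\<in>dyadics h. q < B s p)}
        = (LINT y:{..c}|lborel. ?n (2 * q - y))" .
    then show ?thesis
      unfolding Bh unfolding B_def pair_normal_section(1)[OF \<sigma>(1)] .
  qed
  have int1: "integrable lborel (\<lambda>y. indicator {..q} y * (?n y * (1 - below q y)))"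
    by (rule Bochner_Integration.integrable_bound[OF integrable_normal_density[OF \<sigma>(1), of 0]])
       (use below01 in \<open>auto simp: indicator_def abs_mult intro!: AE_I2 mult_left_le\<close>)
  have int2: "integrable lborel (\<lambda>y. indicator {..q} y * ?n (2 * q - y))"
    using integrable_mult_indicator[of "{..q}" lborel, OF _ lborel_integrable_real_affine[OF integrable_normal_density[OF \<sigma>(1), of 0], of "-1" "2 * q"]]
    by simp
  \<comment> \<open>\<open>key\<close> is available for \<open>c \<le> q\<close> only. Truncating
    both densities at \<open>q\<close> replaces \<open>c\<close> by \<open>min c q\<close> and makes
    the identity hold for all \<open>c\<close>.\<close>
  have "AE y in lborel. indicator {..q} y * (?n y * (1 - below q y)) = indicator {..q} y * ?n (2 * q - y)"
  proof (rule AE_eq_of_integrals_atMost[OF int1 _ int2])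
    fix c
    have *: "(LINT y:{..c}|lborel. indicator {..q} y * k y) = (LINT y:{..min c q}|lborel. k y)" for k :: "real \<Rightarrow> real"
      unfolding set_lebesgue_integral_def by (intro Bochner_Integration.integral_cong) (auto simp: indicator_def)
    show "(LINT y:{..c}|lborel. indicator {..q} y * (?n y * (1 - below q y))) = (LINT y:{..c}|lborel. indicator {..q} y * ?n (2 * q - y))"
      unfolding * by (rule key) simp
  qed (use below01 in auto)
  then show ?thesis
  proof eventually_elim
    case (elim y)
    show ?case
    proof
      assume "y \<le> q"
      then have "?n y * (1 - below q y) = exp (- 2 * q * (q - y) / (\<theta> * h)) * ?n y"
        using elim normal_density_reflect_ratio[of "\<theta> * h" q y] \<theta> h by (simp add: \<sigma>_def)
      moreover have "0 < ?n y" using \<sigma>(1) by (rule normal_density_pos)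
      ultimately show "below q y = 1 - exp (- 2 * q * (q - y) / (\<theta> * h))" by (simp add: mult.commute)
    qed
  qed
qed

text \<open>Since \<open>R s + \<rho> * s\<close> equals
  \<open>bridge s + s / h * (R h + \<rho> * h)\<close>, the event is a condition on the bridge and
  on the drifted endpoint alone. These are independent, so the probability is an integral of
  \<open>below q y\<close> over endpoints \<open>y \<le> c\<close>, and \<open>c \<le> q\<close>
  keeps \<open>y\<close> in the range where \<open>below\<close> is known.\<close>

theorem prob_stays_below:
  assumes q: "0 \<le> q" and c: "c \<le> q"
  shows "prob {\<omega>\<in>space M. R h \<omega> + \<rho> * h \<le> c \<and> (\<forall>s\<in>dyadics h. R s \<omega> + \<rho> * s \<le> q)}
    = (LINT y:{..c}|lborel. (1 - exp (- 2 * q * (q - y) / (\<theta> * h))) * normal_density (\<rho> * h) (sqrt (h * (\<theta> - \<tau> * h))) y)"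
proof -
  define \<sigma> where "\<sigma> = sqrt (h * (\<theta> - \<tau> * h))"
  have \<sigma>: "0 < \<sigma>" using h pos by (simp add: \<sigma>_def)
  have D: "countable (dyadics h)" "dyadics h \<subseteq> {0..h}" using countable_dyadics dyadics_subset[of h] h by auto
  \<comment> \<open>The endpoint is presented as a family over the one-point type
    \<open>unit\<close>, the form in which \<open>uncorrelated_imp_indep\<close> expects its second
    argument.\<close>
  let ?A = "\<Pi>\<^sub>M s\<in>dyadics h. borel :: real measure" and ?B = "\<Pi>\<^sub>M (i::unit)\<in>UNIV. borel :: real measure"
  let ?X = "\<lambda>\<omega>. \<lambda>s\<in>dyadics h. bridge s \<omega>" and ?Y = "\<lambda>\<omega>. \<lambda>(i::unit)\<in>UNIV. R h \<omega>"
  have indep: "distr M (?A \<Otimes>\<^sub>M ?B) (\<lambda>\<omega>. (?X \<omega>, ?Y \<omega>)) = distr M ?A ?X \<Otimes>\<^sub>M distr M ?B ?Y"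
    using D(2) bridge_H Rh bridge_uncorrelated by (intro uncorrelated_imp_indep) auto
  have [measurable]: "R h \<in> borel_measurable M" using Rh measurable_H by auto
  have mX[measurable]: "?X \<in> measurable M ?A" and mY[measurable]: "?Y \<in> measurable M ?B"
    by (auto intro!: measurable_restrict)
  note mb[measurable] = pair_normal_section(2)[OF \<sigma>]
  define E where "E = {p\<in>space (?A \<Otimes>\<^sub>M ?B). snd p () + \<rho> * h \<le> c \<and> (\<forall>s\<in>dyadics h. fst p s + s / h * (snd p () + \<rho> * h) \<le> q)}"
  have [measurable]: "(\<lambda>p. snd p ()) \<in> borel_measurable (?A \<Otimes>\<^sub>M ?B)"
    using measurable_compose[OF measurable_snd measurable_component_singleton[of "()" UNIV]] by simp
  have E: "E \<in> sets (?A \<Otimes>\<^sub>M ?B)"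
  proof -
    have [measurable]: "Measurable.pred (?A \<Otimes>\<^sub>M ?B) (\<lambda>p. \<forall>s\<in>dyadics h. fst p s + s / h * (snd p () + \<rho> * h) \<le> q)"
    proof (rule pred_Ball_countable[OF D(1)])
      fix s assume "s \<in> dyadics h"
      then have [measurable]: "(\<lambda>p. fst p s) \<in> borel_measurable (?A \<Otimes>\<^sub>M ?B)"
        using measurable_compose[OF measurable_fst measurable_component_singleton[of s]] by simp
      show "Measurable.pred (?A \<Otimes>\<^sub>M ?B) (\<lambda>p. fst p s + s / h * (snd p () + \<rho> * h) \<le> q)" by measurable
    qed
    show ?thesis unfolding E_def by measurable
  qed
  have ev: "{\<omega>\<in>space M. R h \<omega> + \<rho> * h \<le> c \<and> (\<forall>s\<in>dyadics h. R s \<omega> + \<rho> * s \<le> q)} = (\<lambda>\<omega>. (?X \<omega>, ?Y \<omega>)) -` E \<inter> space M"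
  proof -
    have "bridge s \<omega> + s / h * (R h \<omega> + \<rho> * h) = R s \<omega> + \<rho> * s" for s \<omega>
      using h by (simp add: bridge_def distrib_left)
    then show ?thesis by (auto simp: E_def space_pair_measure space_PiM)
  qed
  have "prob {\<omega>\<in>space M. R h \<omega> + \<rho> * h \<le> c \<and> (\<forall>s\<in>dyadics h. R s \<omega> + \<rho> * s \<le> q)} = measure (distr M (?A \<Otimes>\<^sub>M ?B) (\<lambda>\<omega>. (?X \<omega>, ?Y \<omega>))) E"
    unfolding ev using E by (subst measure_distr) auto
  also have "\<dots> = (\<integral>r. measure (distr M ?A ?X) ((\<lambda>b. (b, r)) -` E) \<partial>distr M ?B ?Y)"
    unfolding indep using E
    by (intro measure_pair_section(1) prob_space_distr mX mY) (simp cong: sets_pair_measure_cong)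
  also have "\<dots> = (\<integral>r. indicator {..c} (r () + \<rho> * h) * below q (r () + \<rho> * h) \<partial>distr M ?B ?Y)"
  proof (intro Bochner_Integration.integral_cong refl)
    fix r
    let ?S = "{b\<in>space ?A. \<forall>s\<in>dyadics h. b s + s / h * (r () + \<rho> * h) \<le> q}"
    have S: "?S \<in> sets ?A"
      unfolding pred_def[symmetric] by (intro pred_Ball_countable[OF D(1)]) measurable
    have "(\<lambda>b. (b, r)) -` E = (if r () + \<rho> * h \<le> c then ?S else {})"
      by (auto simp: E_def space_pair_measure space_PiM PiE_def extensional_def)
    moreover have "measure (distr M ?A ?X) ?S = below q (r () + \<rho> * h)"
      unfolding below_def using S
      by (subst measure_distr[OF mX]) (auto simp: space_PiM intro!: arg_cong[where f=prob])
    ultimately show "measure (distr M ?A ?X) ((\<lambda>b. (b, r)) -` E) = indicator {..c} (r () + \<rho> * h) * below q (r () + \<rho> * h)"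
      by auto
  qed
  also have "\<dots> = (\<integral>\<omega>. indicator {..c} (R h \<omega> + \<rho> * h) * below q (R h \<omega> + \<rho> * h) \<partial>M)"
    by (subst integral_distr[OF mY]) auto
  also have "\<dots> = (\<integral>x. indicator {..c} (x + \<rho> * h) * below q (x + \<rho> * h) \<partial>distr M borel (R h))"
    by (subst integral_distr) auto
  also have "distr M borel (R h) = density lborel (normal_density 0 \<sigma>)"
    unfolding \<sigma>_def using h pos cov[of h h] by (intro distr_normal Rh) auto
  also have "(\<integral>x. indicator {..c} (x + \<rho> * h) * below q (x + \<rho> * h) \<partial>density lborel (normal_density 0 \<sigma>))
      = (\<integral>x. normal_density 0 \<sigma> x * (indicator {..c} (x + \<rho> * h) * below q (x + \<rho> * h)) \<partial>lborel)"
    by (subst integral_density) auto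
  \<comment> \<open>The translation to the drifted endpoint moves \<open>\<rho> * h\<close> into the
    mean of the normal density.\<close>
  also have "\<dots> = (\<integral>y. normal_density 0 \<sigma> (- \<rho> * h + 1 * y) * (indicator {..c} (- \<rho> * h + 1 * y + \<rho> * h) * below q (- \<rho> * h + 1 * y + \<rho> * h)) \<partial>lborel)"
    by (subst lborel_integral_real_affine[where c=1 and t="- \<rho> * h"]) auto
  also have "\<dots> = (\<integral>y. normal_density (\<rho> * h) \<sigma> y * (indicator {..c} y * below q y) \<partial>lborel)"
    by (simp add: normal_density_def algebra_simps)
  also have "\<dots> = (LINT y:{..c}|lborel. (1 - exp (- 2 * q * (q - y) / (\<theta> * h))) * normal_density (\<rho> * h) \<sigma> y)"
    unfolding set_lebesgue_integral_def
  proof (intro integral_cong_AE)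
    show "AE y in lborel. normal_density (\<rho> * h) \<sigma> y * (indicator {..c} y * below q y) =
        indicator {..c} y *\<^sub>R ((1 - exp (- 2 * q * (q - y) / (\<theta> * h))) * normal_density (\<rho> * h) \<sigma> y)"
      using below_eq[OF q] by eventually_elim (use c in \<open>auto simp: indicator_def mult.commute\<close>)
  qed auto
  finally show ?thesis unfolding \<sigma>_def .
qed

end

section \<open>Normal integrals expressed by the error function\<close>

lemma has_derivative_erf: "(erf has_real_derivative 2 / sqrt pi * exp (- (z\<^sup>2))) (at z)"
proof -
  define a b where "a = min 0 z - 1" and "b = max 0 z + 1"
  have ab: "a < 0" "0 < b" "a < z" "z < b" by (auto simp: a_def b_def)
  define F where "F = (\<lambda>u. LBINT t=ereal 0..ereal u. exp (- (t\<^sup>2)))"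
  have "(F has_vector_derivative exp (- (z\<^sup>2))) (at z within {a..b})"
    unfolding F_def using ab by (intro interval_integral_FTC2 continuous_intros) auto
  moreover have "at z within {a..b} = at z" using ab by (intro at_within_interior) auto
  ultimately have "(F has_real_derivative exp (- (z\<^sup>2))) (at z)"
    by (simp add: has_real_derivative_iff_has_vector_derivative)
  then have "((\<lambda>u. 2 / sqrt pi * F u) has_real_derivative 2 / sqrt pi * exp (- (z\<^sup>2))) (at z)"
    by (rule DERIV_cmult)
  then show ?thesis unfolding F_def erf_def[abs_def] .
qed

lemma erf_minus: "erf (- z) = - erf z"
proof -
  have "((\<lambda>z. erf (- z) + erf z) has_real_derivative 0) (at z)" for z
  proof -
    have "((\<lambda>z. erf (- z)) has_real_derivative (2 / sqrt pi * exp (- ((- z)\<^sup>2))) * (- 1)) (at z)"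
      by (rule DERIV_chain2[OF has_derivative_erf]) (auto intro!: derivative_eq_intros)
    then have "((\<lambda>z. erf (- z) + erf z) has_real_derivative
      (2 / sqrt pi * exp (- ((- z)\<^sup>2))) * (- 1) + 2 / sqrt pi * exp (- (z\<^sup>2))) (at z)"
      by (intro DERIV_add has_derivative_erf)
    then show ?thesis by simp
  qed
  then have "erf (- z) + erf z = erf (- 0) + erf 0" by (intro DERIV_const_ratio_const2[of _ 0] DERIV_isconst_all) auto
  then show ?thesis by (simp add: erf_def)
qed

text \<open>\<open>\<Phi>\<close> is a primitive of the density, so it differs from the distribution
  function by a constant \<open>c\<close>. As \<open>\<Phi>\<close> is odd about
  \<open>\<mu>\<close>, the values of the distribution function at \<open>\<mu> + r\<close> and
  \<open>\<mu> - r\<close> add up to \<open>2 * c\<close>; letting \<open>r\<close> grow shows that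
  this sum is 1.\<close>

lemma measure_normal_atMost:
  assumes \<sigma>: "0 < \<sigma>"
  shows "measure (density lborel (normal_density \<mu> \<sigma>)) {..a} = (1 - erf ((\<mu> - a) / (\<sigma> * sqrt 2))) / 2"
proof -
  let ?N = "density lborel (normal_density \<mu> \<sigma>)"
  interpret N: prob_space ?N by (rule prob_space_normal_density[OF \<sigma>])
  interpret R: real_distribution ?N
    by standard auto
  define \<Phi> where "\<Phi> = (\<lambda>x. erf ((x - \<mu>) / (\<sigma> * sqrt 2)) / 2)"
  have d\<Phi>: "(\<Phi> has_real_derivative normal_density \<mu> \<sigma> x) (at x)" for x
  proof -
    have "((\<lambda>x. erf ((x - \<mu>) / (\<sigma> * sqrt 2))) has_real_derivative
        (2 / sqrt pi * exp (- (((x - \<mu>) / (\<sigma> * sqrt 2))\<^sup>2))) * (1 / (\<sigma> * sqrt 2))) (at x)"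
      using \<sigma> by (intro DERIV_chain2[OF has_derivative_erf]) (auto intro!: derivative_eq_intros)
    then have "(\<Phi> has_real_derivative
        ((2 / sqrt pi * exp (- (((x - \<mu>) / (\<sigma> * sqrt 2))\<^sup>2))) * (1 / (\<sigma> * sqrt 2))) / 2) (at x)"
      unfolding \<Phi>_def by (rule DERIV_cdivide)
    moreover have "((2 / sqrt pi * exp (- (((x - \<mu>) / (\<sigma> * sqrt 2))\<^sup>2))) * (1 / (\<sigma> * sqrt 2))) / 2 = normal_density \<mu> \<sigma> x"
      using \<sigma> by (simp add: normal_density_def power_divide power_mult_distrib real_sqrt_mult field_simps)
    ultimately show ?thesis by simp
  qed
  have incr: "cdf ?N b - cdf ?N a = \<Phi> b - \<Phi> a" if "a < b" for a b
  proof -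
    have "emeasure ?N {a<..b} = (\<integral>\<^sup>+x. ennreal (normal_density \<mu> \<sigma> x) * indicator {a<..b} x \<partial>lborel)"
      by (subst emeasure_density) auto
    also have "\<dots> = (\<integral>\<^sup>+x. ennreal (normal_density \<mu> \<sigma> x) * indicator {a..b} x \<partial>lborel)"
      using AE_lborel_singleton[of a] by (intro nn_integral_cong_AE) (auto elim!: eventually_mono simp: indicator_def)
    also have "\<dots> = \<Phi> b - \<Phi> a"
      using that by (intro nn_integral_FTC_Icc d\<Phi>) auto
    finally have e: "ennreal (measure ?N {a<..b}) = ennreal (\<Phi> b - \<Phi> a)"
      by (simp add: N.emeasure_eq_measure)
    have "\<Phi> a \<le> \<Phi> b"
    proof (rule DERIV_nonneg_imp_nondecreasing[where f=\<Phi>])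
      fix x
      show "\<exists>y. (\<Phi> has_real_derivative y) (at x) \<and> 0 \<le> y"
        using d\<Phi>[of x] normal_density_nonneg[of \<mu> \<sigma> x] by blast
    qed (use that in simp)
    then have "measure ?N {a<..b} = \<Phi> b - \<Phi> a" using e by (simp add: ennreal_inj)
    then show ?thesis using R.cdf_diff_eq[OF that] by simp
  qed
  define c where "c = cdf ?N \<mu> - \<Phi> \<mu>"
  have c: "cdf ?N x = \<Phi> x + c" for x
    using incr[of x \<mu>] incr[of \<mu> x] by (cases x \<mu> rule: linorder_cases) (auto simp: c_def)
  have odd: "\<Phi> (\<mu> - r) = - \<Phi> (\<mu> + r)" for r
    using erf_minus[of "r / (\<sigma> * sqrt 2)"] by (simp add: \<Phi>_def)
  have "((\<lambda>r. cdf ?N (\<mu> + r) + cdf ?N (\<mu> - r)) \<longlongrightarrow> 1 + 0) at_top"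
    by (intro tendsto_add filterlim_compose[OF R.cdf_lim_at_top_prob] filterlim_compose[OF R.cdf_lim_at_bot]; real_asymp)
  moreover have "(\<lambda>r. cdf ?N (\<mu> + r) + cdf ?N (\<mu> - r)) = (\<lambda>_. 2 * c)"
    by (simp add: c odd)
  ultimately have "((\<lambda>_::real. 2 * c) \<longlongrightarrow> 1) at_top" by simp
  then have "2 * c = 1" by (simp add: tendsto_const_iff)
  moreover have "\<Phi> a = - erf ((\<mu> - a) / (\<sigma> * sqrt 2)) / 2"
  proof -
    have "(a - \<mu>) / (\<sigma> * sqrt 2) = - ((\<mu> - a) / (\<sigma> * sqrt 2))"
      by (metis minus_diff_eq minus_divide_left)
    then show ?thesis unfolding \<Phi>_def by (simp only: erf_minus)
  qed
  ultimately show ?thesis using c[of a] by (simp add: cdf_def)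
qed

text \<open>Completing the square: an exponential factor leaves a normal density normal, with the
  same variance and a shifted mean. This keeps the crossing term integrable in closed form.\<close>

lemma normal_density_tilt:
  assumes \<sigma>: "0 < \<sigma>"
  shows "exp (b * y) * normal_density \<mu> \<sigma> y = exp (b * \<mu> + b\<^sup>2 * \<sigma>\<^sup>2 / 2) * normal_density (\<mu> + b * \<sigma>\<^sup>2) \<sigma> y"
proof -
  have "b * y + - (y - \<mu>)\<^sup>2 / (2 * \<sigma>\<^sup>2) = (b * \<mu> + b\<^sup>2 * \<sigma>\<^sup>2 / 2) + - (y - (\<mu> + b * \<sigma>\<^sup>2))\<^sup>2 / (2 * \<sigma>\<^sup>2)"
    using \<sigma> by (simp add: field_simps power2_eq_square)
  then show ?thesis
    unfolding normal_density_def by (simp only: mult.left_commute[of "exp _"] exp_add[symmetric])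
qed

lemma set_integral_normal_density_atMost:
  assumes \<sigma>: "0 < \<sigma>"
  shows "(LINT y:{..a}|lborel. normal_density \<mu> \<sigma> y) = (1 - erf ((\<mu> - a) / (\<sigma> * sqrt 2))) / 2"
    and "set_integrable lborel {..a} (normal_density \<mu> \<sigma>)"
proof -
  interpret N: prob_space "density lborel (normal_density \<mu> \<sigma>)" by (rule prob_space_normal_density[OF \<sigma>])
  have "measure (density lborel (normal_density \<mu> \<sigma>)) {..a} = (\<integral>y. indicator {..a} y \<partial>density lborel (normal_density \<mu> \<sigma>))"
    by simp
  also have "\<dots> = (LINT y:{..a}|lborel. normal_density \<mu> \<sigma> y)"
    by (subst integral_density) (auto simp: set_lebesgue_integral_def mult.commute)
  finally show "(LINT y:{..a}|lborel. normal_density \<mu> \<sigma> y) = (1 - erf ((\<mu> - a) / (\<sigma> * sqrt 2))) / 2"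
    using measure_normal_atMost[OF \<sigma>] by simp
  show "set_integrable lborel {..a} (normal_density \<mu> \<sigma>)"
    unfolding set_integrable_def using \<sigma> by (intro integrable_mult_indicator) auto
qed

text \<open>The crossing probability is exponential in the endpoint with rate
  \<open>b = 2 * q / (\<Theta> * h)\<close>. Tilting turns its product with the endpoint density
  into a normal density of total mass \<open>E\<close>, so the integral is a difference of two
  normal tails. In the exponent of \<open>E\<close> the terms in \<open>1 / h\<close> cancel, which
  is why \<open>E\<close> is free of \<open>h\<close>.\<close>

lemma bridge_crossing_integral:
  fixes \<Theta> \<tau> \<rho> h q v :: real
  assumes \<Theta>: "0 < \<Theta>" and h: "0 < h" and pos: "0 < \<Theta> - \<tau> * h"
  defines "E \<equiv> exp (- 2 * q * (\<tau> * q - \<Theta> * \<rho>) / \<Theta>\<^sup>2)" and "D \<equiv> sqrt (2 * h * (\<Theta> - \<tau> * h))"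
  shows "(LINT y:{..q - v}|lborel. (1 - exp (- 2 * q * (q - y) / (\<Theta> * h))) *
      normal_density (\<rho> * h) (sqrt (h * (\<Theta> - \<tau> * h))) y)
    = 1 / 2 * (1 - E - erf ((- q + v + \<rho> * h) / D)
        + E * erf ((\<Theta> * (q + v) - (2 * \<tau> * q - \<Theta> * \<rho>) * h) / (\<Theta> * D)))"
proof -
  define \<sigma> where "\<sigma> = sqrt (h * (\<Theta> - \<tau> * h))"
  have \<sigma>: "0 < \<sigma>" using h pos by (simp add: \<sigma>_def)
  have \<sigma>2: "\<sigma>\<^sup>2 = h * (\<Theta> - \<tau> * h)" using h pos by (simp add: \<sigma>_def)
  have D: "\<sigma> * sqrt 2 = D" by (simp add: \<sigma>_def D_def real_sqrt_mult)
  define b where "b = 2 * q / (\<Theta> * h)"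
  define \<mu> where "\<mu> = \<rho> * h"
  have split: "(1 - exp (- 2 * q * (q - y) / (\<Theta> * h))) * normal_density \<mu> \<sigma> y =
      normal_density \<mu> \<sigma> y - E * normal_density (\<mu> + b * \<sigma>\<^sup>2) \<sigma> y" for y
  proof -
    have "exp (- 2 * q * (q - y) / (\<Theta> * h)) = exp (- b * q) * exp (b * y)"
      using \<Theta> h by (simp add: b_def exp_add[symmetric] field_simps)
    then have "exp (- 2 * q * (q - y) / (\<Theta> * h)) * normal_density \<mu> \<sigma> y
        = (exp (- b * q) * exp (b * \<mu> + b\<^sup>2 * \<sigma>\<^sup>2 / 2)) * normal_density (\<mu> + b * \<sigma>\<^sup>2) \<sigma> y"
      by (simp add: normal_density_tilt[OF \<sigma>] mult.assoc)
    also have "exp (- b * q) * exp (b * \<mu> + b\<^sup>2 * \<sigma>\<^sup>2 / 2) = E"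
      unfolding exp_add[symmetric] E_def \<sigma>2 b_def \<mu>_def using \<Theta> h
      by (simp add: field_simps power2_eq_square)
    finally show ?thesis by (simp add: left_diff_distrib)
  qed
  have "(LINT y:{..q - v}|lborel. (1 - exp (- 2 * q * (q - y) / (\<Theta> * h))) * normal_density \<mu> \<sigma> y)
      = (1 - erf ((\<mu> - (q - v)) / D)) / 2 - E * ((1 - erf ((\<mu> + b * \<sigma>\<^sup>2 - (q - v)) / D)) / 2)"
    unfolding split using set_integral_normal_density_atMost(2)[OF \<sigma>]
    by (subst set_integral_diff)
       (auto simp only: set_integral_mult_right set_integral_normal_density_atMost(1)[OF \<sigma>] D intro: set_integrable_mult_right)
  also have "(\<mu> - (q - v)) / D = (- q + v + \<rho> * h) / D" by (simp add: \<mu>_def)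
  also have "(\<mu> + b * \<sigma>\<^sup>2 - (q - v)) / D = (\<Theta> * (q + v) - (2 * \<tau> * q - \<Theta> * \<rho>) * h) / (\<Theta> * D)"
  proof -
    have "\<mu> + b * \<sigma>\<^sup>2 - (q - v) = (\<Theta> * (q + v) - (2 * \<tau> * q - \<Theta> * \<rho>) * h) / \<Theta>"
      unfolding \<sigma>2 b_def \<mu>_def using \<Theta> h by (simp add: field_simps)
    then show ?thesis by simp
  qed
  finally show ?thesis unfolding \<mu>_def \<sigma>_def by (simp add: field_simps)
qed

section \<open>Queue length paths\<close>

lemma time_set_interval: "t \<in> time_set \<Delta> \<Longrightarrow> 0 \<le> s \<Longrightarrow> s \<le> t \<Longrightarrow> s \<in> time_set \<Delta>"
  unfolding time_set_def by (auto intro: order_le_less_trans[of "ereal s" "ereal t"])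

text \<open>The upper bound is attained at the last zero of the queue before \<open>t\<close>, if there is one.\<close>

lemma queue_length_le_iff:
  assumes Q: "queue_length_path \<Delta> z l q" and z: "continuous_on (time_set \<Delta>) z"
    and u: "0 \<le> u" "u \<le> t" and t: "t \<in> time_set \<Delta>"
  shows "q t \<le> c \<longleftrightarrow> q u + z t - z u \<le> c \<and> (\<forall>s\<in>{u..t}. z t - z s \<le> c)"
proof -
  have T: "{u..t} \<subseteq> time_set \<Delta>" using time_set_interval[OF t] u by auto
  note Q' = Q[unfolded queue_length_path_def]
  have Q1: "\<forall>t\<in>time_set \<Delta>. q t = q 0 + z t + l t" and Q2: "\<forall>t\<in>time_set \<Delta>. 0 \<le> q t"
    and Q3: "continuous_on (time_set \<Delta>) l" and Q4: "mono_on (time_set \<Delta>) l"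
    and Q5: "\<forall>s\<in>time_set \<Delta>. \<forall>t\<in>time_set \<Delta>. s \<le> t \<and> (\<forall>r\<in>{s..t}. 0 < q r) \<longrightarrow> l s = l t"
    using Q' by blast+
  have q: "q r = q 0 + z r + l r" if "r \<in> {u..t}" for r using Q1 T that by blast
  have q0: "0 \<le> q r" if "r \<in> {u..t}" for r using Q2 T that by blast
  have mono: "l r \<le> l s" if "r \<in> {u..t}" "s \<in> {u..t}" "r \<le> s" for r s
    using mono_onD[OF Q4, of r s] T that by blast
  have const: "l r = l s" if "r \<in> {u..t}" "s \<in> {u..t}" "r \<le> s" "\<forall>x\<in>{r..s}. 0 < q x" for r s
    using Q5 T that by blast
  have cl: "continuous_on {u..t} l" and cz: "continuous_on {u..t} z"
    using continuous_on_subset[OF Q3 T] continuous_on_subset[OF z T] by auto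
  have "continuous_on {u..t} (\<lambda>r. q 0 + z r + l r)" by (intro continuous_intros cl cz)
  then have cq: "continuous_on {u..t} q" by (rule continuous_on_eq) (metis q)
  have lower: "z t - z s \<le> q t" if "s \<in> {u..t}" for s
    using q[OF that] q[of t] q0[OF that] mono[OF that, of t] u that by auto
  have lower': "q u + z t - z u \<le> q t" using q[of u] q[of t] mono[of u t] u by auto
  have "q t = q u + z t - z u \<or> (\<exists>s\<in>{u..t}. q t = z t - z s)"
  proof (cases "\<exists>s\<in>{u..t}. q s = 0")
    case False
    then have "\<forall>x\<in>{u..t}. 0 < q x" using q0 by force
    then have "l u = l t" using const[of u t] u by auto
    then show ?thesis using q[of u] q[of t] u by auto
  next
    case True
    define S where "S = {s\<in>{u..t}. q s = 0}"
    have "closed S" unfolding S_def by (rule continuous_closed_preimage_constant[OF cq]) simp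
    moreover have "bounded S" by (rule bounded_subset[of "{u..t}"]) (auto simp: S_def)
    ultimately have "compact S" by (simp add: compact_eq_bounded_closed)
    moreover have "S \<noteq> {}" using True by (auto simp: S_def)
    ultimately obtain s where s: "s \<in> S" "\<And>r. r \<in> S \<Longrightarrow> r \<le> s"
      using compact_attains_sup[of S] by blast
    have su: "s \<in> {u..t}" "q s = 0" using s by (auto simp: S_def)
    have "l s = l t"
    proof (cases "s = t")
      case False
      then have st: "s < t" using su by simp
      \<comment> \<open>Constancy of \<open>l\<close> is granted only on intervals where the queue
        is positive, and \<open>q s = 0\<close>. It is therefore obtained on \<open>{s<..t}\<close>
        first and extended to \<open>s\<close> by continuity of \<open>l\<close>.\<close>
      have lt: "l r = l t" if "r \<in> {s<..t}" for r
      proof -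
        have "0 < q x" if "x \<in> {r..t}" for x
        proof -
          have "x \<in> {u..t}" "s < x" using that \<open>r \<in> {s<..t}\<close> su by auto
          then show ?thesis using s(2)[of x] q0[of x] by (force simp: S_def)
        qed
        then show ?thesis using const[of r t] that su by auto
      qed
      have "((\<lambda>r. l r) \<longlongrightarrow> l s) (at s within {u..t})"
        using cl su by (simp add: continuous_on)
      then have "(l \<longlongrightarrow> l s) (at s within {s<..t})"
        by (rule tendsto_within_subset) (use su in auto)
      moreover have "(l \<longlongrightarrow> l t) (at s within {s<..t})"
        by (intro tendsto_eventually, unfold eventually_at_filter, intro always_eventually allI impI lt)
      moreover have "at s within {s<..t} \<noteq> bot"
        using st by (simp add: at_within_eq_bot_iff closure_greaterThanAtMost)
      ultimately show ?thesis using tendsto_unique by blast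
    qed simp
    then have "q t = z t - z s" using q[of s] q[of t] su u by auto
    then show ?thesis using su by auto
  qed
  then show ?thesis
  proof (intro iffI conjI ballI)
    fix s assume "q t \<le> c" "s \<in> {u..t}"
    then show "z t - z s \<le> c" using lower[of s] by linarith
  qed (use lower' in \<open>auto split: if_splits\<close>)
qed

text \<open>The supremum is taken in \<open>ereal\<close> so that measurability needs no boundedness; the value is
  meaningless when \<open>g\<close> is unbounded above on \<open>D\<close>.\<close>

definition reflected :: "real set \<Rightarrow> real \<Rightarrow> (real \<Rightarrow> real) \<Rightarrow> real" where
  "reflected D a g = real_of_ereal (max (ereal a) (SUP s\<in>D. ereal (g s)))"

lemma reflected_le_iff:
  assumes b: "\<And>s. s \<in> D \<Longrightarrow> g s \<le> B"
  shows "reflected D a g \<le> c \<longleftrightarrow> a \<le> c \<and> (\<forall>s\<in>D. g s \<le> c)"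
proof -
  let ?m = "max (ereal a) (SUP s\<in>D. ereal (g s))"
  define C where "C = max a B"
  have "a \<le> C" "g s \<le> C" if "s \<in> D" for s using b[OF that] by (auto simp: C_def)
  moreover have "a \<le> C" by (simp add: C_def)
  ultimately have "?m \<le> ereal C" by (intro max.boundedI SUP_least ereal_less_eq(3)[THEN iffD2]) auto
  moreover have "ereal a \<le> ?m" by simp
  ultimately obtain r where r: "?m = ereal r" by (cases ?m) auto
  have "reflected D a g \<le> c \<longleftrightarrow> ?m \<le> ereal c" unfolding reflected_def r by simp
  also have "\<dots> \<longleftrightarrow> a \<le> c \<and> (\<forall>s\<in>D. g s \<le> c)" by (auto simp: SUP_le_iff)
  finally show ?thesis .
qed

lemma measurable_reflected[measurable (raw)]:
  assumes "countable D" "a \<in> borel_measurable M" "\<And>s. s \<in> D \<Longrightarrow> (\<lambda>x. g x s) \<in> borel_measurable M"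
  shows "(\<lambda>x. reflected D (a x) (g x)) \<in> borel_measurable M"
  unfolding reflected_def using assms
  by (intro borel_measurable_real_of_ereal borel_measurable_max borel_measurable_SUP borel_measurable_ereal)

text \<open>Two reals with the same upper bounds are equal, and continuity lets dyadic times replace
  all times, so the value depends on countably many coordinates of the input. The formula serves
  twice: on \<open>{u..u + h}\<close> for the queue being predicted, and on \<open>{0..u}\<close> to
  express \<open>Q u\<close> through \<open>Q 0\<close> and the input.\<close>

lemma queue_length_eq_reflected:
  assumes Q: "queue_length_path \<Delta> z l q" and z: "continuous_on (time_set \<Delta>) z"
    and u: "0 \<le> u" "0 \<le> h" and t: "u + h \<in> time_set \<Delta>"
  shows "q (u + h) = reflected (dyadics h) (q u + z (u + h) - z u) (\<lambda>s. z (u + h) - z (u + s))"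
proof -
  have "{u..u + h} \<subseteq> time_set \<Delta>" using time_set_interval[OF t] u by auto
  then have cz: "continuous_on {u..u + h} z" by (rule continuous_on_subset[OF z])
  have cg: "continuous_on {0..h} (\<lambda>s. z (u + h) - z (u + s))"
    by (intro continuous_intros continuous_on_compose2[OF cz]) auto
  have sub: "dyadics h \<subseteq> {0..h}" using dyadics_subset u by blast
  have "bdd_above ((\<lambda>s. z (u + h) - z (u + s)) ` {0..h})"
    by (intro bounded_imp_bdd_above compact_imp_bounded compact_continuous_image cg compact_Icc)
  then obtain B where B: "\<And>s. s \<in> {0..h} \<Longrightarrow> z (u + h) - z (u + s) \<le> B"
    unfolding bdd_above_def by blast
  have "q (u + h) \<le> c \<longleftrightarrow> reflected (dyadics h) (q u + z (u + h) - z u) (\<lambda>s. z (u + h) - z (u + s)) \<le> c" for c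
  proof -
    have "q (u + h) \<le> c \<longleftrightarrow> q u + z (u + h) - z u \<le> c \<and> (\<forall>s\<in>{u..u + h}. z (u + h) - z s \<le> c)"
      using u t by (intro queue_length_le_iff[OF Q z]) auto
    also have "(\<forall>s\<in>{u..u + h}. z (u + h) - z s \<le> c) \<longleftrightarrow> (\<forall>s\<in>{0..h}. z (u + h) - z (u + s) \<le> c)"
    proof safe
      fix s assume *: "\<forall>s\<in>{0..h}. z (u + h) - z (u + s) \<le> c" "s \<in> {u..u + h}"
      then show "z (u + h) - z s \<le> c" using *(1)[rule_format, of "s - u"] by auto
    qed auto
    also have "\<dots> \<longleftrightarrow> (\<forall>s\<in>dyadics h. z (u + h) - z (u + s) \<le> c)"
      using dyadics_dense[OF u(2) cg] sub by blast
    also have "q u + z (u + h) - z u \<le> c \<and> \<dots> \<longleftrightarrow> reflected (dyadics h) (q u + z (u + h) - z u) (\<lambda>s. z (u + h) - z (u + s)) \<le> c"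
      using B sub by (intro reflected_le_iff[symmetric, where B=B]) auto
    finally show ?thesis .
  qed
  then show ?thesis by (meson order_antisym order_refl)
qed

section \<open>Conditional distributions and independence\<close>

text \<open>Nested products carry a fixed grouping; this moves the independence of three components
  from the grouping in which it is derived to the one in which the first two form the conditioning
  information. Rectangles \<open>S \<times> V\<close> suffice, because the sections over them
  factor.\<close>

lemma distr_pair_assoc:
  assumes "prob_space A" "prob_space B" "prob_space C"
  shows "distr (A \<Otimes>\<^sub>M (B \<Otimes>\<^sub>M C)) ((A \<Otimes>\<^sub>M B) \<Otimes>\<^sub>M C) (\<lambda>p. ((fst p, fst (snd p)), snd (snd p))) = (A \<Otimes>\<^sub>M B) \<Otimes>\<^sub>M C"
proof -
  interpret A: prob_space A by fact
  interpret B: prob_space B by fact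
  interpret C: prob_space C by fact
  interpret AB: pair_prob_space A B ..
  interpret BC: pair_prob_space B C ..
  show ?thesis
  proof (rule pair_measure_eqI[symmetric])
    fix S V assume S: "S \<in> sets (A \<Otimes>\<^sub>M B)" and V: "V \<in> sets C"
    let ?f = "\<lambda>p. ((fst p, fst (snd p)), snd (snd p))"
    let ?E = "?f -` (S \<times> V) \<inter> space (A \<Otimes>\<^sub>M (B \<Otimes>\<^sub>M C))"
    have f: "?f \<in> measurable (A \<Otimes>\<^sub>M (B \<Otimes>\<^sub>M C)) ((A \<Otimes>\<^sub>M B) \<Otimes>\<^sub>M C)" by measurable
    have E: "?E \<in> sets (A \<Otimes>\<^sub>M (B \<Otimes>\<^sub>M C))" by (rule measurable_sets[OF f]) (use S V in auto)
    have "emeasure (distr (A \<Otimes>\<^sub>M (B \<Otimes>\<^sub>M C)) ((A \<Otimes>\<^sub>M B) \<Otimes>\<^sub>M C) ?f) (S \<times> V) = emeasure (A \<Otimes>\<^sub>M (B \<Otimes>\<^sub>M C)) ?E"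
      by (rule emeasure_distr[OF f]) (use S V in auto)
    also have "\<dots> = (\<integral>\<^sup>+a. emeasure (B \<Otimes>\<^sub>M C) (Pair a -` ?E) \<partial>A)"
      by (rule BC.emeasure_pair_measure_alt[OF E])
    also have "\<dots> = (\<integral>\<^sup>+a. emeasure B (Pair a -` S) * emeasure C V \<partial>A)"
    proof (rule nn_integral_cong)
      fix a assume a: "a \<in> space A"
      have "Pair a -` ?E = (Pair a -` S) \<times> V"
        using a sets.sets_into_space[OF S] sets.sets_into_space[OF V] by (auto simp: space_pair_measure)
      then show "emeasure (B \<Otimes>\<^sub>M C) (Pair a -` ?E) = emeasure B (Pair a -` S) * emeasure C V"
        using S V by (simp add: C.emeasure_pair_measure_Times sets_Pair1)
    qed
    also have "\<dots> = emeasure (A \<Otimes>\<^sub>M B) S * emeasure C V"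
      using S by (subst nn_integral_multc) (auto simp: B.emeasure_pair_measure_alt B.measurable_emeasure_Pair)
    finally show "emeasure (A \<Otimes>\<^sub>M B) S * emeasure C V = emeasure (distr (A \<Otimes>\<^sub>M (B \<Otimes>\<^sub>M C)) ((A \<Otimes>\<^sub>M B) \<Otimes>\<^sub>M C) ?f) (S \<times> V)" ..
  qed (auto simp: AB.sigma_finite_measure_axioms C.sigma_finite_measure_axioms)
qed

lemma (in prob_space) distr_pair_of_indep_set:
  assumes X[measurable]: "X \<in> measurable M A" and Y[measurable]: "Y \<in> measurable M B"
    and ind: "indep_set (sets (vimage_algebra (space M) X A)) (sets (vimage_algebra (space M) Y B))"
  shows "distr M (A \<Otimes>\<^sub>M B) (\<lambda>\<omega>. (X \<omega>, Y \<omega>)) = distr M A X \<Otimes>\<^sub>M distr M B Y"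
proof (rule pair_measure_eqI[symmetric])
  fix S V assume "S \<in> sets (distr M A X)" "V \<in> sets (distr M B Y)"
  then have SV[measurable]: "S \<in> sets A" "V \<in> sets B" by auto
  have "prob ((X -` S \<inter> space M) \<inter> (Y -` V \<inter> space M)) = prob (X -` S \<inter> space M) * prob (Y -` V \<inter> space M)"
    using SV by (intro indep_setD[OF ind] in_vimage_algebra) auto
  moreover have "(X -` S \<inter> space M) \<inter> (Y -` V \<inter> space M) = (\<lambda>\<omega>. (X \<omega>, Y \<omega>)) -` (S \<times> V) \<inter> space M" by auto
  ultimately show "emeasure (distr M A X) S * emeasure (distr M B Y) V = emeasure (distr M (A \<Otimes>\<^sub>M B) (\<lambda>\<omega>. (X \<omega>, Y \<omega>))) (S \<times> V)"
    using SV by (simp add: emeasure_distr emeasure_eq_measure ennreal_mult[symmetric] measure_nonneg)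
next
  show "sigma_finite_measure (distr M A X)" "sigma_finite_measure (distr M B Y)"
    by (intro prob_space_imp_sigma_finite prob_space_distr X Y)+
qed (simp cong: sets_pair_measure_cong)

lemma (in prob_space) regular_conditional_distribution_of_independent:
  assumes T[measurable]: "T \<in> measurable M N" and Y[measurable]: "Y \<in> measurable M S"
    and ind: "distr M (N \<Otimes>\<^sub>M S) (\<lambda>\<omega>. (T \<omega>, Y \<omega>)) = distr M N T \<Otimes>\<^sub>M distr M S Y"
    and f[measurable]: "f \<in> measurable (N \<Otimes>\<^sub>M S) R"
    and V[measurable]: "V \<in> measurable M R" and eq: "AE \<omega> in M. V \<omega> = f (T \<omega>, Y \<omega>)"
  shows "regular_conditional_distribution M N T R V (\<lambda>t. distr (distr M S Y) R (\<lambda>y. f (t, y)))"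
  unfolding regular_conditional_distribution_def
proof (intro conjI ballI T V)
  let ?L = "distr M S Y" and ?\<kappa> = "\<lambda>t. distr (distr M S Y) R (\<lambda>y. f (t, y))"
  interpret L: prob_space ?L by (rule prob_space_distr[OF Y])
  interpret TT: prob_space "distr M N T" by (rule prob_space_distr[OF T])
  have fL: "f \<in> measurable (N \<Otimes>\<^sub>M ?L) R" by (simp cong: measurable_cong_sets sets_pair_measure_cong)
  show \<kappa>: "?\<kappa> \<in> measurable N (prob_algebra R)"
  proof (rule measurable_distr_prob_space2)
    show "(\<lambda>t. ?L) \<in> measurable N (prob_algebra S)"
      by (intro measurable_const) (auto simp: space_prob_algebra L.prob_space_axioms)
    show "(\<lambda>(t, y). f (t, y)) \<in> measurable (N \<Otimes>\<^sub>M S) R" by simp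
  qed
  fix B assume B[measurable]: "B \<in> sets R"
  let ?F = "vimage_algebra (space M) T N"
  have sub: "subalgebra M ?F"
    unfolding subalgebra_def using measurable_sets[OF T] measurable_space[OF T] by (auto simp: sets_vimage_algebra2)
  interpret finite_measure_subalgebra M ?F by standard (rule sub)
  have mk: "(\<lambda>t. measure (?\<kappa> t) B) \<in> borel_measurable N"
    by (rule measurable_compose[OF \<kappa> measurable_measure_prob_algebra[OF B]])
  have TF: "T \<in> measurable ?F N" using measurable_space[OF T] by (intro measurable_vimage_algebra1) auto
  have p: "measure (?\<kappa> t) B \<le> 1" if "t \<in> space N" for t
    using measurable_space[OF \<kappa> that] by (intro prob_space.prob_le_1) (simp add: space_prob_algebra)
  have sec: "measure (?\<kappa> t) B = measure ?L {y\<in>space S. f (t, y) \<in> B}" if "t \<in> space N" for t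
    using that by (subst measure_distr) (auto intro!: arg_cong[where f="measure ?L"])
  show "AE \<omega> in M. real_cond_exp M ?F (indicator (V -` B \<inter> space M)) \<omega> = measure (?\<kappa> (T \<omega>)) B"
  proof (rule real_cond_exp_charact)
    fix A assume "A \<in> sets ?F"
    then obtain C where C[measurable]: "C \<in> sets N" and A: "A = T -` C \<inter> space M"
      using measurable_space[OF T] by (auto simp: sets_vimage_algebra2)
    let ?E = "{p\<in>space (N \<Otimes>\<^sub>M S). fst p \<in> C \<and> f p \<in> B}"
    have E[measurable]: "?E \<in> sets (N \<Otimes>\<^sub>M S)" by measurable
    have "(\<integral>\<omega>\<in>A. indicator (V -` B \<inter> space M) \<omega> \<partial>M) = (\<integral>\<omega>. indicat_real ?E (T \<omega>, Y \<omega>) \<partial>M)"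
      unfolding set_lebesgue_integral_def
    proof (intro integral_cong_AE)
      show "AE \<omega> in M. indicator A \<omega> *\<^sub>R indicator (V -` B \<inter> space M) \<omega> = (indicator ?E (T \<omega>, Y \<omega>) :: real)"
        using eq AE_space
        by eventually_elim (use measurable_space[OF T] measurable_space[OF Y] in \<open>auto simp: A indicator_def space_pair_measure\<close>)
    qed (auto simp: A)
    also have "\<dots> = (\<integral>p. indicat_real ?E p \<partial>distr M (N \<Otimes>\<^sub>M S) (\<lambda>\<omega>. (T \<omega>, Y \<omega>)))"
      by (subst integral_distr) auto
    also have "\<dots> = measure (distr M (N \<Otimes>\<^sub>M S) (\<lambda>\<omega>. (T \<omega>, Y \<omega>))) ?E"
      by (subst Bochner_Integration.integral_indicator) (auto intro!: arg_cong2[where f=measure])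
    also have "\<dots> = measure (distr M N T \<Otimes>\<^sub>M ?L) ?E"
      unfolding ind ..
    also have "\<dots> = enn2real (\<integral>\<^sup>+t. emeasure ?L (Pair t -` ?E) \<partial>distr M N T)"
      unfolding measure_def by (subst L.emeasure_pair_measure_alt) (auto cong: sets_pair_measure_cong)
    also have "(\<integral>\<^sup>+t. emeasure ?L (Pair t -` ?E) \<partial>distr M N T) = (\<integral>\<^sup>+t. ennreal (indicator C t * measure (?\<kappa> t) B) \<partial>distr M N T)"
    proof (rule nn_integral_cong)
      fix t assume "t \<in> space (distr M N T)"
      then have t: "t \<in> space N" by simp
      then have "Pair t -` ?E = (if t \<in> C then {y\<in>space S. f (t, y) \<in> B} else {})" by (auto simp: space_pair_measure)
      then show "emeasure ?L (Pair t -` ?E) = ennreal (indicator C t * measure (?\<kappa> t) B)"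
        using sec[OF t] by (simp add: L.emeasure_eq_measure)
    qed
    also have "enn2real \<dots> = (\<integral>t. indicator C t * measure (?\<kappa> t) B \<partial>distr M N T)"
      using mk by (intro integral_eq_nn_integral[symmetric]) auto
    also have "\<dots> = (\<integral>\<omega>. indicator C (T \<omega>) * measure (?\<kappa> (T \<omega>)) B \<partial>M)"
      using mk by (intro integral_distr) auto
    also have "\<dots> = (\<integral>\<omega>\<in>A. measure (?\<kappa> (T \<omega>)) B \<partial>M)"
      unfolding set_lebesgue_integral_def A by (intro Bochner_Integration.integral_cong) (auto simp: indicator_def)
    finally show "(\<integral>\<omega>\<in>A. indicator (V -` B \<inter> space M) \<omega> \<partial>M) = (\<integral>\<omega>\<in>A. measure (?\<kappa> (T \<omega>)) B \<partial>M)" .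
  next
    show "integrable M (\<lambda>\<omega>. measure (?\<kappa> (T \<omega>)) B)"
      using measurable_compose[OF T mk] measurable_space[OF T] p
      by (intro integrable_const_bound[where B=1]) (auto intro!: AE_I2)
    show "integrable M (indicat_real (V -` B \<inter> space M))"
      by (rule integrable_real_indicator) (use measurable_sets[OF V B] in \<open>auto simp: less_top[symmetric]\<close>)
    show "(\<lambda>\<omega>. measure (?\<kappa> (T \<omega>)) B) \<in> borel_measurable ?F"
      by (rule measurable_compose[OF TF mk])
  qed
qed

lemma (in prob_space) distr_pair_map:
  assumes X[measurable]: "X \<in> measurable M A" and Y[measurable]: "Y \<in> measurable M B"
    and eq: "distr M (A \<Otimes>\<^sub>M B) (\<lambda>\<omega>. (X \<omega>, Y \<omega>)) = distr M A X \<Otimes>\<^sub>M distr M B Y"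
    and f[measurable]: "f \<in> measurable A A'" and g[measurable]: "g \<in> measurable B B'"
  shows "distr M (A' \<Otimes>\<^sub>M B') (\<lambda>\<omega>. (f (X \<omega>), g (Y \<omega>))) = distr M A' (\<lambda>\<omega>. f (X \<omega>)) \<Otimes>\<^sub>M distr M B' (\<lambda>\<omega>. g (Y \<omega>))"
proof -
  have F: "(\<lambda>(x, y). (f x, g y)) \<in> measurable (A \<Otimes>\<^sub>M B) (A' \<Otimes>\<^sub>M B')" by measurable
  have "distr M (A' \<Otimes>\<^sub>M B') (\<lambda>\<omega>. (f (X \<omega>), g (Y \<omega>))) = distr (distr M (A \<Otimes>\<^sub>M B) (\<lambda>\<omega>. (X \<omega>, Y \<omega>))) (A' \<Otimes>\<^sub>M B') (\<lambda>(x, y). (f x, g y))"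
    by (subst distr_distr[OF F]) (auto simp: comp_def)
  also have "\<dots> = distr (distr M A X) A' f \<Otimes>\<^sub>M distr (distr M B Y) B' g"
    unfolding eq by (intro pair_measure_distr[symmetric] prob_space_imp_sigma_finite prob_space.prob_space_distr prob_space_distr) auto
  also have "\<dots> = distr M A' (\<lambda>\<omega>. f (X \<omega>)) \<Otimes>\<^sub>M distr M B' (\<lambda>\<omega>. g (Y \<omega>))"
    by (simp add: distr_distr comp_def)
  finally show ?thesis .
qed

section \<open>The queue length distribution\<close>

text \<open>\<open>Y s\<close> is the increment over \<open>[u, u + s]\<close> minus its best linear prediction from the values
  at time \<open>u\<close>; covariance \<open>s (\<theta> - \<tau> t)\<close> makes it uncorrelated with the whole past.\<close>

lemma (in gaussian_space) gmsi_residual: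
  fixes X :: "'i \<Rightarrow> real \<Rightarrow> 'a \<Rightarrow> real" and k \<theta> \<tau> :: "'i \<Rightarrow> real"
  assumes I: "finite I" and X: "\<And>i t. i \<in> I \<Longrightarrow> t \<in> {0..u + h} \<Longrightarrow> X i t \<in> H"
    and cov: "\<And>i s t. i \<in> I \<Longrightarrow> 0 \<le> s \<Longrightarrow> s \<le> t \<Longrightarrow> t \<le> u + h \<Longrightarrow>
      expectation (\<lambda>\<omega>. X i s \<omega> * X i t \<omega>) = s * (\<theta> i - \<tau> i * t)"
    and cross: "\<And>i j s t. i \<in> I \<Longrightarrow> j \<in> I \<Longrightarrow> i \<noteq> j \<Longrightarrow> s \<in> {0..u + h} \<Longrightarrow> t \<in> {0..u + h} \<Longrightarrow>
      expectation (\<lambda>\<omega>. X i s \<omega> * X j t \<omega>) = 0"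
    and u: "0 \<le> u" and \<tau>: "\<And>i. i \<in> I \<Longrightarrow> \<tau> i \<noteq> 0" and d: "\<And>i. i \<in> I \<Longrightarrow> \<theta> i - \<tau> i * u \<noteq> 0"
  defines "Y \<equiv> \<lambda>s \<omega>. \<Sum>i\<in>I. k i * (X i (u + s) \<omega> - (1 - s / (\<theta> i / \<tau> i - u)) * X i u \<omega>)"
  shows "s \<in> {0..h} \<Longrightarrow> Y s \<in> H"
    and "j \<in> I \<Longrightarrow> r \<in> {0..u} \<Longrightarrow> s \<in> {0..h} \<Longrightarrow> expectation (\<lambda>\<omega>. X j r \<omega> * Y s \<omega>) = 0"
    and "0 \<le> s \<Longrightarrow> s \<le> t \<Longrightarrow> t \<le> h \<Longrightarrow> expectation (\<lambda>\<omega>. Y s \<omega> * Y t \<omega>)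
      = s * ((\<Sum>i\<in>I. (k i)\<^sup>2 * \<theta> i) - (\<Sum>i\<in>I. (k i)\<^sup>2 * (\<theta> i / (\<theta> i / \<tau> i - u))) * t)"
proof -
  define a where "a i = \<theta> i / \<tau> i - u" for i
  define W where "W i s = (\<lambda>\<omega>. X i (u + s) \<omega> - (1 - s / a i) * X i u \<omega>)" for i s
  have Y: "Y s = (\<lambda>\<omega>. \<Sum>i\<in>I. k i * W i s \<omega>)" for s by (simp add: Y_def W_def a_def)
  have a: "a i = (\<theta> i - \<tau> i * u) / \<tau> i" if "i \<in> I" for i using \<tau>[OF that] by (simp add: a_def field_simps)
  \<comment> \<open>This is the regression coefficient of \<open>X i (u + s)\<close> on
    \<open>X i u\<close>. The factor \<open>u\<close> shared by covariance and variance has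
    cancelled, so the formula also covers \<open>u = 0\<close>.\<close>
  have ratio: "1 - s / a i = (\<theta> i - \<tau> i * u - \<tau> i * s) / (\<theta> i - \<tau> i * u)" if "i \<in> I" for i s
    unfolding a[OF that] using \<tau>[OF that] d[OF that] by (simp add: field_simps)
  have W: "W i s \<in> H" if "i \<in> I" "s \<in> {0..h}" for i s
    unfolding W_def using X[OF that(1), of "u + s"] X[OF that(1), of u] that u by (intro diff_closed scale_closed) auto
  have EXW: "expectation (\<lambda>\<omega>. X j r \<omega> * W i s \<omega>)
      = expectation (\<lambda>\<omega>. X j r \<omega> * X i (u + s) \<omega>) - (1 - s / a i) * expectation (\<lambda>\<omega>. X j r \<omega> * X i u \<omega>)"
    if "i \<in> I" "j \<in> I" "r \<in> {0..u + h}" "s \<in> {0..h}" for i j r s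
    unfolding W_def using that X[OF that(1), of "u + s"] X[OF that(1), of u] X[OF that(2,3)] u scale_closed[of "X i u" "1 - s / a i"]
    by (simp add: covariance_diff_right covariance_scale_right)
  have XW: "expectation (\<lambda>\<omega>. X j r \<omega> * W i s \<omega>) = 0" if "i \<in> I" "j \<in> I" "r \<in> {0..u}" "s \<in> {0..h}" for i j r s
  proof (cases "i = j")
    case True
    have "(1 - s / a i) * (\<theta> i - \<tau> i * u) = \<theta> i - \<tau> i * u - \<tau> i * s" using d[OF that(1)] by (simp add: ratio[OF that(1)])
    then have e1: "(1 - s / a i) * (r * (\<theta> i - \<tau> i * u)) = r * (\<theta> i - \<tau> i * u - \<tau> i * s)" by (metis mult.left_commute)
    have e2: "expectation (\<lambda>\<omega>. X j r \<omega> * W i s \<omega>) = r * (\<theta> i - \<tau> i * (u + s)) - (1 - s / a i) * (r * (\<theta> i - \<tau> i * u))"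
      using that True EXW[of i j r s] cov[of i r "u + s"] cov[of i r u] u by simp
    show ?thesis unfolding e2 e1 by (simp add: distrib_left diff_diff_eq)
  next
    case False
    then show ?thesis using that EXW[of i j r s] cross[of j i r "u + s"] cross[of j i r u] u by simp
  qed
  have XW': "expectation (\<lambda>\<omega>. X j r \<omega> * W i s \<omega>) = 0" if "i \<in> I" "j \<in> I" "i \<noteq> j" "r \<in> {0..u + h}" "s \<in> {0..h}" for i j r s
    using that EXW[of i j r s] cross[of j i r "u + s"] cross[of j i r u] u by simp
  \<comment> \<open>\<open>W j t\<close> is orthogonal to \<open>X i u\<close>, so the prediction
    part of \<open>W i s\<close> drops out.\<close>
  have EWW: "expectation (\<lambda>\<omega>. W i s \<omega> * W j t \<omega>) = expectation (\<lambda>\<omega>. X i (u + s) \<omega> * W j t \<omega>)"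
    if "i \<in> I" "j \<in> I" "s \<in> {0..h}" "t \<in> {0..h}" for i j s t
  proof -
    have "expectation (\<lambda>\<omega>. W i s \<omega> * W j t \<omega>)
      = expectation (\<lambda>\<omega>. X i (u + s) \<omega> * W j t \<omega>) - (1 - s / a i) * expectation (\<lambda>\<omega>. X i u \<omega> * W j t \<omega>)"
      unfolding W_def[of i] using that X[OF that(1), of "u + s"] X[OF that(1), of u] W[OF that(2,4)] u scale_closed[of "X i u" "1 - s / a i"]
      by (simp add: covariance_diff_left covariance_scale_left)
    then show ?thesis using XW[OF that(2,1), of u t] that u by simp
  qed
  have WW': "expectation (\<lambda>\<omega>. W i s \<omega> * W j t \<omega>) = 0" if "i \<in> I" "j \<in> I" "i \<noteq> j" "s \<in> {0..h}" "t \<in> {0..h}" for i j s t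
    using EWW[OF that(1,2,4,5)] XW'[of j i "u + s" t] that u by simp
  \<comment> \<open>The residual again has a covariance of the form
    \<open>s * (\<theta> - \<tau> * t)\<close>, now with \<open>\<theta> i / a i\<close> in place of
    \<open>\<tau> i\<close>; weighted by the squares of the \<open>k i\<close>, these values add up
    to \<open>\<tau>u\<close>.\<close>
  have WW: "expectation (\<lambda>\<omega>. W i s \<omega> * W i t \<omega>) = s * (\<theta> i - \<theta> i / a i * t)" if "i \<in> I" "0 \<le> s" "s \<le> t" "t \<le> h" for i s t
  proof -
    have "expectation (\<lambda>\<omega>. X i (u + s) \<omega> * X i u \<omega>) = u * (\<theta> i - \<tau> i * (u + s))"
      using cov[of i u "u + s"] that u by (simp add: mult.commute[of "X i (u + s) _"])
    then have "expectation (\<lambda>\<omega>. W i s \<omega> * W i t \<omega>)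
        = (u + s) * (\<theta> i - \<tau> i * (u + t)) - (1 - t / a i) * (u * (\<theta> i - \<tau> i * (u + s)))"
      using EWW[of i i s t] EXW[of i i "u + s" t] cov[of i "u + s" "u + t"] that u by simp
    also have "\<dots> = s * (\<theta> i - \<theta> i / a i * t)"
      unfolding ratio[OF that(1)] a[OF that(1)] using \<tau>[OF that(1)] d[OF that(1)]
      by (simp add: divide_simps) (simp add: algebra_simps)
    finally show ?thesis .
  qed
  show YH: "Y s \<in> H" if "s \<in> {0..h}" for s
    unfolding Y using I W that by (intro lincomb_closed) auto
  have sumr: "expectation (\<lambda>\<omega>. V \<omega> * Y s \<omega>) = (\<Sum>i\<in>I. k i * expectation (\<lambda>\<omega>. V \<omega> * W i s \<omega>))"
    if "V \<in> H" "s \<in> {0..h}" for V s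
  proof -
    have "W i s \<in> H" if "i \<in> I" for i using W that \<open>s \<in> {0..h}\<close> by blast
    from covariance_sum_left[where X="\<lambda>i. W i s" and c=k, OF I this that(1)]
    show ?thesis unfolding Y by (simp add: mult.commute[of "V _"])
  qed
  show "expectation (\<lambda>\<omega>. X j r \<omega> * Y s \<omega>) = 0" if "j \<in> I" "r \<in> {0..u}" "s \<in> {0..h}" for j r s
    using sumr[OF X that(3), of j r] XW[OF _ that] that by simp
  show "expectation (\<lambda>\<omega>. Y s \<omega> * Y t \<omega>)
      = s * ((\<Sum>i\<in>I. (k i)\<^sup>2 * \<theta> i) - (\<Sum>i\<in>I. (k i)\<^sup>2 * (\<theta> i / (\<theta> i / \<tau> i - u))) * t)"
    if st: "0 \<le> s" "s \<le> t" "t \<le> h" for s t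
  proof -
    have sh: "s \<in> {0..h}" "t \<in> {0..h}" using st by auto
    have "expectation (\<lambda>\<omega>. Y s \<omega> * Y t \<omega>) = (\<Sum>i\<in>I. k i * expectation (\<lambda>\<omega>. W i s \<omega> * Y t \<omega>))"
      unfolding Y[of s] using I W sh YH by (intro covariance_sum_left) auto
    also have "\<dots> = (\<Sum>i\<in>I. k i * (k i * (s * (\<theta> i - \<theta> i / a i * t))))"
    proof (intro sum.cong refl)
      fix i assume i: "i \<in> I"
      have "expectation (\<lambda>\<omega>. W i s \<omega> * Y t \<omega>) = (\<Sum>j\<in>I. k j * expectation (\<lambda>\<omega>. W i s \<omega> * W j t \<omega>))"
        by (rule sumr[OF W[OF i sh(1)] sh(2)])
      also have "\<dots> = (\<Sum>j\<in>I. if j = i then k i * (s * (\<theta> i - \<theta> i / a i * t)) else 0)"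
        using WW[OF i st] WW'[OF i _ _ sh] by (intro sum.cong) auto
      also have "\<dots> = k i * (s * (\<theta> i - \<theta> i / a i * t))" using I i by simp
      finally show "k i * expectation (\<lambda>\<omega>. W i s \<omega> * Y t \<omega>) = k i * (k i * (s * (\<theta> i - \<theta> i / a i * t)))" by simp
    qed
    also have "\<dots> = s * ((\<Sum>i\<in>I. (k i)\<^sup>2 * \<theta> i) - (\<Sum>i\<in>I. (k i)\<^sup>2 * (\<theta> i / a i)) * t)"
      unfolding sum_distrib_left sum_distrib_right right_diff_distrib sum_subtractf[symmetric]
      by (intro sum.cong refl) (simp add: power2_eq_square algebra_simps)
    finally show ?thesis by (simp add: a_def)
  qed
qed

theorem theorem3:
  fixes M :: "'a measure"
    and K :: nat
    and \<Delta> :: ereal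
    and \<theta> \<tau> k :: "nat \<Rightarrow> real"
    and \<rho> u h :: real
    and X :: "nat \<Rightarrow> real \<Rightarrow> 'a \<Rightarrow> real"
    and Z L Q :: "real \<Rightarrow> 'a \<Rightarrow> real"
  assumes "prob_space M"
    and "\<forall>i\<in>{1..K}. 0 < \<theta> i \<and> \<tau> i \<noteq> 0"
    and "0 < \<Delta>"
    and "\<forall>i\<in>{1..K}. 0 < \<tau> i \<longrightarrow> \<Delta> \<le> ereal (\<theta> i / \<tau> i)"
    and "\<forall>i\<in>{1..K}. gmsi_process M \<Delta> (\<theta> i) (\<tau> i) (X i)"
    and "prob_space.indep_vars M (\<lambda>_. \<Pi>\<^sub>M t\<in>time_set \<Delta>. borel)
           (\<lambda>i \<omega>. \<lambda>t\<in>time_set \<Delta>. X i t \<omega>) {1..K}"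
    and "\<exists>i\<in>{1..K}. k i \<noteq> 0"
    and "\<forall>t\<in>time_set \<Delta>. \<forall>\<omega>\<in>space M. Z t \<omega> = \<rho> * t + (\<Sum>i=1..K. k i * X i t \<omega>)"
    and "\<forall>t\<in>time_set \<Delta>. Q t \<in> borel_measurable M"
    and "AE \<omega> in M. queue_length_path \<Delta> (\<lambda>t. Z t \<omega>) (\<lambda>t. L t \<omega>) (\<lambda>t. Q t \<omega>)"
    and "prob_space.indep_set M
           (sets (vimage_algebra (space M) (Q 0) borel))
           (sets (vimage_algebra (space M)
              (\<lambda>\<omega>. \<lambda>p\<in>{1..K} \<times> time_set \<Delta>. X (fst p) (snd p) \<omega>)
              (\<Pi>\<^sub>M p\<in>{1..K} \<times> time_set \<Delta>. borel)))"
    and "0 \<le> u" and "0 < h" and "ereal h < \<Delta> - ereal u"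
  shows "\<exists>\<kappa> :: (nat \<Rightarrow> real) \<times> real \<Rightarrow> real measure.
    regular_conditional_distribution M
      ((\<Pi>\<^sub>M i\<in>{1..K}. borel) \<Otimes>\<^sub>M borel) (\<lambda>\<omega>. (\<lambda>i\<in>{1..K}. X i u \<omega>, Q u \<omega>))
      borel (Q (u + h)) \<kappa> \<and>
    (\<forall>x\<in>{1..K} \<rightarrow>\<^sub>E UNIV. \<forall>v\<ge>0. \<forall>q\<ge>0.
      (let \<Theta> = (\<Sum>i=1..K. (k i)\<^sup>2 * \<theta> i);
           \<tau>u = (\<Sum>i=1..K. (k i)\<^sup>2 * (\<theta> i / (\<theta> i / \<tau> i - u)));
           \<rho>ux = \<rho> - (\<Sum>i=1..K. k i * x i / (\<theta> i / \<tau> i - u));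
           E = exp (- 2 * q * (\<tau>u * q - \<Theta> * \<rho>ux) / \<Theta>\<^sup>2);
           D = sqrt (2 * h * (\<Theta> - \<tau>u * h))
       in measure (\<kappa> (x, v)) {..q} =
            1 / 2 * (1 - E - erf ((- q + v + \<rho>ux * h) / D)
              + E * erf ((\<Theta> * (q + v) - (2 * \<tau>u * q - \<Theta> * \<rho>ux) * h) / (\<Theta> * D)))))"
proof -
  interpret prob_space M by fact
  define I where "I = {1..K}"
  define T where "T = time_set \<Delta>"
  note asm = assms[folded I_def T_def]
  have fI: "finite I" by (simp add: I_def)
  have \<theta>\<tau>: "0 < \<theta> i" "\<tau> i \<noteq> 0" if "i \<in> I" for i using asm(2) that by auto
  have u0: "0 \<le> u" and h0: "0 < h" and hD: "ereal h < \<Delta> - ereal u" by fact+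
  have "ereal (u + h) < \<Delta>" using hD by (cases \<Delta>) auto
  then have uhT: "u + h \<in> T" using u0 h0 by (simp add: T_def time_set_def)
  then have sub: "{0..u + h} \<subseteq> T" using time_set_interval unfolding T_def by auto
  have d1: "0 < \<theta> i - \<tau> i * (u + h)" if i: "i \<in> I" for i
  proof (cases "0 < \<tau> i")
    case True
    then have "\<Delta> \<le> ereal (\<theta> i / \<tau> i)" using asm(4) i by auto
    then have "ereal (u + h) < ereal (\<theta> i / \<tau> i)" using \<open>ereal (u + h) < \<Delta>\<close> by (rule less_le_trans[rotated])
    then show ?thesis using True by (simp add: field_simps)
  next
    case False
    then have "\<tau> i * (u + h) \<le> 0" using u0 h0 by (intro mult_nonpos_nonneg) auto
    then show ?thesis using \<theta>\<tau>(1)[OF i] by linarith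
  qed
  \<comment> \<open>The map sending \<open>r\<close> to \<open>\<theta> i - \<tau> i * r\<close> is
    affine and positive at 0 and at \<open>u + h\<close>, hence at the intermediate point
    \<open>u\<close>.\<close>
  have d0: "0 < \<theta> i - \<tau> i * u" if i: "i \<in> I" for i
  proof -
    have "0 < \<theta> i * h" "0 \<le> (\<theta> i - \<tau> i * (u + h)) * u" using \<theta>\<tau>(1)[OF i] d1[OF i] u0 h0 by auto
    then have "0 < (\<theta> i - \<tau> i * u) * (u + h)" by (simp add: algebra_simps)
    then show ?thesis using u0 h0 by (simp add: zero_less_mult_iff)
  qed
  have gmsi: "gaussian_process M T (X i)" "\<And>t. t \<in> T \<Longrightarrow> expectation (X i t) = 0"
    "AE \<omega> in M. continuous_on T (\<lambda>t. X i t \<omega>)"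
    "\<And>s t. s \<in> T \<Longrightarrow> t \<in> T \<Longrightarrow> s \<le> t \<Longrightarrow> expectation (\<lambda>\<omega>. X i s \<omega> * X i t \<omega>) = s * (\<theta> i - \<tau> i * t)"
    if "i \<in> I" for i
    using asm(5) that unfolding gmsi_process_def T_def[symmetric] by auto
  define H where "H = process_span I T X"
  have gs: "gaussian_space M H" unfolding H_def
    by (rule gaussian_space_process_span(1)[OF fI gmsi(1,2) asm(6)])
  interpret gaussian_space M H by (rule gs)
  have XH: "X i t \<in> H" if "i \<in> I" "t \<in> T" for i t unfolding H_def by (rule process_in_span[OF fI that])
  have cross: "expectation (\<lambda>\<omega>. X i s \<omega> * X j t \<omega>) = 0" if "i \<in> I" "j \<in> I" "i \<noteq> j" "s \<in> T" "t \<in> T" for i j s t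
    using that by (intro gaussian_space_process_span(2)[OF fI gmsi(1,2) asm(6)])
  have mX[measurable]: "X i t \<in> borel_measurable M" if "i \<in> I" "t \<in> T" for i t
    using XH[OF that] by (rule measurable_H)

  define a where "a i = \<theta> i / \<tau> i - u" for i
  have a0: "a i \<noteq> 0" if "i \<in> I" for i using d0[OF that] \<theta>\<tau>(2)[OF that] by (auto simp: a_def field_simps)
  define \<Theta> where "\<Theta> = (\<Sum>i\<in>I. (k i)\<^sup>2 * \<theta> i)"
  define \<tau>u where "\<tau>u = (\<Sum>i\<in>I. (k i)\<^sup>2 * (\<theta> i / a i))"
  define \<rho>x where "\<rho>x x = \<rho> - (\<Sum>i\<in>I. k i * x i / a i)" for x :: "nat \<Rightarrow> real"
  define Y where "Y s \<omega> = (\<Sum>i\<in>I. k i * (X i (u + s) \<omega> - (1 - s / a i) * X i u \<omega>))" for s \<omega>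
  have res: "s \<in> {0..h} \<Longrightarrow> Y s \<in> H"
    "j \<in> I \<Longrightarrow> r \<in> {0..u} \<Longrightarrow> s \<in> {0..h} \<Longrightarrow> expectation (\<lambda>\<omega>. X j r \<omega> * Y s \<omega>) = 0"
    "0 \<le> s \<Longrightarrow> s \<le> t \<Longrightarrow> t \<le> h \<Longrightarrow> expectation (\<lambda>\<omega>. Y s \<omega> * Y t \<omega>) = s * (\<Theta> - \<tau>u * t)" for s t j r
  proof -
    have d0': "\<theta> i - \<tau> i * u \<noteq> 0" if "i \<in> I" for i using d0[OF that] by simp
    have X': "X i t \<in> H" if "i \<in> I" "t \<in> {0..u + h}" for i t using XH sub that by blast
    have cov': "expectation (\<lambda>\<omega>. X i s \<omega> * X i t \<omega>) = s * (\<theta> i - \<tau> i * t)"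
      if "i \<in> I" "0 \<le> s" "s \<le> t" "t \<le> u + h" for i s t
      using that sub by (intro gmsi(4)) auto
    have cross': "expectation (\<lambda>\<omega>. X i s \<omega> * X j t \<omega>) = 0"
      if "i \<in> I" "j \<in> I" "i \<noteq> j" "s \<in> {0..u + h}" "t \<in> {0..u + h}" for i j s t
      using that sub by (intro cross) auto
    have Y': "Y = (\<lambda>s \<omega>. \<Sum>i\<in>I. k i * (X i (u + s) \<omega> - (1 - s / (\<theta> i / \<tau> i - u)) * X i u \<omega>))"
      by (simp add: Y_def[abs_def] a_def)
    note g = gmsi_residual[where X=X and u=u and h=h and \<theta>=\<theta> and \<tau>=\<tau> and k=k, OF fI X' cov' cross' u0 \<theta>\<tau>(2) d0']
    show "s \<in> {0..h} \<Longrightarrow> Y s \<in> H" unfolding Y' by (rule g(1))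
    show "j \<in> I \<Longrightarrow> r \<in> {0..u} \<Longrightarrow> s \<in> {0..h} \<Longrightarrow> expectation (\<lambda>\<omega>. X j r \<omega> * Y s \<omega>) = 0" unfolding Y' by (rule g(2))
    show "0 \<le> s \<Longrightarrow> s \<le> t \<Longrightarrow> t \<le> h \<Longrightarrow> expectation (\<lambda>\<omega>. Y s \<omega> * Y t \<omega>) = s * (\<Theta> - \<tau>u * t)"
      unfolding Y' \<Theta>_def \<tau>u_def a_def by (rule g(3))
  qed
  have \<Theta>: "0 < \<Theta>" and pos: "0 < \<Theta> - \<tau>u * h"
  proof -
    obtain j where j: "j \<in> I" "k j \<noteq> 0" using asm(7) by auto
    show "0 < \<Theta>" unfolding \<Theta>_def
      using j \<theta>\<tau>(1) by (intro sum_pos2[OF fI j(1)]) (auto intro!: mult_nonneg_nonneg simp: less_imp_le)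
    \<comment> \<open>The difference is \<open>\<theta> i\<close> times the ratio of
      \<open>\<theta> i - \<tau> i * r\<close> at \<open>r = u + h\<close> to its value at
      \<open>r = u\<close>, both positive.\<close>
    have p: "0 < \<theta> i - \<theta> i / a i * h" if i: "i \<in> I" for i
    proof -
      have "\<theta> i - \<theta> i / a i * h = \<theta> i * (\<theta> i - \<tau> i * (u + h)) / (\<theta> i - \<tau> i * u)"
        using d0[OF i] \<theta>\<tau>(2)[OF i] by (simp add: a_def divide_simps) (simp add: algebra_simps)
      then show ?thesis using d0[OF i] d1[OF i] \<theta>\<tau>(1)[OF i] by simp
    qed
    have "\<Theta> - \<tau>u * h = (\<Sum>i\<in>I. (k i)\<^sup>2 * (\<theta> i - \<theta> i / a i * h))"
      unfolding \<Theta>_def \<tau>u_def by (simp add: sum_distrib_right sum_subtractf[symmetric] right_diff_distrib mult.assoc)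
    also have "0 < \<dots>"
      using j p by (intro sum_pos2[OF fI j(1)]) (auto intro!: mult_nonneg_nonneg simp: less_imp_le)
    finally show "0 < \<Theta> - \<tau>u * h" .
  qed
  have contX: "AE \<omega> in M. \<forall>i\<in>I. continuous_on T (\<lambda>t. X i t \<omega>)"
    using gmsi(3) fI by (intro AE_finite_allI) auto
  have contY: "AE \<omega> in M. continuous_on {0..h} (\<lambda>s. Y s \<omega>)"
    using contX
  proof eventually_elim
    case (elim \<omega>)
    have "continuous_on {0..h} (\<lambda>s. X i (u + s) \<omega>)" if "i \<in> I" for i
      using elim that sub u0 by (intro continuous_on_compose2[where f="\<lambda>s. u + s" and s="{0..h}" and t=T and g="\<lambda>t. X i t \<omega>"] continuous_intros) auto
    then show ?case unfolding Y_def using a0 by (intro continuous_intros) auto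
  qed

  txt \<open>Time reversal turns the supremum of \<open>Y h - Y s\<close> into a running supremum.\<close>
  define R where "R s \<omega> = Y h \<omega> - Y (h - s) \<omega>" for s \<omega>
  interpret bridge_crossing M H R h \<Theta> \<tau>u
  proof
    show "R s \<in> H" if "s \<in> {0..h}" for s
      unfolding R_def[abs_def] using that h0 by (intro diff_closed res(1)) auto
    \<comment> \<open>Reversal about \<open>h\<close> reproduces the covariance function, so
      \<open>R\<close> has the same parameters \<open>\<Theta>\<close> and \<open>\<tau>u\<close> as
      \<open>Y\<close>.\<close>
    show "expectation (\<lambda>\<omega>. R s \<omega> * R t \<omega>) = s * (\<Theta> - \<tau>u * t)" if st: "0 \<le> s" "s \<le> t" "t \<le> h" for s t
    proof -
      have Y: "Y h \<in> H" "Y (h - s) \<in> H" "Y (h - t) \<in> H" using st h0 by (auto intro!: res(1))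
      have "expectation (\<lambda>\<omega>. R s \<omega> * R t \<omega>) = expectation (\<lambda>\<omega>. Y h \<omega> * Y h \<omega>) - expectation (\<lambda>\<omega>. Y (h - t) \<omega> * Y h \<omega>)
          - (expectation (\<lambda>\<omega>. Y (h - s) \<omega> * Y h \<omega>) - expectation (\<lambda>\<omega>. Y (h - t) \<omega> * Y (h - s) \<omega>))"
        unfolding R_def using Y
        by (simp add: covariance_diff_left covariance_diff_right diff_closed mult.commute[of "Y h _" "Y (h - t) _"] mult.commute[of "Y (h - s) _" "Y (h - t) _"])
      also have "\<dots> = h * (\<Theta> - \<tau>u * h) - (h - t) * (\<Theta> - \<tau>u * h) - ((h - s) * (\<Theta> - \<tau>u * h) - (h - t) * (\<Theta> - \<tau>u * (h - s)))"
        using st h0 res(3)[of h h] res(3)[of "h - t" h] res(3)[of "h - s" h] res(3)[of "h - t" "h - s"] by simp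
      also have "\<dots> = s * (\<Theta> - \<tau>u * t)" by (simp add: algebra_simps)
      finally show ?thesis .
    qed
    show "AE \<omega> in M. continuous_on {0..h} (\<lambda>s. R s \<omega>)"
      using contY unfolding R_def
      by eventually_elim (intro continuous_intros continuous_on_compose2[where f="\<lambda>s. h - s" and s="{0..h}" and t="{0..h}"]; auto)
  qed (fact h0 \<Theta> pos)+

  let ?N = "(\<Pi>\<^sub>M i\<in>I. borel :: real measure) \<Otimes>\<^sub>M (borel :: real measure)"
  let ?S = "\<Pi>\<^sub>M s\<in>dyadics h. borel :: real measure"
  define f where "f = (\<lambda>(p :: (nat \<Rightarrow> real) \<times> real, y :: real \<Rightarrow> real).
    reflected (dyadics h) (snd p + \<rho>x (fst p) * h + y h) (\<lambda>s. \<rho>x (fst p) * (h - s) + y h - y s))"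
  define Tv where "Tv \<omega> = (\<lambda>i\<in>I. X i u \<omega>, Q u \<omega>)" for \<omega>
  define Yp where "Yp \<omega> = (\<lambda>s\<in>dyadics h. Y s \<omega>)" for \<omega>
  define \<kappa> where "\<kappa> t = distr (distr M ?S Yp) borel (\<lambda>y. f (t, y))" for t
  have D: "countable (dyadics h)" "dyadics h \<subseteq> {0..h}" "h \<in> dyadics h"
    using countable_dyadics dyadics_subset[of h] dyadics_ends h0 by auto
  have uT: "u \<in> T" "0 \<in> T" using sub u0 h0 by auto
  have mQ[measurable]: "Q t \<in> borel_measurable M" if "t \<in> T" for t using asm(9) that by auto
  have mY[measurable]: "Y s \<in> borel_measurable M" if "s \<in> dyadics h" for s
    using res(1) D(2) that by (intro measurable_H) auto
  have mYp: "Yp \<in> measurable M ?S" unfolding Yp_def using mY by (intro measurable_restrict)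
  have mTv: "Tv \<in> measurable M ?N"
    unfolding Tv_def using mX uT mQ by (intro measurable_Pair measurable_restrict) auto
  have mf: "f \<in> borel_measurable (?N \<Otimes>\<^sub>M ?S)"
  proof -
    have [measurable]: "(\<lambda>p. fst (fst p) i) \<in> borel_measurable (?N \<Otimes>\<^sub>M ?S)" if "i \<in> I" for i
      using measurable_compose[OF measurable_compose[OF measurable_fst measurable_fst] measurable_component_singleton[OF that]] .
    have [measurable]: "(\<lambda>p. snd p s) \<in> borel_measurable (?N \<Otimes>\<^sub>M ?S)" if "s \<in> dyadics h" for s
      using measurable_compose[OF measurable_snd measurable_component_singleton[OF that]] .
    have \<rho>m[measurable]: "(\<lambda>p. \<rho>x (fst (fst p))) \<in> borel_measurable (?N \<Otimes>\<^sub>M ?S)" unfolding \<rho>x_def by measurable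
    note hm[measurable] = \<open>\<And>s. s \<in> dyadics h \<Longrightarrow> (\<lambda>p. snd p s) \<in> borel_measurable (?N \<Otimes>\<^sub>M ?S)\<close>[OF D(3)]
    show ?thesis unfolding f_def case_prod_beta
      by (rule measurable_reflected[OF D(1)]) measurable
  qed

  have pathZ: "AE \<omega> in M. continuous_on T (\<lambda>t. Z t \<omega>) \<and> (\<forall>t\<in>T. Z t \<omega> = \<rho> * t + (\<Sum>i\<in>I. k i * X i t \<omega>))"
    using contX AE_space
  proof eventually_elim
    case (elim \<omega>)
    have Z: "Z t \<omega> = \<rho> * t + (\<Sum>i\<in>I. k i * X i t \<omega>)" if "t \<in> T" for t using asm(8) that elim by auto
    have "continuous_on T (\<lambda>t. \<rho> * t + (\<Sum>i\<in>I. k i * X i t \<omega>))"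
      using elim by (intro continuous_intros) auto
    then have "continuous_on T (\<lambda>t. Z t \<omega>)" by (rule continuous_on_eq) (simp add: Z)
    then show ?case using Z by auto
  qed
  have eq: "AE \<omega> in M. Q (u + h) \<omega> = f (Tv \<omega>, Yp \<omega>)"
    using pathZ asm(10)
  proof eventually_elim
    case (elim \<omega>)
    have path: "queue_length_path \<Delta> (\<lambda>t. Z t \<omega>) (\<lambda>t. L t \<omega>) (\<lambda>t. Q t \<omega>)"
      and cont: "continuous_on (time_set \<Delta>) (\<lambda>t. Z t \<omega>)"
      using elim unfolding T_def by blast+
    \<comment> \<open>\<open>X i (u + s) - X i u\<close> is the residual minus
      \<open>(s / a i) * X i u\<close>. The second part is linear in \<open>s\<close>, and
      collecting it changes the drift from \<open>\<rho>\<close> to \<open>\<rho>x\<close>.\<close>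
    have Z: "Z (u + s) \<omega> = Z u \<omega> + (\<rho>x (\<lambda>i\<in>I. X i u \<omega>) * s + Y s \<omega>)" if "s \<in> {0..h}" for s
    proof -
      have "u + s \<in> T" using sub that u0 by auto
      then have "Z (u + s) \<omega> - Z u \<omega> = \<rho> * s + (\<Sum>i\<in>I. k i * X i (u + s) \<omega> - k i * X i u \<omega>)"
        using elim uT by (simp add: sum_subtractf algebra_simps)
      also have "(\<Sum>i\<in>I. k i * X i (u + s) \<omega> - k i * X i u \<omega>) = Y s \<omega> - (\<Sum>i\<in>I. k i * X i u \<omega> / a i) * s"
        unfolding Y_def sum_distrib_right sum_subtractf[symmetric] by (intro sum.cong refl) (simp add: algebra_simps)
      also have "(\<Sum>i\<in>I. k i * X i u \<omega> / a i) = (\<Sum>i\<in>I. k i * (\<lambda>i\<in>I. X i u \<omega>) i / a i)" by (intro sum.cong) auto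
      finally show ?thesis unfolding \<rho>x_def by (simp add: algebra_simps)
    qed
    have "Q (u + h) \<omega> = reflected (dyadics h) (Q u \<omega> + Z (u + h) \<omega> - Z u \<omega>) (\<lambda>s. Z (u + h) \<omega> - Z (u + s) \<omega>)"
      by (rule queue_length_eq_reflected[OF path cont u0 less_imp_le[OF h0] uhT[unfolded T_def]])
    also have "\<dots> = f (Tv \<omega>, Yp \<omega>)"
      unfolding f_def Tv_def Yp_def reflected_def using Z D h0
      by (auto intro!: arg_cong[where f=real_of_ereal] arg_cong2[where f=max] SUP_cong simp: subset_iff right_diff_distrib)
    finally show ?case .
  qed

  \<comment> \<open>\<open>PX\<close> collects the full paths, \<open>PA\<close> their restriction
    to \<open>{0..u}\<close>. Zero covariance separates \<open>Yp\<close> from \<open>PA\<close>;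
    \<open>Q 0\<close>, independent of \<open>PX\<close>, is then added to the past, and
    \<open>Tv\<close> is a function of \<open>Q 0\<close> and \<open>PA\<close>.\<close>
  have indep: "distr M (?N \<Otimes>\<^sub>M ?S) (\<lambda>\<omega>. (Tv \<omega>, Yp \<omega>)) = distr M ?N Tv \<Otimes>\<^sub>M distr M ?S Yp"
  proof -
    let ?SX = "\<Pi>\<^sub>M p\<in>I \<times> T. borel :: real measure" and ?SA = "\<Pi>\<^sub>M p\<in>I \<times> {0..u}. borel :: real measure"
    define PX where "PX \<omega> = (\<lambda>p\<in>I \<times> T. X (fst p) (snd p) \<omega>)" for \<omega>
    define PA where "PA \<omega> = (\<lambda>p\<in>I \<times> {0..u}. X (fst p) (snd p) \<omega>)" for \<omega>
    have uT': "{0..u} \<subseteq> T" using sub h0 by auto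
    have mQ0: "Q 0 \<in> borel_measurable M" using mQ uT by auto
    have mPX: "PX \<in> measurable M ?SX" unfolding PX_def using mX by (intro measurable_restrict) auto
    have mPA: "PA \<in> measurable M ?SA" unfolding PA_def using mX uT' by (intro measurable_restrict) auto
    have mid: "(\<lambda>x :: real. x) \<in> borel_measurable borel" by simp
    define g1 where "g1 x = (\<lambda>p\<in>I \<times> {0..u}. x p)" for x :: "nat \<times> real \<Rightarrow> real"
    define g2 where "g2 x = (\<lambda>s\<in>dyadics h. \<Sum>i\<in>I. k i * (x (i, u + s) - (1 - s / a i) * x (i, u)))" for x :: "nat \<times> real \<Rightarrow> real"
    have cmp: "(\<lambda>x. x p) \<in> borel_measurable ?SX" if "p \<in> I \<times> T" for p
      using that by (rule measurable_component_singleton)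
    have mg1: "g1 \<in> measurable ?SX ?SA"
      unfolding g1_def using uT' by (intro measurable_restrict cmp) auto
    have usT: "u + s \<in> T" if "s \<in> dyadics h" for s using that D(2) sub u0 by (auto simp: subset_iff)
    have mg2: "g2 \<in> measurable ?SX ?S"
      unfolding g2_def using uT usT
      by (intro measurable_restrict borel_measurable_sum borel_measurable_times borel_measurable_diff
          borel_measurable_const cmp) auto
    have g1: "g1 (PX \<omega>) = PA \<omega>" for \<omega>
      unfolding g1_def PX_def PA_def using uT' by (auto simp: restrict_def fun_eq_iff)
    have g2: "g2 (PX \<omega>) = Yp \<omega>" for \<omega>
      unfolding g2_def PX_def Yp_def Y_def using uT usT by (auto simp: restrict_def fun_eq_iff intro!: sum.cong)
    have D0: "distr M (borel \<Otimes>\<^sub>M ?SX) (\<lambda>\<omega>. (Q 0 \<omega>, PX \<omega>)) = distr M borel (Q 0) \<Otimes>\<^sub>M distr M ?SX PX"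
      using asm(11) unfolding PX_def[abs_def] by (intro distr_pair_of_indep_set mQ0 mPX[unfolded PX_def[abs_def]])
    have D1: "distr M (?SA \<Otimes>\<^sub>M ?S) (\<lambda>\<omega>. (PA \<omega>, Yp \<omega>)) = distr M ?SA PA \<Otimes>\<^sub>M distr M ?S Yp"
      unfolding PA_def Yp_def using XH uT' res(1,2) D(2)
      by (intro uncorrelated_imp_indep) (auto simp: subset_iff)
    \<comment> \<open>\<open>PA\<close> and \<open>Yp\<close> are both images of \<open>PX\<close>,
      so \<open>Q 0\<close> is independent of the pair; with \<open>D1\<close> the three laws
      multiply.\<close>
    have D2: "distr M (borel \<Otimes>\<^sub>M (?SA \<Otimes>\<^sub>M ?S)) (\<lambda>\<omega>. (Q 0 \<omega>, (PA \<omega>, Yp \<omega>))) = distr M borel (Q 0) \<Otimes>\<^sub>M (distr M ?SA PA \<Otimes>\<^sub>M distr M ?S Yp)"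
      using distr_pair_map[OF mQ0 mPX D0 mid measurable_Pair[OF mg1 mg2]] unfolding g1 g2 D1 .
    have D2': "distr M (borel \<Otimes>\<^sub>M ?SA) (\<lambda>\<omega>. (Q 0 \<omega>, PA \<omega>)) = distr M borel (Q 0) \<Otimes>\<^sub>M distr M ?SA PA"
      using distr_pair_map[OF mQ0 mPX D0 mid mg1] unfolding g1 .
    let ?as = "\<lambda>p :: real \<times> (nat \<times> real \<Rightarrow> real) \<times> (real \<Rightarrow> real). ((fst p, fst (snd p)), snd (snd p))"
    have mQPA: "(\<lambda>\<omega>. (Q 0 \<omega>, PA \<omega>)) \<in> measurable M (borel \<Otimes>\<^sub>M ?SA)" by (intro measurable_Pair mQ0 mPA)
    have D3: "distr M ((borel \<Otimes>\<^sub>M ?SA) \<Otimes>\<^sub>M ?S) (\<lambda>\<omega>. ((Q 0 \<omega>, PA \<omega>), Yp \<omega>)) = distr M (borel \<Otimes>\<^sub>M ?SA) (\<lambda>\<omega>. (Q 0 \<omega>, PA \<omega>)) \<Otimes>\<^sub>M distr M ?S Yp"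
    proof -
      have "distr M ((borel \<Otimes>\<^sub>M ?SA) \<Otimes>\<^sub>M ?S) (\<lambda>\<omega>. ((Q 0 \<omega>, PA \<omega>), Yp \<omega>))
        = distr (distr M (borel \<Otimes>\<^sub>M (?SA \<Otimes>\<^sub>M ?S)) (\<lambda>\<omega>. (Q 0 \<omega>, (PA \<omega>, Yp \<omega>)))) ((borel \<Otimes>\<^sub>M ?SA) \<Otimes>\<^sub>M ?S) ?as"
        by (subst distr_distr) (auto simp: comp_def intro!: measurable_Pair mQ0 mPA mYp)
      also have "\<dots> = distr (distr M borel (Q 0) \<Otimes>\<^sub>M (distr M ?SA PA \<Otimes>\<^sub>M distr M ?S Yp))
          ((distr M borel (Q 0) \<Otimes>\<^sub>M distr M ?SA PA) \<Otimes>\<^sub>M distr M ?S Yp) ?as"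
        unfolding D2 by (intro distr_cong refl sets_pair_measure_cong) auto
      also have "\<dots> = (distr M borel (Q 0) \<Otimes>\<^sub>M distr M ?SA PA) \<Otimes>\<^sub>M distr M ?S Yp"
        by (intro distr_pair_assoc prob_space_distr mQ0 mPA mYp)
      finally show ?thesis unfolding D2' .
    qed
    define z where "z x s = \<rho> * s + (\<Sum>i\<in>I. k i * x (i, s))" for x :: "nat \<times> real \<Rightarrow> real" and s
    \<comment> \<open>\<open>\<Gamma>\<close> rebuilds the conditioning variables from
      \<open>Q 0\<close> and the past. It agrees with \<open>Tv\<close> only almost surely, since
      the queue equation and path continuity hold only so, and the passage to \<open>Tv\<close> is
      made at the level of laws.\<close>
    define \<Gamma> where "\<Gamma> p = (\<lambda>i\<in>I. snd p (i, u), reflected (dyadics u) (fst p + z (snd p) u - z (snd p) 0) (\<lambda>s. z (snd p) u - z (snd p) s))"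
      for p :: "real \<times> (nat \<times> real \<Rightarrow> real)"
    have Du: "countable (dyadics u)" "dyadics u \<subseteq> {0..u}" using countable_dyadics dyadics_subset[OF u0] by auto
    have cmpA: "(\<lambda>p. snd p r) \<in> borel_measurable (borel \<Otimes>\<^sub>M ?SA)" if "r \<in> I \<times> {0..u}" for r
      using measurable_compose[OF measurable_snd measurable_component_singleton[OF that]] .
    have mz: "(\<lambda>p. z (snd p) s) \<in> borel_measurable (borel \<Otimes>\<^sub>M ?SA)" if "s \<in> {0..u}" for s
      unfolding z_def using that by (intro borel_measurable_add borel_measurable_const borel_measurable_sum borel_measurable_times cmpA) auto
    have m\<Gamma>: "\<Gamma> \<in> measurable (borel \<Otimes>\<^sub>M ?SA) ?N"
      unfolding \<Gamma>_def using u0 Du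
      by (intro measurable_Pair measurable_restrict cmpA measurable_reflected borel_measurable_add borel_measurable_diff mz measurable_fst) auto
    have AE\<Gamma>: "AE \<omega> in M. \<Gamma> (Q 0 \<omega>, PA \<omega>) = Tv \<omega>"
      using pathZ asm(10)
    proof eventually_elim
      case (elim \<omega>)
      have path: "queue_length_path \<Delta> (\<lambda>t. Z t \<omega>) (\<lambda>t. L t \<omega>) (\<lambda>t. Q t \<omega>)"
        and cont: "continuous_on (time_set \<Delta>) (\<lambda>t. Z t \<omega>)"
        using elim unfolding T_def by blast+
      have Z: "z (PA \<omega>) s = Z s \<omega>" if "s \<in> {0..u}" for s
        using elim that uT' by (auto simp: z_def PA_def subset_iff intro!: sum.cong)
      have "Q (0 + u) \<omega> = reflected (dyadics u) (Q 0 \<omega> + Z (0 + u) \<omega> - Z 0 \<omega>) (\<lambda>s. Z (0 + u) \<omega> - Z (0 + s) \<omega>)"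
        by (rule queue_length_eq_reflected[OF path cont order_refl u0]) (use uT in \<open>simp add: T_def\<close>)
      also have "\<dots> = reflected (dyadics u) (Q 0 \<omega> + z (PA \<omega>) u - z (PA \<omega>) 0) (\<lambda>s. z (PA \<omega>) u - z (PA \<omega>) s)"
        unfolding reflected_def using Z Du u0
        by (auto intro!: arg_cong[where f=real_of_ereal] arg_cong2[where f=max] SUP_cong simp: subset_iff)
      finally show ?case using u0 by (auto simp: \<Gamma>_def Tv_def PA_def restrict_def fun_eq_iff)
    qed
    have mid': "(\<lambda>x. x) \<in> measurable ?S ?S" by simp
    have m\<Gamma>M: "(\<lambda>\<omega>. \<Gamma> (Q 0 \<omega>, PA \<omega>)) \<in> measurable M ?N" by (rule measurable_compose[OF mQPA m\<Gamma>])
    have "distr M (?N \<Otimes>\<^sub>M ?S) (\<lambda>\<omega>. (\<Gamma> (Q 0 \<omega>, PA \<omega>), Yp \<omega>)) = distr M ?N (\<lambda>\<omega>. \<Gamma> (Q 0 \<omega>, PA \<omega>)) \<Otimes>\<^sub>M distr M ?S Yp"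
      by (rule distr_pair_map[OF mQPA mYp D3 m\<Gamma> mid'])
    moreover have "distr M (?N \<Otimes>\<^sub>M ?S) (\<lambda>\<omega>. (\<Gamma> (Q 0 \<omega>, PA \<omega>), Yp \<omega>)) = distr M (?N \<Otimes>\<^sub>M ?S) (\<lambda>\<omega>. (Tv \<omega>, Yp \<omega>))"
      using AE\<Gamma> by (intro distr_cong_AE refl measurable_Pair m\<Gamma>M mYp mTv) auto
    moreover have "distr M ?N (\<lambda>\<omega>. \<Gamma> (Q 0 \<omega>, PA \<omega>)) = distr M ?N Tv"
      using AE\<Gamma> by (intro distr_cong_AE refl m\<Gamma>M mTv) auto
    ultimately show ?thesis by simp
  qed
  have rcd: "regular_conditional_distribution M ?N Tv borel (Q (u + h)) \<kappa>"
    unfolding \<kappa>_def[abs_def] by (rule regular_conditional_distribution_of_independent[OF mTv mYp indep mf mQ[OF uhT] eq])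

  \<comment> \<open>\<open>\<kappa>\<close> is an explicit kernel, so its value is computed at every
    admissible \<open>x\<close>, \<open>v\<close> and \<open>q\<close> and not merely almost
    everywhere.\<close>
  have formula: "measure (\<kappa> (x, v)) {..q} = (LINT y:{..q - v}|lborel. (1 - exp (- 2 * q * (q - y) / (\<Theta> * h))) *
      normal_density (\<rho>x x * h) (sqrt (h * (\<Theta> - \<tau>u * h))) y)"
    if x: "x \<in> I \<rightarrow>\<^sub>E UNIV" and v: "0 \<le> v" and q: "0 \<le> q" for x v q
  proof -
    have fm: "(\<lambda>y. f ((x, v), y)) \<in> borel_measurable ?S"
      by (rule measurable_Pair2[OF mf]) (use x in \<open>auto simp: space_pair_measure space_PiM\<close>)
    have fm': "(\<lambda>\<omega>. f ((x, v), Yp \<omega>)) \<in> borel_measurable M" by (rule measurable_compose[OF mYp fm])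
    have mR: "R s \<in> borel_measurable M" if "s \<in> dyadics h" for s
      using R D(2) that by (intro measurable_H) auto
    have "measure (\<kappa> (x, v)) {..q} = prob {\<omega>\<in>space M. f ((x, v), Yp \<omega>) \<le> q}"
      unfolding \<kappa>_def using fm fm' mYp
      by (simp add: distr_distr comp_def measure_distr) (auto intro!: arg_cong[where f=prob])
    also have "\<dots> = prob {\<omega>\<in>space M. R h \<omega> + \<rho>x x * h \<le> q - v \<and> (\<forall>s\<in>dyadics h. R s \<omega> + \<rho>x x * s \<le> q)}"
    proof (rule finite_measure_eq_AE)
      show "AE \<omega> in M. \<omega> \<in> {\<omega>\<in>space M. f ((x, v), Yp \<omega>) \<le> q} \<longleftrightarrow>
          \<omega> \<in> {\<omega>\<in>space M. R h \<omega> + \<rho>x x * h \<le> q - v \<and> (\<forall>s\<in>dyadics h. R s \<omega> + \<rho>x x * s \<le> q)}"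
        using contY
      proof eventually_elim
        case (elim \<omega>)
        let ?g = "\<lambda>s. \<rho>x x * (h - s) + Y h \<omega> - Y s \<omega>"
        have "bdd_above (?g ` {0..h})"
          by (intro bounded_imp_bdd_above compact_imp_bounded compact_continuous_image compact_Icc continuous_intros elim)
        then obtain B where B: "\<And>s. s \<in> {0..h} \<Longrightarrow> ?g s \<le> B" unfolding bdd_above_def by blast
        have g: "\<rho>x x * (h - s) + Yp \<omega> h - Yp \<omega> s = ?g s" if "s \<in> dyadics h" for s
          using that D(3) by (simp add: Yp_def)
        have gB: "\<rho>x x * (h - s) + Yp \<omega> h - Yp \<omega> s \<le> B" if "s \<in> dyadics h" for s
          unfolding g[OF that] using B D(2) that by blast
        have "f ((x, v), Yp \<omega>) \<le> q \<longleftrightarrow> v + \<rho>x x * h + Yp \<omega> h \<le> q \<and> (\<forall>s\<in>dyadics h. \<rho>x x * (h - s) + Yp \<omega> h - Yp \<omega> s \<le> q)"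
          unfolding f_def prod.case fst_conv snd_conv by (rule reflected_le_iff[OF gB])
        also have "\<dots> \<longleftrightarrow> v + \<rho>x x * h + Y h \<omega> \<le> q \<and> (\<forall>s\<in>dyadics h. ?g s \<le> q)"
          using g D(3) by (simp add: Yp_def)
        \<comment> \<open>Substituting \<open>h - s\<close> for \<open>s\<close>, which preserves
          the dyadic times, exchanges future increments of \<open>Y\<close> with values of
          \<open>R\<close>.\<close>
        also have "(\<forall>s\<in>dyadics h. ?g s \<le> q) \<longleftrightarrow> (\<forall>s\<in>dyadics h. R s \<omega> + \<rho>x x * s \<le> q)"
        proof safe
          fix s assume *: "\<forall>s\<in>dyadics h. ?g s \<le> q" "s \<in> dyadics h"
          then show "R s \<omega> + \<rho>x x * s \<le> q" using *(1)[rule_format, OF dyadics_reflect[OF *(2)]] by (simp add: R_def)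
        next
          fix s assume *: "\<forall>s\<in>dyadics h. R s \<omega> + \<rho>x x * s \<le> q" "s \<in> dyadics h"
          then show "?g s \<le> q" using *(1)[rule_format, OF dyadics_reflect[OF *(2)]] by (simp add: R_def)
        qed
        \<comment> \<open>\<open>Y 0\<close> vanishes identically, because its prediction
          coefficient is 1; hence \<open>R h = Y h\<close>.\<close>
        also have "v + \<rho>x x * h + Y h \<omega> \<le> q \<longleftrightarrow> R h \<omega> + \<rho>x x * h \<le> q - v"
          by (auto simp: R_def Y_def)
        finally show ?case by simp
      qed
      show "{\<omega>\<in>space M. f ((x, v), Yp \<omega>) \<le> q} \<in> events" using fm' by measurable
      have "Measurable.pred M (\<lambda>\<omega>. \<forall>s\<in>dyadics h. R s \<omega> + \<rho>x x * s \<le> q)"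
        using mR by (intro pred_Ball_countable[OF D(1)]) measurable
      then show "{\<omega>\<in>space M. R h \<omega> + \<rho>x x * h \<le> q - v \<and> (\<forall>s\<in>dyadics h. R s \<omega> + \<rho>x x * s \<le> q)} \<in> events"
        using mR[OF D(3)] by measurable
    qed
    also have "\<dots> = (LINT y:{..q - v}|lborel. (1 - exp (- 2 * q * (q - y) / (\<Theta> * h))) *
      normal_density (\<rho>x x * h) (sqrt (h * (\<Theta> - \<tau>u * h))) y)"
      \<comment> \<open>The endpoint bound is \<open>c = q - v\<close>, and \<open>v \<ge> 0\<close>
        makes it at most \<open>q\<close>.\<close>
      using v by (intro prob_stays_below q) simp
    finally show ?thesis .
  qed
  show ?thesis
    unfolding I_def[symmetric] Tv_def[symmetric] a_def[symmetric] Let_def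
      \<Theta>_def[symmetric] \<tau>u_def[symmetric] \<rho>x_def[symmetric]
  proof (intro exI[of _ \<kappa>] conjI ballI allI impI)
    show "regular_conditional_distribution M ?N Tv borel (Q (u + h)) \<kappa>" by (rule rcd)
  qed (rule trans[OF formula bridge_crossing_integral[OF \<Theta> h0 pos]])
qed

end
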